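(* Let $\varepsilon \in [0,1]$ and $\delta \in [0,1]$. Then, for $z, z^* \in X$, one has $[z,z^*] \in \partial \Psi^{(\varepsilon,\delta)}$ in $X \times X$ if and only if there exist $\varpi^* \in Y \cap L^\infty(\Omega)$ and $\xi \in X$ such that (i) $z \in H^2(\Omega)$ and $(\varpi^* + \nu^2 \partial_x z)(\pm L) = 0$; (ii) $z^* = -\partial_x \varpi^* - \nu^2 \partial_x^2 z + \xi$ in $X$, where $\varpi^* \in \partial f^\varepsilon(\partial_x z)$ and $\xi \in K^\delta(z)$ a.e. in $\Omega$.
   Context: Let $0<L<\infty$, $\Omega := (-L,L) \subset \mathbb{R}$, $X := L^2(\Omega)$, $Y := H^1(\Omega)\ (\subset C(\overline{\Omega}))$; $\partial_x$ is the distributional derivative. Let $\nu>0$ be a fixed constant. Subdifferential: for a proper, lower semicontinuous (l.s.c.), convex $\psi: H \to (-\infty,\infty]$ on a Hilbert space $H$, $\partial\psi$ denotes its subdifferential, identified with its graph in $H\times H$. Mosco convergence: for proper l.s.c. convex functions $\psi_n,\psi$ on a Hilbert space $H$, $\psi_n \to \psi$ in the sense of Mosco iff (M1) $\liminf_n \psi_n(w_n) \ge \psi(w)$ whenever $w_n \to w$ weakly in $H$; (M2) for every $w \in D(\psi)$ there are $w_n \to w$ in $H$ with $\psi_n(w_n) \to \psi(w)$. For a family with a continuous parameter, convergence is meant along every sequence of parameters converging to the given limit. Assumption on $f^\varepsilon$: $f^0(r) := |r|$; $\{f^\varepsilon\}_{\varepsilon\in(0,1]} \subset C^2(\mathbb{R})$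 are convex functions with $f^\varepsilon(0)=0$, $f^\varepsilon \ge 0$ on $\mathbb{R}$; for every $\varepsilon_0 \in [0,1]$, as $\varepsilon \to \varepsilon_0$, $f^\varepsilon(r) \to f^{\varepsilon_0}(r)$ for every $r\in\mathbb{R}$ and $f^\varepsilon \to f^{\varepsilon_0}$ on $\mathbb{R}$ in the sense of Mosco; there is $C_0>0$ independent of $\varepsilon$ with $|(f^\varepsilon)'(r)| \le C_0(1+|r|)$ for all $r \in \mathbb{R}$, $\varepsilon\in(0,1]$; and for every $\lambda>0$, $(f^\varepsilon)'' \to 0$ uniformly on $\{|r| \ge \lambda\}$ as $\varepsilon \to 0$. For $\varepsilon\in(0,1]$, $\partial f^\varepsilon(r) = \{(f^\varepsilon)'(r)\}$; $\partial f^0(r) = \{r/|r|\}$ if $r\neq 0$, $\partial f^0(0)=[-1,1]$. Assumption on $K^\delta$: $\hat K^0 := I_{[-1,1]}$ (equal to $0$ on $[-1,1]$ and $+\infty$ elsewhere) and $K^0 := \partial I_{[-1,1]}$ (set-valued). $\{\hat K^\delta\}_{\delta\in(0,1]} \subset C^2(\mathbb{R})$ and $\{K^\delta\}_{\delta\in(0,1]} \subset C^1(\mathbb{R})$ satisfy: $K^\delta = (\hat K^\delta)'$ and $\hat K^\delta \equiv 0$ on $[-1,1]$ for all $\delta\in(0,1]$; for each $\delta\in(0,1]$ there is $C_K^\delta>0$ with $0 \le (K^\delta)' \le C_K^\delta$ on $\mathbb{R}$; for every $\delta_0\in[0,1]$, $\hat K^\delta \to \hat K^{\delta_0}$ on $\mathbb{R}$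 in the sense of Mosco as $\delta\to\delta_0$, and if $\delta_0 \in (0,1]$ also $\hat K^\delta \to \hat K^{\delta_0}$ in $C_{\mathrm{loc}}(\mathbb{R})$. For $\delta\in(0,1]$, $\xi \in K^\delta(z)$ means $\xi = K^\delta(z)$. Functionals: for $\varepsilon,\delta\in[0,1]$, $\Psi^{(\varepsilon,\delta)}: X \to [0,\infty]$ is the proper l.s.c. convex function $$\Psi^{(\varepsilon,\delta)}(z) := \int_\Omega f^\varepsilon(\partial_x z)\,dx + \frac{\nu^2}{2}\int_\Omega |\partial_x z|^2\,dx + \int_\Omega \hat K^\delta(z)\,dx \ \text{ if } z\in Y, \qquad \Psi^{(\varepsilon,\delta)}(z) := \infty \ \text{ otherwise.}$$ *)

theory Defs
  imports "HOL-Analysis.Analysis"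
begin

section \<open>Convex analysis\<close>

text \<open>
  A Hilbert space is given by a carrier and an inner product, so that the same definition serves
  the real line and \<open>L\<^sup>2(\<Omega>)\<close>, whose elements are represented below by functions. The
  subdifferential is identified with its graph.
\<close>

definition subdifferential ::
    "'a::minus set \<Rightarrow> ('a \<Rightarrow> 'a \<Rightarrow> real) \<Rightarrow> ('a \<Rightarrow> ereal) \<Rightarrow> ('a \<times> 'a) set" where
  "subdifferential H ip \<psi> =
     {(z, zs). z \<in> H \<and> zs \<in> H \<and> \<psi> z < \<infinity> \<and> (\<forall>w\<in>H. \<psi> z + ereal (ip zs (w - z)) \<le> \<psi> w)}"

abbreviation subdifferential_real :: "(real \<Rightarrow> ereal) \<Rightarrow> (real \<times> real) set" where
  "subdifferential_real \<equiv> subdifferential UNIV inner"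

definition weakly_converges :: "(nat \<Rightarrow> 'a::real_inner) \<Rightarrow> 'a \<Rightarrow> bool" where
  "weakly_converges w x \<longleftrightarrow> (\<forall>v. (\<lambda>n. w n \<bullet> v) \<longlonglongrightarrow> x \<bullet> v)"

definition mosco_converges :: "(nat \<Rightarrow> 'a::real_inner \<Rightarrow> ereal) \<Rightarrow> ('a \<Rightarrow> ereal) \<Rightarrow> bool" where
  "mosco_converges \<psi>s \<psi> \<longleftrightarrow>
     (\<forall>w x. weakly_converges w x \<longrightarrow> \<psi> x \<le> liminf (\<lambda>n. \<psi>s n (w n))) \<and>
     (\<forall>x. \<psi> x < \<infinity> \<longrightarrow> (\<exists>w. w \<longlonglongrightarrow> x \<and> (\<lambda>n. \<psi>s n (w n)) \<longlonglongrightarrow> \<psi> x))"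

definition mosco_continuous_at ::
    "(real \<Rightarrow> 'a::real_inner \<Rightarrow> ereal) \<Rightarrow> real set \<Rightarrow> real \<Rightarrow> bool" where
  "mosco_continuous_at \<psi> P p \<longleftrightarrow>
     (\<forall>s. (\<forall>n. s n \<in> P) \<longrightarrow> s \<longlonglongrightarrow> p \<longrightarrow> mosco_converges (\<lambda>n. \<psi> (s n)) (\<psi> p))"


section \<open>Function spaces on \<open>\<Omega> = (-L, L)\<close>\<close>

text \<open>
  Elements of \<open>L\<^sup>2\<close>, \<open>L\<^sup>\<infinity>\<close> and the Sobolev spaces are represented by functions; the values outside
  \<open>\<Omega>\<close> and on null sets are irrelevant, and equality in these spaces is equality almost everywhere.
\<close>

definition Ck :: "nat \<Rightarrow> (real \<Rightarrow> real) \<Rightarrow> bool" where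
  "Ck k g \<longleftrightarrow> (\<forall>i<k. \<forall>x. (deriv ^^ i) g field_differentiable at x) \<and>
              continuous_on UNIV ((deriv ^^ k) g)"

abbreviation Om :: "real \<Rightarrow> real set" where
  "Om L \<equiv> {-L<..<L}"

definition test_functions :: "real \<Rightarrow> (real \<Rightarrow> real) set" where
  "test_functions L = {\<phi>. (\<forall>k. Ck k \<phi>) \<and> closure {x. \<phi> x \<noteq> 0} \<subseteq> Om L}"

definition L2 :: "real \<Rightarrow> (real \<Rightarrow> real) set" where
  "L2 L = {u \<in> borel_measurable (lebesgue_on (Om L)).
             integrable (lebesgue_on (Om L)) (\<lambda>x. (u x)\<^sup>2)}"

definition L2_inner :: "real \<Rightarrow> (real \<Rightarrow> real) \<Rightarrow> (real \<Rightarrow> real) \<Rightarrow> real" where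
  "L2_inner L u v = (LINT x|lebesgue_on (Om L). u x * v x)"

definition Linf :: "real \<Rightarrow> (real \<Rightarrow> real) set" where
  "Linf L = {u \<in> borel_measurable (lebesgue_on (Om L)).
               \<exists>C. AE x in lebesgue_on (Om L). \<bar>u x\<bar> \<le> C}"

text \<open>
  Local integrability of \<open>v\<close> cannot be dropped: the integral of a non-integrable function is \<open>0\<close>
  by convention.
\<close>

definition has_weak_deriv :: "real \<Rightarrow> (real \<Rightarrow> real) \<Rightarrow> (real \<Rightarrow> real) \<Rightarrow> bool" where
  "has_weak_deriv L u v \<longleftrightarrow>
     (\<forall>S. compact S \<and> S \<subseteq> Om L \<longrightarrow> u absolutely_integrable_on S \<and> v absolutely_integrable_on S) \<and>
     (\<forall>\<phi>\<in>test_functions L.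
        (LINT x|lebesgue_on (Om L). u x * deriv \<phi> x) = - (LINT x|lebesgue_on (Om L). v x * \<phi> x))"

text \<open>A representative of \<open>\<partial>\<^sub>x u\<close>; it is unique almost everywhere in \<open>\<Omega>\<close> if it exists.\<close>

definition weak_deriv :: "real \<Rightarrow> (real \<Rightarrow> real) \<Rightarrow> real \<Rightarrow> real" where
  "weak_deriv L u = (SOME v. has_weak_deriv L u v)"

definition H1 :: "real \<Rightarrow> (real \<Rightarrow> real) set" where
  "H1 L = {u \<in> L2 L. \<exists>v\<in>L2 L. has_weak_deriv L u v}"

definition H2 :: "real \<Rightarrow> (real \<Rightarrow> real) set" where
  "H2 L = {u \<in> L2 L. \<exists>v\<in>H1 L. has_weak_deriv L u v}"

text \<open>
  The representative in \<open>C([-L, L])\<close> of an element of \<open>H\<^sup>1(\<Omega>)\<close>, which gives it values at \<open>\<plusminus>L\<close>. On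
  \<open>[-L, L]\<close> it is unique.
\<close>

definition cont_rep :: "real \<Rightarrow> (real \<Rightarrow> real) \<Rightarrow> real \<Rightarrow> real" where
  "cont_rep L u =
     (SOME g. continuous_on {-L..L} g \<and> (AE x in lebesgue_on (Om L). g x = u x))"


section \<open>The families \<open>f\<^sup>\<epsilon>\<close> and \<open>K\<^sup>\<delta>\<close>\<close>

definition f_family :: "(real \<Rightarrow> real \<Rightarrow> real) \<Rightarrow> bool" where
  "f_family f \<longleftrightarrow>
     (\<forall>r. f 0 r = \<bar>r\<bar>) \<and>
     (\<forall>\<epsilon>\<in>{0<..1}. Ck 2 (f \<epsilon>) \<and> convex_on UNIV (f \<epsilon>) \<and> f \<epsilon> 0 = 0 \<and> (\<forall>r. 0 \<le> f \<epsilon> r)) \<and>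
     (\<forall>\<epsilon>0\<in>{0..1}. (\<forall>r. ((\<lambda>\<epsilon>. f \<epsilon> r) \<longlongrightarrow> f \<epsilon>0 r) (at \<epsilon>0 within {0..1})) \<and>
                   mosco_continuous_at (\<lambda>\<epsilon> r. ereal (f \<epsilon> r)) {0..1} \<epsilon>0) \<and>
     (\<exists>C0>0. \<forall>\<epsilon>\<in>{0<..1}. \<forall>r. \<bar>deriv (f \<epsilon>) r\<bar> \<le> C0 * (1 + \<bar>r\<bar>)) \<and>
     (\<forall>c>0. uniform_limit {r. c \<le> \<bar>r\<bar>} (\<lambda>\<epsilon>. deriv (deriv (f \<epsilon>))) (\<lambda>r. 0) (at_right 0))"

text \<open>
  The potentials \<open>Khat \<delta>\<close> and functions \<open>K \<delta>\<close> are real-valued data used only for \<open>0 < \<delta> \<le> 1\<close>. The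
  full families, including the extended-valued and set-valued members at \<open>\<delta> = 0\<close>, are
  \<open>Khat_ext\<close> and \<open>K_set\<close>.
\<close>

definition Khat_ext :: "(real \<Rightarrow> real \<Rightarrow> real) \<Rightarrow> real \<Rightarrow> real \<Rightarrow> ereal" where
  "Khat_ext Khat \<delta> z = (if \<delta> = 0 then (if z \<in> {-1..1} then 0 else \<infinity>) else ereal (Khat \<delta> z))"

definition K_set ::
    "(real \<Rightarrow> real \<Rightarrow> real) \<Rightarrow> (real \<Rightarrow> real \<Rightarrow> real) \<Rightarrow> real \<Rightarrow> real \<Rightarrow> real set" where
  "K_set Khat K \<delta> z =
     (if \<delta> = 0 then {\<xi>. (z, \<xi>) \<in> subdifferential_real (Khat_ext Khat 0)} else {K \<delta> z})"

definition K_family :: "(real \<Rightarrow> real \<Rightarrow> real) \<Rightarrow> (real \<Rightarrow> real \<Rightarrow> real) \<Rightarrow> bool" where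
  "K_family Khat K \<longleftrightarrow>
     (\<forall>\<delta>\<in>{0<..1}. Ck 2 (Khat \<delta>) \<and> Ck 1 (K \<delta>) \<and> K \<delta> = deriv (Khat \<delta>) \<and>
        (\<forall>z\<in>{-1..1}. Khat \<delta> z = 0) \<and>
        (\<exists>C>0. \<forall>z. 0 \<le> deriv (K \<delta>) z \<and> deriv (K \<delta>) z \<le> C)) \<and>
     (\<forall>\<delta>0\<in>{0..1}. mosco_continuous_at (Khat_ext Khat) {0..1} \<delta>0) \<and>
     (\<forall>\<delta>0\<in>{0<..1}. \<forall>S. compact S \<longrightarrow> uniform_limit S Khat (Khat \<delta>0) (at \<delta>0 within {0<..1}))"


section \<open>The functionals \<open>\<Psi>\<close>\<close>

text \<open>
  All integrands are non-negative (\<open>Khat \<delta>\<close> is convex with minimum \<open>0\<close>), so the conversions to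
  \<open>ennreal\<close> do not truncate.
\<close>

definition Psi :: "real \<Rightarrow> real \<Rightarrow> (real \<Rightarrow> real \<Rightarrow> real) \<Rightarrow> (real \<Rightarrow> real \<Rightarrow> real) \<Rightarrow>
    real \<Rightarrow> real \<Rightarrow> (real \<Rightarrow> real) \<Rightarrow> ereal" where
  "Psi L \<nu> f Khat \<epsilon> \<delta> z =
     (if z \<in> H1 L then enn2ereal (
        (\<integral>\<^sup>+x. ennreal (f \<epsilon> (weak_deriv L z x)) \<partial>lebesgue_on (Om L)) +
        ennreal (\<nu>\<^sup>2 / 2) * (\<integral>\<^sup>+x. ennreal ((weak_deriv L z x)\<^sup>2) \<partial>lebesgue_on (Om L)) +
        (\<integral>\<^sup>+x. e2ennreal (Khat_ext Khat \<delta> (z x)) \<partial>lebesgue_on (Om L)))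
      else \<infinity>)"

end

theory Submission
  imports Defs
begin

text \<open>
  In one space dimension the functional can be read in terms of the derivative: a function of
  \<open>H\<^sup>1(\<Omega>)\<close> is \<open>c + \<integral> r\<close> with \<open>r \<in> L\<^sup>2(\<Omega>)\<close>, and \<open>\<Psi>\<close> becomes
  \<open>\<integral> G(r) + \<integral> Khat(c + \<integral> r)\<close> with \<open>G(p) = f(p) + \<nu>\<^sup>2 p\<^sup>2 / 2\<close>. The pair \<open>(z, z\<^sup>*)\<close> lies in the
  subdifferential iff \<open>z\<close> minimises \<open>\<Psi>(w) - \<integral> z\<^sup>* w\<close>. Write \<open>v = z'\<close>. The conditions (i), (ii) say that some
  multiplier \<open>\<sigma> = \<omega> + \<nu>\<^sup>2 v\<close> with \<open>\<sigma>(\<plusminus>L) = 0\<close> satisfies \<open>\<sigma> \<in> \<partial>G(v)\<close> and \<open>\<sigma>' + z\<^sup>* = \<xi> \<in> K(z)\<close>.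

  That these conditions suffice is the pointwise subgradient inequality for \<open>G\<close> and \<open>Khat\<close>,
  integrated over \<open>\<Omega>\<close>; an integration by parts turns \<open>\<integral> \<sigma> (w - z)'\<close> into \<open>- \<integral> \<sigma>' (w - z)\<close>
  (\<open>sufficiency\<close>).

  For necessity the difficulty is to select \<open>\<sigma>\<close>, because both \<open>\<partial>f\<close> (at \<open>\<epsilon> = 0\<close>) and \<open>K\<close> (at \<open>\<delta> = 0\<close>)
  may be set-valued. The first variation of a minimiser gives
  \<open>0 \<le> \<integral> max (q a) (q b) + \<integral> max (\<phi> l) (\<phi> u)\<close>, where \<open>\<phi>' = q\<close>,
  for all bounded \<open>q\<close>, where \<open>[a, b] = \<partial>G(v)\<close> and \<open>[l, u]\<close> is the set of slopes allowed for \<open>\<sigma>\<close>.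
  Taking for \<open>\<phi>\<close> an approximation of plus or minus the indicator function of an interval with end
  points \<open>s\<close>, \<open>t\<close>, one gets
  \<open>a(t) - b(s) \<le> d(s, t)\<close>, where \<open>d(s, t)\<close> is the largest value of \<open>\<sigma>(t) - \<sigma>(s)\<close> compatible with
  \<open>l \<le> \<sigma>' \<le> u\<close>. This is exactly the condition under which McShane's extension formula
  \<open>\<sigma>(t) = inf\<^sub>s (b(s) + d(s, t))\<close> produces a function between \<open>a\<close> and \<open>b\<close> whose increments are bounded by
  \<open>d\<close>, and by the Radon--Nikodym theorem such a function is a primitive of some \<open>\<eta>\<close> with
  \<open>l \<le> \<eta> \<le> u\<close> (\<open>prim_between_density\<close>, \<open>prim_interpolation\<close>, \<open>multiplier_exists\<close>). Setting
  \<open>a = b = l = u = 0\<close> outside \<open>\<Omega>\<close> makes the boundary conditions a part of the same statement.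

  For \<open>\<delta> > 0\<close> the potential is differentiable and \<open>l = u = K(z) - z\<^sup>*\<close>. For the obstacle \<open>\<delta> = 0\<close> the
  competitors are truncated to \<open>[-1, 1]\<close>; truncation does not increase \<open>\<integral> G\<close>, and it leads to
  \<open>-z\<^sup>* \<le> \<sigma>' \<le> max (-z\<^sup>*) 0\<close> where \<open>z = 1\<close>, to the mirrored bounds where \<open>z = -1\<close>, and to
  \<open>\<sigma>' = -z\<^sup>*\<close> elsewhere. So the multiplier of the obstacle lies in \<open>L\<^sup>2\<close> by construction, being
  bounded by \<open>\<bar>z\<^sup>*\<bar>\<close>. Finally \<open>\<partial>G\<close> is
  strongly monotone, hence \<open>\<nu>\<^sup>2 \<bar>v(s) - v(t)\<bar> \<le> \<bar>\<sigma>(s) - \<sigma>(t)\<bar>\<close>, and the interpolation lemma applied a second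
  time gives \<open>v \<in> H\<^sup>1\<close>, that is, \<open>z \<in> H\<^sup>2\<close> (\<open>derivative_regular\<close>).
\<close>

section \<open>Primitives of integrable functions\<close>

abbreviation leb :: "real \<Rightarrow> real measure" where
  "leb L \<equiv> lebesgue_on (Om L)"

text \<open>
  The argument \<open>x\<close> ranges over the whole line, so that a primitive is constant to the left and to the
  right of \<open>\<Omega>\<close>; the multiplier is constructed on the whole line.
\<close>

definition prim :: "real \<Rightarrow> (real \<Rightarrow> real) \<Rightarrow> real \<Rightarrow> real" where
  "prim L r x = (LINT y|leb L. r y * indicator {..x} y)"

lemma borel_measurable_Om [measurable (raw)]:
  "g \<in> borel_measurable borel \<Longrightarrow> g \<in> borel_measurable (leb L)"
  by (intro measurable_restrict_space1) (simp add: measurable_completion)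

lemma integrable_mult_ind:
  fixes r :: "real \<Rightarrow> real"
  assumes "integrable (leb L) r" "S \<in> sets borel"
  shows "integrable (leb L) (\<lambda>y. r y * indicator S y)"
proof (rule Bochner_Integration.integrable_bound[OF assms(1)])
  show "(\<lambda>y. r y * indicator S y) \<in> borel_measurable (leb L)"
    by (intro borel_measurable_times borel_measurable_integrable[OF assms(1)] borel_measurable_Om
        borel_measurable_indicator assms(2))
qed (auto simp: indicator_def)

lemma prim_diff:
  assumes "integrable (leb L) r" "x \<le> y"
  shows "prim L r y - prim L r x = (LINT t|leb L. r t * indicator {x<..y} t)"
proof -
  have "prim L r y - prim L r x =
      (LINT t|leb L. r t * indicator {..y} t - r t * indicator {..x} t)"
    unfolding prim_def by (intro Bochner_Integration.integral_diff[symmetric] integrable_mult_ind assms) auto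
  also have "\<dots> = (LINT t|leb L. r t * indicator {x<..y} t)"
    using assms(2) by (intro Bochner_Integration.integral_cong) (auto simp: indicator_def)
  finally show ?thesis .
qed

text \<open>
  Interval measures and densities on the line are Borel measures, while the functions on \<open>\<Omega>\<close> are
  only Lebesgue measurable. Passing to a Borel representative, extended by zero, connects the two.
\<close>

lemma lebesgue_on_Om_to_lborel:
  fixes g :: "real \<Rightarrow> real"
  assumes g: "integrable (leb L) g"
  obtains g' where "g' \<in> borel_measurable borel" "integrable lborel g'"
    "AE x in leb L. g' x = g x" "\<And>x. x \<notin> Om L \<Longrightarrow> g' x = 0"
    "\<And>S. S \<in> sets borel \<Longrightarrow>
      (LINT t|leb L. g t * indicator S t) = (LINT t|lborel. g' t * indicator S t)"
proof -
  have i: "integrable lebesgue (\<lambda>x. indicator (Om L) x * g x)"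
    using g by (subst (asm) integrable_restrict_space) auto
  then obtain h where h: "h \<in> borel_measurable lborel" "AE x in lborel. indicator (Om L) x * g x = h x"
    using completion_ex_borel_measurable_real[of "\<lambda>x. indicator (Om L) x * g x" lborel] by auto
  define g' where "g' x = indicator (Om L) x * h x" for x
  have g': "g' \<in> borel_measurable lborel" "AE x in lborel. indicator (Om L) x * g x = g' x"
    unfolding g'_def using h by (auto elim!: eventually_mono simp: indicator_def)
  have out: "g' x = 0" if "x \<notin> Om L" for x using that by (simp add: g'_def)
  have g'b: "g' \<in> borel_measurable borel" using g'(1) by simp
  have ae: "AE x in lebesgue. indicator (Om L) x * g x = g' x"
    using g'(2) by (rule AE_completion)
  have i': "integrable lebesgue g'"
    by (rule integrable_cong_AE_imp[OF i _ ae]) (use g'(1) in \<open>auto intro: measurable_completion\<close>)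
  then have i'': "integrable lborel g'" using g'(1) by (simp add: integrable_completion)
  have ae2: "AE x in leb L. g' x = g x"
    using ae by (subst AE_restrict_space_iff) (auto elim: eventually_mono)
  have eqS: "(LINT t|leb L. g t * indicator S t) = (LINT t|lborel. g' t * indicator S t)"
    if S: "S \<in> sets borel" for S
  proof -
    have "(LINT t|leb L. g t * indicator S t)
        = (LINT t|lebesgue. (indicator (Om L) t * g t) * indicator S t)"
      by (subst integral_restrict_space) (auto simp: mult.assoc)
    also have "\<dots> = (LINT t|lebesgue. g' t * indicator S t)"
    proof (rule integral_cong_AE)
      have iS: "indicator S \<in> borel_measurable lebesgue"
        using S by (intro borel_measurable_indicator) auto
      show "(\<lambda>t. indicator (Om L) t * g t * indicator S t) \<in> borel_measurable lebesgue"
        by (rule borel_measurable_times[OF borel_measurable_integrable[OF i] iS])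
      show "(\<lambda>t. g' t * indicator S t) \<in> borel_measurable lebesgue"
        by (rule borel_measurable_times[OF measurable_completion[OF g'(1)] iS])
      show "AE t in lebesgue. indicator (Om L) t * g t * indicator S t = g' t * indicator S t"
        using ae by eventually_elim simp
    qed
    also have "\<dots> = (LINT t|lborel. g' t * indicator S t)"
      by (intro integral_completion borel_measurable_times[OF g'(1)] borel_measurable_indicator) (use S in auto)
    finally show ?thesis .
  qed
  show ?thesis by (rule that[OF g'b i'' ae2 out eqS])
qed

lemma AE_Om_neq: "AE t in leb L. t \<noteq> (x::real)"
proof (subst AE_restrict_space_iff)
  show "AE t in lebesgue. t \<in> Om L \<longrightarrow> t \<noteq> x"
    using AE_completion[OF AE_lborel_singleton[of x]] by (auto elim: eventually_mono)
qed auto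

lemma isCont_integral_atMost:
  fixes r :: "real \<Rightarrow> real"
  assumes r: "integrable N r" and ri: "\<And>x. integrable N (\<lambda>t. r t * indicator {..x} t)"
    and neq: "AE t in N. t \<noteq> x"
  shows "isCont (\<lambda>x. LINT t|N. r t * indicator {..x} t) x"
  unfolding continuous_at_sequentially comp_def
proof (intro allI impI)
  fix X :: "nat \<Rightarrow> real" assume X: "X \<longlonglongrightarrow> x"
  show "(\<lambda>n. LINT t|N. r t * indicator {..X n} t) \<longlonglongrightarrow> (LINT t|N. r t * indicator {..x} t)"
  proof (rule integral_dominated_convergence[where w="\<lambda>t. \<bar>r t\<bar>"])
    show "AE t in N. (\<lambda>n. r t * indicator {..X n} t) \<longlonglongrightarrow> r t * indicator {..x} t"
      using neq
    proof eventually_elim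
      case (elim t)
      have "\<forall>\<^sub>F n in sequentially. r t * indicator {..X n} t = r t * indicator {..x} t"
      proof (cases "t < x")
        case True
        then show ?thesis
          by (intro eventually_mono[OF order_tendstoD(1)[OF X True]]) (auto simp: indicator_def)
      next
        case False
        with elim have "x < t" by simp
        then show ?thesis
          by (intro eventually_mono[OF order_tendstoD(2)[OF X \<open>x < t\<close>]]) (auto simp: indicator_def)
      qed
      then show ?case by (rule tendsto_eventually)
    qed
  qed (use r ri in \<open>auto simp: indicator_def borel_measurable_integrable\<close>)
qed

lemma prim_continuous:
  assumes r: "integrable (leb L) r"
  shows "continuous_on UNIV (prim L r)"
proof (rule continuous_at_imp_continuous_on, intro ballI)
  fix x :: real
  show "isCont (prim L r) x"
    unfolding prim_def[abs_def]
    by (rule isCont_integral_atMost[OF r integrable_mult_ind[OF r] AE_Om_neq]) simp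
qed

lemma prim_add:
  assumes "integrable (leb L) r" "integrable (leb L) s"
  shows "prim L (\<lambda>x. r x + s x) y = prim L r y + prim L s y"
  unfolding prim_def distrib_right
  by (intro Bochner_Integration.integral_add integrable_mult_ind assms) auto

lemma prim_cmult: "prim L (\<lambda>x. c * r x) y = c * prim L r y"
  unfolding prim_def by (simp add: mult.assoc)

lemma prim_mono_increments:
  assumes "integrable (leb L) r" "integrable (leb L) s"
    "AE t in leb L. r t \<le> s t" "x \<le> y"
  shows "prim L r y - prim L r x \<le> prim L s y - prim L s x"
  unfolding prim_diff[OF assms(1,4)] prim_diff[OF assms(2,4)] using assms
  by (intro integral_mono_AE integrable_mult_ind) (auto simp: indicator_def)

lemma prim_left: "x \<le> -L \<Longrightarrow> prim L r x = 0"
  unfolding prim_def by (rule integral_eq_zero_AE) (auto simp: indicator_def intro!: AE_I2)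

lemma prim_right: "L \<le> x \<Longrightarrow> prim L r x = (LINT y|leb L. r y)"
  unfolding prim_def by (rule Bochner_Integration.integral_cong) (auto simp: indicator_def)

section \<open>Functions with increments bounded by integrals\<close>

lemma measure_eqI_Ioc:
  fixes \<mu> \<nu> :: "real measure"
  assumes sets: "sets \<mu> = sets borel" "sets \<nu> = sets borel"
    and eq: "\<And>a b. a \<le> b \<Longrightarrow> emeasure \<mu> {a<..b} = emeasure \<nu> {a<..b}"
    and fin: "\<And>a b. emeasure \<mu> {a<..b} \<noteq> \<infinity>"
  shows "\<mu> = \<nu>"
proof (rule measure_eqI_generator_eq[where E="range (\<lambda>(a, b). {a<..b::real})" and \<Omega>=UNIV
      and A="\<lambda>k. {- real k<..real k}"])
  have bs: "sets (borel :: real measure) = sigma_sets UNIV (range (\<lambda>(a, b). {a<..b}))"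
    by (subst borel_sigma_sets_Ioc) (rule sets_measure_of, simp)
  show "sets \<mu> = sigma_sets UNIV (range (\<lambda>(a, b). {a<..b}))" "sets \<nu> = sigma_sets UNIV (range (\<lambda>(a, b). {a<..b}))"
    using sets bs by simp_all
  show "Int_stable (range (\<lambda>(a, b). {a<..b::real}))"
    by (auto simp: Int_stable_def)
  show "emeasure \<mu> X = emeasure \<nu> X" if X: "X \<in> range (\<lambda>(a, b). {a<..b::real})" for X
  proof -
    from X obtain a b where X: "X = {a<..b}" by auto
    show ?thesis using eq[of a b] by (cases "a \<le> b") (simp_all add: X)
  qed
  show "(\<Union>k. {- real k<..real k}) = UNIV"
  proof safe
    fix x :: real
    obtain k :: nat where "\<bar>x\<bar> < real k" using reals_Archimedean2 by blast
    then show "x \<in> (\<Union>k. {- real k<..real k})" by (auto intro!: exI[of _ k])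
  qed auto
  show "emeasure \<mu> {- real k<..real k} \<noteq> \<infinity>" for k by (rule fin)
qed auto

lemma emeasure_density_lborel:
  fixes h :: "real \<Rightarrow> real"
  assumes h: "integrable lborel h" "\<And>x. 0 \<le> h x" and S: "S \<in> sets borel"
  shows "emeasure (density lborel (\<lambda>x. ennreal (h x))) S = ennreal (LINT t|lborel. h t * indicator S t)"
proof -
  have "emeasure (density lborel (\<lambda>x. ennreal (h x))) S = (\<integral>\<^sup>+t. ennreal (h t) * indicator S t \<partial>lborel)"
    by (rule emeasure_density) (use h S in auto)
  also have "\<dots> = (\<integral>\<^sup>+t. ennreal (h t * indicator S t) \<partial>lborel)"
    by (intro nn_integral_cong) (auto simp: indicator_def)
  also have "\<dots> = ennreal (LINT t|lborel. h t * indicator S t)"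
    by (rule nn_integral_eq_integral) (use h S in \<open>auto intro: integrable_real_mult_indicator\<close>)
  finally show ?thesis .
qed

text \<open>
  A function whose increments are bounded by those of a primitive is itself a primitive. The
  absolute continuity needed for Radon--Nikodym follows from the decomposition \<open>W = m + (W - m)\<close> of the
  primitive \<open>W\<close> of \<open>w\<close> into two increasing functions: the sum of their interval measures is the measure with density
  \<open>w\<close>, which also bounds the density of each summand by \<open>w\<close>.
\<close>

lemma interval_measure_density:
  fixes m w :: "real \<Rightarrow> real"
  assumes w: "w \<in> borel_measurable borel" "\<And>x. 0 \<le> w x" "integrable lborel w"
    and m: "\<And>x y. x \<le> y \<Longrightarrow> 0 \<le> m y - m x"
    and mw: "\<And>x y. x \<le> y \<Longrightarrow> m y - m x \<le> (LINT t|lborel. w t * indicator {x<..y} t)"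
  obtains \<theta> where "\<theta> \<in> borel_measurable borel" "\<And>x. 0 \<le> \<theta> x" "AE x in lborel. \<theta> x \<le> w x"
    "\<And>x y. x \<le> y \<Longrightarrow> m y - m x = (LINT t|lborel. \<theta> t * indicator {x<..y} t)"
proof -
  define W where "W x = (LINT t|lborel. w t * indicator {..x} t)" for x
  have iw: "integrable lborel (\<lambda>t. w t * indicator S t)" if "S \<in> sets borel" for S
    by (rule integrable_real_mult_indicator) (use w that in auto)
  have Wd: "W y - W x = (LINT t|lborel. w t * indicator {x<..y} t)" if "x \<le> y" for x y
  proof -
    have "W y - W x = (LINT t|lborel. w t * indicator {..y} t - w t * indicator {..x} t)"
      unfolding W_def by (intro Bochner_Integration.integral_diff[symmetric] iw) auto
    also have "\<dots> = (LINT t|lborel. w t * indicator {x<..y} t)"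
      using that by (intro Bochner_Integration.integral_cong) (auto simp: indicator_def)
    finally show ?thesis .
  qed
  have Wc: "isCont W x" for x
    unfolding W_def[abs_def] by (rule isCont_integral_atMost[OF w(3) iw AE_lborel_singleton]) simp
  define n where "n x = W x - m x" for x
  have nmono: "0 \<le> n y - n x" if "x \<le> y" for x y
    using mw[OF that] Wd[OF that] by (simp add: n_def)
  have mc: "isCont m x" for x
  proof -
    have bd: "\<bar>m y - m x\<bar> \<le> \<bar>W y - W x\<bar>" for y
      using m[of x y] m[of y x] mw[of x y] mw[of y x] Wd[of x y] Wd[of y x] by linarith
    have "((\<lambda>y. W y - W x) \<longlongrightarrow> 0) (at x)"
      using Wc[of x] by (simp add: isCont_def LIM_zero_iff)
    then have "((\<lambda>y. m y - m x) \<longlongrightarrow> 0) (at x)"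
      by (rule Lim_null_comparison[rotated, OF tendsto_rabs_zero]) (auto simp: bd)
    then show ?thesis by (simp add: isCont_def LIM_zero_iff)
  qed
  have nc: "isCont n x" for x
    unfolding n_def by (intro continuous_intros Wc mc)
  have rc: "continuous (at_right x) m" "continuous (at_right x) n" for x
    using mc[of x] nc[of x] by (auto intro: continuous_at_imp_continuous_at_within)
  let ?N1 = "interval_measure m" and ?N2 = "interval_measure n"
  have mm: "x \<le> y \<Longrightarrow> m x \<le> m y" and nn: "x \<le> y \<Longrightarrow> n x \<le> n y" for x y
    using m[of x y] nmono[of x y] by auto
  define S where "S = measure_of UNIV (sets borel) (\<lambda>A. emeasure ?N1 A + emeasure ?N2 A)"
  have sS: "sets S = sets borel" "space S = UNIV" unfolding S_def
    using sets.sigma_sets_eq[of "borel::real measure"] by (auto simp: sets.space_closed)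
  have eS: "emeasure S A = emeasure ?N1 A + emeasure ?N2 A" if A: "A \<in> sets borel" for A
    unfolding S_def
  proof (rule emeasure_measure_of_sigma)
    show "sigma_algebra UNIV (sets (borel::real measure))"
      using sets.sigma_algebra_axioms[of "borel::real measure"] by simp
    show "positive (sets borel) (\<lambda>A. emeasure ?N1 A + emeasure ?N2 A)"
      by (simp add: positive_def)
    show "countably_additive (sets borel) (\<lambda>A. emeasure ?N1 A + emeasure ?N2 A)"
      by (auto intro!: countably_additiveI simp: suminf_add[symmetric] suminf_emeasure)
  qed (use A in auto)
  have SD: "S = density lborel (\<lambda>x. ennreal (w x))"
  proof (rule measure_eqI_Ioc)
    fix a b :: real
    show "emeasure S {a<..b} \<noteq> \<infinity>"
      by (cases "a \<le> b") (simp_all add: eS emeasure_interval_measure_Ioc_eq mm nn rc)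
    assume ab: "a \<le> b"
    have "emeasure S {a<..b} = ennreal (m b - m a) + ennreal (n b - n a)"
      using eS[of "{a<..b}"] emeasure_interval_measure_Ioc[OF ab mm rc(1)]
        emeasure_interval_measure_Ioc[OF ab nn rc(2)] by simp
    also have "\<dots> = ennreal (W b - W a)"
      using m[OF ab] nmono[OF ab] by (simp flip: ennreal_plus) (simp add: n_def)
    finally show "emeasure S {a<..b} = emeasure (density lborel (\<lambda>x. ennreal (w x))) {a<..b}"
      using emeasure_density_lborel[OF w(3,2), of "{a<..b}"] Wd[OF ab] by simp
  qed (simp_all add: sS)
  have ac: "absolutely_continuous lborel ?N1" "absolutely_continuous lborel ?N2"
  proof -
    have "emeasure ?N1 A = 0 \<and> emeasure ?N2 A = 0" if "A \<in> null_sets lborel" for A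
    proof -
      have "A \<in> null_sets (density lborel (\<lambda>x. ennreal (w x)))"
        using absolutely_continuousI_density[of "\<lambda>x. ennreal (w x)" lborel] w that
        unfolding absolutely_continuous_def by auto
      then have "emeasure S A = 0" using SD by auto
      moreover have "A \<in> sets borel" using that by auto
      ultimately show ?thesis using eS by simp
    qed
    then show "absolutely_continuous lborel ?N1" "absolutely_continuous lborel ?N2"
      unfolding absolutely_continuous_def by (auto simp: null_sets_def)
  qed
  obtain F where F: "F \<in> borel_measurable lborel" "density lborel F = ?N1"
    using sigma_finite_measure.Radon_Nikodym[OF sigma_finite_lborel ac(1)] by auto
  obtain G where G: "G \<in> borel_measurable lborel" "density lborel G = ?N2"
    using sigma_finite_measure.Radon_Nikodym[OF sigma_finite_lborel ac(2)] by auto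
  have "density lborel (\<lambda>x. F x + G x) = density lborel (\<lambda>x. ennreal (w x))"
  proof (rule measure_eqI)
    fix A assume "A \<in> sets (density lborel (\<lambda>x. F x + G x))"
    then have A: "A \<in> sets borel" by simp
    have "emeasure (density lborel (\<lambda>x. F x + G x)) A = (\<integral>\<^sup>+t. F t * indicator A t + G t * indicator A t \<partial>lborel)"
      using F(1) G(1) A by (subst emeasure_density) (auto simp: distrib_right)
    also have "\<dots> = emeasure (density lborel F) A + emeasure (density lborel G) A"
      using F(1) G(1) A by (subst nn_integral_add) (auto simp: emeasure_density)
    also have "\<dots> = emeasure S A" using eS[OF A] F(2) G(2) by simp
    finally show "emeasure (density lborel (\<lambda>x. F x + G x)) A = emeasure (density lborel (\<lambda>x. ennreal (w x))) A"
      using SD by simp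
  qed auto
  then have FG: "AE x in lborel. F x + G x = ennreal (w x)"
    using F(1) G(1) w(1) by (subst (asm) sigma_finite_measure.density_unique_iff[OF sigma_finite_lborel]) auto
  define \<theta> where "\<theta> x = enn2real (F x)" for x
  have Ft: "AE x in lborel. F x = ennreal (\<theta> x)"
    using FG
  proof eventually_elim
    case (elim x)
    then have "F x \<le> ennreal (w x)" using le_iff_add by metis
    then have "F x < \<infinity>" by (metis ennreal_less_top infinity_ennreal_def le_less_trans)
    then show ?case by (simp add: \<theta>_def)
  qed
  have tw: "AE x in lborel. \<theta> x \<le> w x"
    using FG
  proof eventually_elim
    case (elim x)
    then have "F x \<le> ennreal (w x)" using le_iff_add by metis
    then show ?case unfolding \<theta>_def using w(2)[of x] enn2real_leI by blast
  qed
  have tb: "\<theta> \<in> borel_measurable borel" using F(1) unfolding \<theta>_def by simp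
  have t0: "0 \<le> \<theta> x" for x by (simp add: \<theta>_def)
  have it: "integrable lborel (\<lambda>t. \<theta> t * indicator S t)" if S: "S \<in> sets borel" for S
  proof (rule Bochner_Integration.integrable_bound[OF w(3)])
    show "AE x in lborel. norm (\<theta> x * indicator S x) \<le> norm (w x)"
      using tw by eventually_elim (use t0 w(2) in \<open>auto simp: indicator_def\<close>)
  qed (use tb S in auto)
  show ?thesis
  proof (rule that[OF tb t0 tw])
    fix x y :: real assume xy: "x \<le> y"
    have "ennreal (m y - m x) = emeasure (density lborel F) {x<..y}"
      using F(2) xy by (simp add: emeasure_interval_measure_Ioc mm rc)
    also have "\<dots> = (\<integral>\<^sup>+t. F t * indicator {x<..y} t \<partial>lborel)"
      using F(1) by (subst emeasure_density) auto
    also have "\<dots> = (\<integral>\<^sup>+t. ennreal (\<theta> t * indicator {x<..y} t) \<partial>lborel)"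
      using Ft by (intro nn_integral_cong_AE) (auto elim!: eventually_mono simp: indicator_def)
    also have "\<dots> = ennreal (LINT t|lborel. \<theta> t * indicator {x<..y} t)"
      by (rule nn_integral_eq_integral) (use it t0 in auto)
    finally show "m y - m x = (LINT t|lborel. \<theta> t * indicator {x<..y} t)"
      using m[OF xy] t0 by (subst (asm) ennreal_inj) (auto intro!: integral_nonneg_AE)
  qed
qed

text \<open>
  The previous lemma applied to the increasing function \<open>\<sigma> - \<integral> l\<close>. It plays the role of the theorem that an
  absolutely continuous function is differentiable almost everywhere, and it also yields the chain
  rule for truncations.
\<close>

lemma prim_between_density:
  assumes l: "integrable (leb L) l" and u: "integrable (leb L) u"
    and lu: "\<And>x. x \<in> Om L \<Longrightarrow> l x \<le> u x"
    and inc: "\<And>x y. x \<le> y \<Longrightarrow> prim L l y - prim L l x \<le> \<sigma> y - \<sigma> x"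
      "\<And>x y. x \<le> y \<Longrightarrow> \<sigma> y - \<sigma> x \<le> prim L u y - prim L u x"
  obtains \<eta> where "\<eta> \<in> borel_measurable (leb L)"
    "integrable (leb L) \<eta>"
    "\<And>x. x \<in> Om L \<Longrightarrow> l x \<le> \<eta> x \<and> \<eta> x \<le> u x"
    "\<And>x y. \<sigma> y - \<sigma> x = prim L \<eta> y - prim L \<eta> x"
proof -
  let ?M = "leb L"
  have ul: "integrable ?M (\<lambda>x. u x - l x)" using u l by simp
  obtain g where g: "g \<in> borel_measurable borel" "integrable lborel g"
    "AE x in ?M. g x = u x - l x" and out: "\<And>x. x \<notin> Om L \<Longrightarrow> g x = 0"
    and g4: "\<And>S. S \<in> sets borel \<Longrightarrow> (LINT t|?M. (u t - l t) * indicator S t) = (LINT t|lborel. g t * indicator S t)"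
    by (rule lebesgue_on_Om_to_lborel[OF ul], rule that)
  define w where "w x = max 0 (g x)" for x
  have w: "w \<in> borel_measurable borel" "\<And>x. 0 \<le> w x" "integrable lborel w"
    using g(1,2) unfolding w_def by auto
  define m where "m x = \<sigma> x - prim L l x" for x
  have mw: "m y - m x \<le> (LINT t|lborel. w t * indicator {x<..y} t)" if "x \<le> y" for x y
  proof -
    have "m y - m x \<le> (prim L u y - prim L u x) - (prim L l y - prim L l x)"
      using inc(2)[OF that] by (simp add: m_def)
    also have "\<dots> = (LINT t|?M. (u t - l t) * indicator {x<..y} t)"
      unfolding prim_diff[OF u that] prim_diff[OF l that] left_diff_distrib
      by (intro Bochner_Integration.integral_diff[symmetric] integrable_mult_ind u l) auto
    also have "\<dots> = (LINT t|lborel. g t * indicator {x<..y} t)" by (rule g4) auto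
    also have "\<dots> \<le> (LINT t|lborel. w t * indicator {x<..y} t)"
    proof (rule integral_mono)
      show "integrable lborel (\<lambda>t. g t * indicator {x<..y} t)"
        by (rule Bochner_Integration.integrable_bound[OF g(2)]) (use g(1) in \<open>auto simp: indicator_def\<close>)
      show "integrable lborel (\<lambda>t. w t * indicator {x<..y} t)"
        by (rule Bochner_Integration.integrable_bound[OF w(3)]) (use w(1) in \<open>auto simp: indicator_def\<close>)
    qed (auto simp: indicator_def w_def)
    finally show ?thesis .
  qed
  have m0: "0 \<le> m y - m x" if "x \<le> y" for x y
    using inc(1)[OF that] by (simp add: m_def)
  obtain \<theta> where \<theta>: "\<theta> \<in> borel_measurable borel" "\<And>x. 0 \<le> \<theta> x" "AE x in lborel. \<theta> x \<le> w x"
    "\<And>x y. x \<le> y \<Longrightarrow> m y - m x = (LINT t|lborel. \<theta> t * indicator {x<..y} t)"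
    using interval_measure_density[OF w m0 mw] by blast
  define \<eta> where "\<eta> x = min (u x) (l x + \<theta> x)" for x
  have \<theta>M: "\<theta> \<in> borel_measurable ?M" using \<theta>(1) by (rule borel_measurable_Om)
  have lM: "l \<in> borel_measurable ?M" and uM: "u \<in> borel_measurable ?M" using l u by auto
  have \<eta>M: "\<eta> \<in> borel_measurable ?M" unfolding \<eta>_def using \<theta>M lM uM by measurable
  have \<eta>b: "l x \<le> \<eta> x \<and> \<eta> x \<le> u x" if "x \<in> Om L" for x
    using lu[OF that] \<theta>(2)[of x] by (auto simp: \<eta>_def)
  have i\<eta>: "integrable ?M \<eta>"
  proof (rule Bochner_Integration.integrable_bound)
    show "integrable ?M (\<lambda>x. \<bar>l x\<bar> + \<bar>u x\<bar>)" using l u by auto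
    show "AE x in ?M. norm (\<eta> x) \<le> norm (\<bar>l x\<bar> + \<bar>u x\<bar>)"
      using \<eta>b by (intro AE_I2) (force simp: abs_if)
  qed (rule \<eta>M)
  have "AE x in lebesgue. \<theta> x \<le> w x" by (rule AE_completion[OF \<theta>(3)])
  then have "AE x in ?M. \<theta> x \<le> w x"
    by (subst AE_restrict_space_iff) (auto elim: eventually_mono)
  with g(3) AE_space have ae: "AE x in ?M. \<theta> x = \<eta> x - l x"
  proof eventually_elim
    case (elim x)
    then have "x \<in> Om L" by simp
    from lu[OF this] elim show ?case by (auto simp: \<eta>_def w_def)
  qed
  have step: "\<sigma> y - \<sigma> x = prim L \<eta> y - prim L \<eta> x" if "x \<le> y" for x y
  proof -
    have "(LINT t|lborel. \<theta> t * indicator {x<..y} t) = (LINT t|lebesgue. \<theta> t * indicator {x<..y} t)"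
      by (rule integral_completion[symmetric]) (use \<theta>(1) in auto)
    also have "\<dots> = (LINT t|lebesgue. indicator (Om L) t *\<^sub>R (\<theta> t * indicator {x<..y} t))"
    proof (rule integral_cong_AE)
      have "AE t in lborel. \<theta> t * indicator {x<..y} t = indicator (Om L) t *\<^sub>R (\<theta> t * indicator {x<..y} t)"
        using \<theta>(3)
      proof eventually_elim
        case (elim t)
        then show ?case using \<theta>(2)[of t] out[of t] by (cases "t \<in> Om L") (auto simp: w_def)
      qed
      then show "AE t in lebesgue. \<theta> t * indicator {x<..y} t = indicator (Om L) t *\<^sub>R (\<theta> t * indicator {x<..y} t)"
        by (rule AE_completion)
    qed (use \<theta>(1) in \<open>auto intro!: measurable_completion\<close>)
    also have "\<dots> = (LINT t|?M. \<theta> t * indicator {x<..y} t)"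
      by (rule integral_restrict_space[symmetric]) auto
    also have "\<dots> = (LINT t|?M. \<eta> t * indicator {x<..y} t - l t * indicator {x<..y} t)"
    proof (rule integral_cong_AE)
      have ind: "indicator {x<..y} \<in> borel_measurable ?M" by (rule borel_measurable_Om) simp
      show "(\<lambda>t. \<theta> t * indicator {x<..y} t) \<in> borel_measurable ?M"
        by (rule borel_measurable_times[OF \<theta>M ind])
      show "(\<lambda>t. \<eta> t * indicator {x<..y} t - l t * indicator {x<..y} t) \<in> borel_measurable ?M"
        by (intro borel_measurable_times borel_measurable_diff \<eta>M lM ind)
      show "AE t in ?M. \<theta> t * indicator {x<..y} t = \<eta> t * indicator {x<..y} t - l t * indicator {x<..y} t"
        using ae by eventually_elim (simp add: left_diff_distrib)
    qed
    also have "\<dots> = (prim L \<eta> y - prim L \<eta> x) - (prim L l y - prim L l x)"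
      unfolding prim_diff[OF i\<eta> that] prim_diff[OF l that]
      by (intro Bochner_Integration.integral_diff integrable_mult_ind i\<eta> l) auto
    finally show ?thesis using \<theta>(4)[OF that] by (simp add: m_def)
  qed
  have "\<sigma> y - \<sigma> x = prim L \<eta> y - prim L \<eta> x" for x y
    using step[of x y] step[of y x] by linarith
  then show ?thesis using that[of \<eta>] \<eta>M i\<eta> \<eta>b by simp
qed

text \<open>
  McShane's extension for the asymmetric distance \<open>d(s, t)\<close>, the largest increment from \<open>s\<close> to \<open>t\<close> that
  a function with slope in \<open>[l, u]\<close> can have; this is the increment of \<open>\<integral> u\<close> if \<open>s \<le> t\<close> and of \<open>\<integral> l\<close>
  otherwise, and in both cases the larger one of the two. The triangle inequality for \<open>d\<close> is all
  that the extension formula needs.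
\<close>

lemma prim_interpolation:
  assumes l: "integrable (leb L) l" and u: "integrable (leb L) u"
    and lu: "\<And>x. x \<in> Om L \<Longrightarrow> l x \<le> u x"
    and S: "S \<noteq> {}"
    and ab: "\<And>s t. s \<in> S \<Longrightarrow> t \<in> S \<Longrightarrow>
      a t \<le> b s + max (prim L u t - prim L u s) (prim L l t - prim L l s)"
  obtains \<sigma> \<eta> where "integrable (leb L) \<eta>"
    "\<And>x. x \<in> Om L \<Longrightarrow> l x \<le> \<eta> x \<and> \<eta> x \<le> u x"
    "\<And>x y. \<sigma> y - \<sigma> x = prim L \<eta> y - prim L \<eta> x"
    "\<And>t. t \<in> S \<Longrightarrow> a t \<le> \<sigma> t \<and> \<sigma> t \<le> b t"
proof -
  define d where "d s t = max (prim L u t - prim L u s) (prim L l t - prim L l s)" for s t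
  have tri: "d s r \<le> d s t + d t r" for s t r by (auto simp: d_def)
  have dd: "d t t = 0" for t by (simp add: d_def)
  define \<sigma> where "\<sigma> t = (INF s\<in>S. b s + d s t)" for t
  obtain t0 where t0: "t0 \<in> S" using S by auto
  have ab': "a t \<le> b s + d s t" if "s \<in> S" "t \<in> S" for s t
    using ab[OF that] by (simp add: d_def)
  have bdd: "bdd_below ((\<lambda>s. b s + d s t) ` S)" for t
  proof (rule bdd_belowI2)
    fix s assume "s \<in> S"
    then show "a t0 - d t t0 \<le> b s + d s t"
      using ab'[of s t0] t0 tri[of s t0 t] by simp
  qed
  have lip: "\<sigma> r \<le> \<sigma> t + d t r" for t r
  proof -
    have "\<sigma> r - d t r \<le> \<sigma> t" unfolding \<sigma>_def[of t]
    proof (rule cINF_greatest[OF S])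
      fix s assume "s \<in> S"
      then have "\<sigma> r \<le> b s + d s r" unfolding \<sigma>_def by (intro cINF_lower bdd)
      then show "\<sigma> r - d t r \<le> b s + d s t" using tri[of s r t] by simp
    qed
    then show ?thesis by simp
  qed
  have between: "a t \<le> \<sigma> t \<and> \<sigma> t \<le> b t" if t: "t \<in> S" for t
  proof
    show "a t \<le> \<sigma> t" unfolding \<sigma>_def using t by (intro cINF_greatest S ab')
    show "\<sigma> t \<le> b t" unfolding \<sigma>_def using cINF_lower[OF bdd t, of t] dd[of t] by simp
  qed
  have lu': "AE x in leb L. l x \<le> u x" using lu by (intro AE_I2) auto
  have mono: "prim L l y - prim L l x \<le> prim L u y - prim L u x" if "x \<le> y" for x y
    by (rule prim_mono_increments[OF l u lu' that])
  have 1: "prim L l y - prim L l x \<le> \<sigma> y - \<sigma> x" if "x \<le> y" for x y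
    using lip[of x y] mono[OF that] unfolding d_def by linarith
  have 2: "\<sigma> y - \<sigma> x \<le> prim L u y - prim L u x" if "x \<le> y" for x y
    using lip[of y x] mono[OF that] unfolding d_def by linarith
  obtain \<eta> where "integrable (leb L) \<eta>"
    "\<And>x. x \<in> Om L \<Longrightarrow> l x \<le> \<eta> x \<and> \<eta> x \<le> u x"
    "\<And>x y. \<sigma> y - \<sigma> x = prim L \<eta> y - prim L \<eta> x"
    using prim_between_density[where \<sigma>=\<sigma>, OF l u lu 1 2] by metis
  with between show ?thesis by (intro that[of \<eta> \<sigma>])
qed

section \<open>Smooth bump functions\<close>

text \<open>
  The smooth function \<open>exp(-1/x)\<close> for \<open>x > 0\<close>, extended by zero, and its multiples by powers of \<open>1/x\<close>:
  the family is closed under differentiation up to linear combinations.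
\<close>

definition flat :: "nat \<Rightarrow> real \<Rightarrow> real" where
  "flat k x = (if x > 0 then (1 / x) ^ k * exp (- (1 / x)) else 0)"

lemma flat_at_right_0: "(flat k \<longlongrightarrow> 0) (at_right 0)"
proof -
  have "((\<lambda>x::real. (inverse x) ^ k / exp (inverse x)) \<longlongrightarrow> 0) (at_right 0)"
    by (rule filterlim_compose[OF tendsto_power_div_exp_0 filterlim_inverse_at_top_right])
  then show ?thesis
    by (rule Lim_transform_eventually)
       (auto simp: eventually_at_right_field flat_def exp_minus divide_simps intro!: exI[of _ 1])
qed

lemma flat_deriv: "(flat k has_real_derivative (flat (k + 2) x - real k * flat (k + 1) x)) (at x)"
proof -
  consider "x > 0" | "x < 0" | "x = 0" by linarith
  then show ?thesis
  proof cases
    case 1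
    have "((\<lambda>x. (1 / x) ^ k * exp (- (1 / x))) has_real_derivative
        (flat (k + 2) x - real k * flat (k + 1) x)) (at x)"
    proof -
      have d: "((\<lambda>x. 1 / x) has_real_derivative - ((1 / x)\<^sup>2)) (at x)"
        using 1 by (auto intro!: derivative_eq_intros simp: power2_eq_square)
      have dk: "real k * (- (y\<^sup>2) * y ^ (k - Suc 0)) = - real k * y ^ (k + 1)" for y :: real
        by (cases k) (auto simp: power2_eq_square algebra_simps)
      have de: "((\<lambda>x. exp (- (1 / x))) has_real_derivative exp (- (1 / x)) * (1 / x)\<^sup>2) (at x)"
        using DERIV_chain2[OF DERIV_exp DERIV_minus[OF d]] by simp
      show ?thesis
        by (rule DERIV_cong[OF DERIV_mult[OF DERIV_power[OF d, of k, unfolded dk] de]])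
           (use 1 in \<open>simp add: flat_def power_add power2_eq_square algebra_simps del: power_divide\<close>)
    qed
    moreover have "\<forall>\<^sub>F y in nhds x. (1 / y) ^ k * exp (- (1 / y)) = flat k y"
      using eventually_nhds_in_open[of "{0<..}" x] 1
      by (auto elim!: eventually_mono simp: flat_def)
    ultimately show ?thesis by (subst DERIV_cong_ev[OF refl _ refl, symmetric])
  next
    case 2
    have "\<forall>\<^sub>F y in nhds x. 0 = flat k y"
      using eventually_nhds_in_open[of "{..<0}" x] 2
      by (auto elim!: eventually_mono simp: flat_def)
    moreover have "((\<lambda>x. 0::real) has_real_derivative 0) (at x)" by simp
    ultimately have "(flat k has_real_derivative 0) (at x)"
      by (subst DERIV_cong_ev[OF refl _ refl, symmetric])
    then show ?thesis using 2 by (simp add: flat_def)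
  next
    case 3
    have "((\<lambda>h. (flat k h - flat k 0) / h) \<longlongrightarrow> 0) (at_right 0)"
      by (rule Lim_transform_eventually[OF flat_at_right_0[of "k + 1"]])
         (auto simp: eventually_at_right_field flat_def divide_simps intro!: exI[of _ 1])
    moreover have "((\<lambda>h. (flat k h - flat k 0) / h) \<longlongrightarrow> 0) (at_left 0)"
      by (rule Lim_transform_eventually[OF tendsto_const])
         (auto simp: eventually_at_left_field flat_def intro!: exI[of _ "-1"])
    ultimately have "((\<lambda>h. (flat k h - flat k 0) / h) \<longlongrightarrow> 0) (at 0)"
      by (simp add: filterlim_at_split)
    then show ?thesis using 3 by (simp add: DERIV_def flat_def)
  qed
qed

text \<open>
  A class of functions that is closed under differentiation by construction; it contains the bump
  functions below, which are products of two flat functions.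
\<close>

inductive smooth :: "(real \<Rightarrow> real) \<Rightarrow> bool" where
  flat: "smooth (\<lambda>x. flat k (c * x + d))"
| const: "smooth (\<lambda>x. c)"
| add: "smooth f \<Longrightarrow> smooth g \<Longrightarrow> smooth (\<lambda>x. f x + g x)"
| mult: "smooth f \<Longrightarrow> smooth g \<Longrightarrow> smooth (\<lambda>x. f x * g x)"

lemma smooth_deriv:
  assumes "smooth f"
  shows "\<exists>f'. smooth f' \<and> (\<forall>x. (f has_real_derivative f' x) (at x))"
  using assms
proof induction
  case (flat k c d)
  have "smooth (\<lambda>x. c * (flat (k + 2) (c * x + d) + (- real k) * flat (k + 1) (c * x + d)))"
    by (intro smooth.intros)
  moreover have "((\<lambda>x. flat k (c * x + d)) has_real_derivative
      c * (flat (k + 2) (c * x + d) + (- real k) * flat (k + 1) (c * x + d))) (at x)" for x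
    by (rule DERIV_cong[OF DERIV_chain2[OF flat_deriv]]) (auto intro!: derivative_eq_intros)
  ultimately show ?case by blast
next
  case (const c)
  show ?case by (intro exI[of _ "\<lambda>x. 0"]) (auto intro: smooth.const)
next
  case (add f g)
  then show ?case by (auto intro!: derivative_eq_intros smooth.intros)
next
  case (mult f g)
  then obtain f' g' where "smooth f'" "smooth g'" "\<And>x. (f has_real_derivative f' x) (at x)"
    "\<And>x. (g has_real_derivative g' x) (at x)" by blast
  then show ?case using mult.hyps
    by (intro exI[of _ "\<lambda>x. f' x * g x + g' x * f x"]) (auto intro!: derivative_eq_intros smooth.intros)
qed

lemma Ck_antideriv:
  assumes g: "\<And>k. Ck k g" and f: "\<And>x. (f has_real_derivative g x) (at x)"
  shows "Ck k f"
proof -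
  have df: "deriv f = g" using f by (auto intro: DERIV_imp_deriv)
  have sh: "(deriv ^^ Suc i) f = (deriv ^^ i) g" for i
    using df by (simp add: funpow_swap1)
  have fd: "(deriv ^^ i) f field_differentiable at x" for i x
  proof (cases i)
    case 0
    then show ?thesis using f field_differentiable_def by auto
  next
    case (Suc j)
    then show ?thesis using g[of "Suc j"] sh[of j] unfolding Ck_def by auto
  qed
  have "continuous_on UNIV ((deriv ^^ k) f)"
    by (intro continuous_at_imp_continuous_on ballI field_differentiable_imp_continuous_at fd)
  with fd show ?thesis unfolding Ck_def by blast
qed

lemma smooth_Ck:
  assumes "smooth f"
  shows "Ck k f"
proof -
  have it: "smooth ((deriv ^^ i) f)" for i
  proof (induction i)
    case (Suc i)
    then obtain f' where "smooth f'" "\<And>x. ((deriv ^^ i) f has_real_derivative f' x) (at x)"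
      using smooth_deriv by blast
    moreover then have "deriv ((deriv ^^ i) f) = f'" by (auto intro: DERIV_imp_deriv)
    ultimately show ?case by simp
  qed (use assms in auto)
  have fd: "(deriv ^^ i) f field_differentiable at x" for i x
    using smooth_deriv[OF it[of i]] field_differentiable_def by blast
  have "continuous_on UNIV ((deriv ^^ k) f)"
    by (intro continuous_at_imp_continuous_on ballI field_differentiable_imp_continuous_at fd)
  with fd show ?thesis unfolding Ck_def by blast
qed

text \<open>
  With the scaling factor \<open>n + 1\<close> inside, these bumps converge pointwise to the indicator function
  of \<open>(s, t)\<close> and stay between \<open>0\<close> and \<open>1\<close>.
\<close>

definition bump :: "nat \<Rightarrow> real \<Rightarrow> real \<Rightarrow> real \<Rightarrow> real" where
  "bump n s t x = flat 0 (real (Suc n) * x + (- real (Suc n) * s)) * flat 0 (- real (Suc n) * x + real (Suc n) * t)"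

lemma smooth_bump: "smooth (bump n s t)"
  unfolding bump_def by (intro smooth.intros)

lemma bump_eq: "bump n s t x =
    (if x \<in> {s<..<t} then exp (- (1 / (real (Suc n) * (x - s)))) * exp (- (1 / (real (Suc n) * (t - x)))) else 0)"
proof -
  have 1: "real (Suc n) * x + (- real (Suc n) * s) = real (Suc n) * (x - s)"
    "- real (Suc n) * x + real (Suc n) * t = real (Suc n) * (t - x)"
    by (simp_all add: algebra_simps)
  have 2: "0 < real (Suc n) * y \<longleftrightarrow> 0 < y" for y :: real
    by (simp add: zero_less_mult_iff)
  show ?thesis unfolding bump_def flat_def 1 2 by (simp add: greaterThanLessThan_iff)
qed

lemma bump_range: "0 \<le> bump n s t x" "bump n s t x \<le> 1"
proof -
  have "exp (- (1 / (real (Suc n) * (x - s)))) * exp (- (1 / (real (Suc n) * (t - x)))) \<le> 1"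
    if "s < x" "x < t"
    using that by (intro mult_le_one) simp_all
  then show "bump n s t x \<le> 1" unfolding bump_eq by simp
  show "0 \<le> bump n s t x" unfolding bump_eq by simp
qed

lemma bump_outside: "x \<notin> {s<..<t} \<Longrightarrow> bump n s t x = 0"
  unfolding bump_eq by simp

lemma bump_pos: "x \<in> {s<..<t} \<Longrightarrow> 0 < bump n s t x"
  unfolding bump_eq by simp

lemma bump_tendsto: "(\<lambda>n. bump n s t x) \<longlonglongrightarrow> indicator {s<..<t} x"
proof (cases "x \<in> {s<..<t}")
  case True
  have "(\<lambda>n. exp (- (1 / (real (Suc n) * y)))) \<longlonglongrightarrow> 1" if "y > 0" for y :: real
  proof -
    have "(\<lambda>n. exp (- (inverse (real (Suc n)) * (1 / y)))) \<longlonglongrightarrow> exp (- (0 * (1 / y)))"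
      by (intro tendsto_intros LIMSEQ_inverse_real_of_nat)
    then show ?thesis by (simp add: inverse_eq_divide)
  qed
  from tendsto_mult[OF this[of "x - s"] this[of "t - x"]] True
  have "(\<lambda>n. exp (- (1 / (real (Suc n) * (x - s)))) * exp (- (1 / (real (Suc n) * (t - x))))) \<longlonglongrightarrow> 1"
    by simp
  moreover have "bump n s t x = exp (- (1 / (real (Suc n) * (x - s)))) * exp (- (1 / (real (Suc n) * (t - x))))" for n
    using True unfolding bump_eq by simp
  ultimately show ?thesis using True by simp
qed (simp add: bump_outside)

lemma closure_support_bump: "closure {x. bump n s t x \<noteq> 0} \<subseteq> {s..t}"
proof (rule closure_minimal)
  show "{x. bump n s t x \<noteq> 0} \<subseteq> {s..t}"
    by (auto simp: bump_eq split: if_splits)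
qed simp

lemma bump_test:
  assumes "-L < s" "t < L"
  shows "bump n s t \<in> test_functions L"
proof -
  have "{s..t} \<subseteq> Om L" using assms by auto
  then show ?thesis unfolding test_functions_def
    using smooth_Ck[OF smooth_bump] closure_support_bump[of n s t] by blast
qed

section \<open>Weak derivatives on the interval\<close>

lemma finite_measure_Om: "finite_measure (leb L)"
  by (rule finite_measure_lebesgue_on) simp

text \<open>
  Fubini's theorem on the two triangles \<open>y \<le> x\<close> and \<open>x \<le> y\<close>, whose union is the square and whose
  intersection is a null set.
\<close>

lemma prim_integration_by_parts:
  assumes \<eta>: "integrable (leb L) \<eta>" and r: "integrable (leb L) r"
  shows "(LINT x|leb L. prim L \<eta> x * r x) + (LINT x|leb L. \<eta> x * prim L r x)
    = (LINT x|leb L. \<eta> x) * (LINT x|leb L. r x)"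
proof -
  define M where "M = leb L"
  interpret finite_measure M unfolding M_def by (rule finite_measure_Om)
  interpret P: pair_sigma_finite M M ..
  have \<eta>': "integrable M \<eta>" "\<eta> \<in> borel_measurable M" and r': "integrable M r" "r \<in> borel_measurable M"
    using \<eta> r by (auto simp: M_def)
  have idM: "(\<lambda>x. x) \<in> borel_measurable M"
    unfolding M_def by (rule borel_measurable_Om) simp
  have fs: "(\<lambda>p. fst p) \<in> borel_measurable (M \<Otimes>\<^sub>M M)" "(\<lambda>p. snd p) \<in> borel_measurable (M \<Otimes>\<^sub>M M)"
    by (rule measurable_compose[OF measurable_fst idM], rule measurable_compose[OF measurable_snd idM])
  have \<eta>r: "(\<lambda>p. \<eta> (snd p) * r (fst p)) \<in> borel_measurable (M \<Otimes>\<^sub>M M)"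
    by (intro borel_measurable_times measurable_compose[OF measurable_fst r'(2)]
        measurable_compose[OF measurable_snd \<eta>'(2)])
  have i: "integrable (M \<Otimes>\<^sub>M M) (\<lambda>p. \<eta> (snd p) * r (fst p))"
  proof (rule P.Fubini_integrable[OF \<eta>r])
    show "integrable M (\<lambda>x. LINT y|M. norm (\<eta> (snd (x, y)) * r (fst (x, y))))"
      using \<eta>' r' by (simp add: abs_mult)
    show "AE x in M. integrable M (\<lambda>y. \<eta> (snd (x, y)) * r (fst (x, y)))"
      using \<eta>' r' by simp
  qed
  have m1: "(\<lambda>p. indicator {..fst p} (snd p) :: real) \<in> borel_measurable (M \<Otimes>\<^sub>M M)"
    by (subst measurable_cong[where g="indicator {p \<in> space (M \<Otimes>\<^sub>M M). snd p \<le> fst p}"])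
      (simp add: indicator_def, rule borel_measurable_indicator[OF borel_measurable_le[OF fs(2,1)]])
  have m2: "(\<lambda>p. indicator {..snd p} (fst p) :: real) \<in> borel_measurable (M \<Otimes>\<^sub>M M)"
    by (subst measurable_cong[where g="indicator {p \<in> space (M \<Otimes>\<^sub>M M). fst p \<le> snd p}"])
      (simp add: indicator_def, rule borel_measurable_indicator[OF borel_measurable_le[OF fs(1,2)]])
  have i1: "integrable (M \<Otimes>\<^sub>M M) (\<lambda>p. \<eta> (snd p) * r (fst p) * indicator {..fst p} (snd p))"
    by (rule Bochner_Integration.integrable_bound[OF i borel_measurable_times[OF \<eta>r m1]])
       (intro AE_I2, simp add: indicator_def)
  have i2: "integrable (M \<Otimes>\<^sub>M M) (\<lambda>p. \<eta> (snd p) * r (fst p) * indicator {..snd p} (fst p))"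
    by (rule Bochner_Integration.integrable_bound[OF i borel_measurable_times[OF \<eta>r m2]])
       (intro AE_I2, simp add: indicator_def)
  have A: "(LINT x|M. prim L \<eta> x * r x) = (LINT x|M. LINT y|M. \<eta> y * r x * indicator {..x} y)"
    unfolding prim_def M_def[symmetric]
    by (simp flip: Bochner_Integration.integral_mult_left_zero Bochner_Integration.integral_mult_right_zero add: ac_simps)
  have B: "(LINT x|M. \<eta> x * prim L r x) = (LINT x|M. LINT y|M. \<eta> y * r x * indicator {..y} x)"
  proof -
    have "(LINT x|M. \<eta> x * prim L r x) = (LINT y|M. LINT x|M. \<eta> y * r x * indicator {..y} x)"
      unfolding prim_def M_def[symmetric]
      by (simp flip: Bochner_Integration.integral_mult_left_zero Bochner_Integration.integral_mult_right_zero add: ac_simps)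
    also have "\<dots> = (LINT x|M. LINT y|M. \<eta> y * r x * indicator {..y} x)"
      by (rule P.Fubini_integral) (use i2 in \<open>simp only: case_prod_beta'\<close>)
    finally show ?thesis .
  qed
  have "(LINT x|M. prim L \<eta> x * r x) + (LINT x|M. \<eta> x * prim L r x)
     = (LINT p|(M \<Otimes>\<^sub>M M). \<eta> (snd p) * r (fst p) * indicator {..fst p} (snd p)
         + \<eta> (snd p) * r (fst p) * indicator {..snd p} (fst p))"
    unfolding A B using P.integral_fst'[OF i1] P.integral_fst'[OF i2]
    by (subst Bochner_Integration.integral_add[OF i1 i2]) simp
  also have "\<dots> = (LINT x|M. LINT y|M. \<eta> y * r x * indicator {..x} y + \<eta> y * r x * indicator {..y} x)"
    using P.integral_fst'[OF Bochner_Integration.integrable_add[OF i1 i2]] by simp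
  also have "\<dots> = (LINT x|M. LINT y|M. \<eta> y * r x)"
  proof (rule Bochner_Integration.integral_cong[OF refl], rule integral_cong_AE)
    fix x
    show "AE y in M. \<eta> y * r x * indicator {..x} y + \<eta> y * r x * indicator {..y} x = \<eta> y * r x"
      using AE_Om_neq[of x L] unfolding M_def by eventually_elim (auto simp: indicator_def)
    have ix: "(\<lambda>y. indicator S y :: real) \<in> borel_measurable M" if "S \<in> sets borel" for S
      using that unfolding M_def by (intro borel_measurable_Om borel_measurable_indicator)
    have ix2: "(\<lambda>y. indicator {..y} x :: real) \<in> borel_measurable M"
      using ix[of "{x..}"] by (simp add: indicator_def)
    show "(\<lambda>y. \<eta> y * r x * indicator {..x} y + \<eta> y * r x * indicator {..y} x) \<in> borel_measurable M"
      by (intro borel_measurable_add borel_measurable_times borel_measurable_const \<eta>'(2) ix ix2) simp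
    show "(\<lambda>y. \<eta> y * r x) \<in> borel_measurable M"
      by (intro borel_measurable_times borel_measurable_const \<eta>'(2))
  qed
  also have "\<dots> = (LINT x|M. \<eta> x) * (LINT x|M. r x)" by simp
  finally show ?thesis unfolding M_def .
qed

text \<open>
  The positive and the negative part of the function are densities of the same measure.
\<close>

lemma AE_zero_if_prim_zero:
  assumes r: "integrable (leb L) r" and z: "\<And>x. prim L r x = 0"
  shows "AE x in leb L. r x = 0"
proof -
  obtain g where g: "g \<in> borel_measurable borel" "integrable lborel g"
    "AE x in leb L. g x = r x"
    and g4: "\<And>S. S \<in> sets borel \<Longrightarrow>
      (LINT t|leb L. r t * indicator S t) = (LINT t|lborel. g t * indicator S t)"
    by (rule lebesgue_on_Om_to_lborel[OF r], rule that)
  define p where "p x = max 0 (g x)" for x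
  define q where "q x = max 0 (- g x)" for x
  have pq: "p \<in> borel_measurable borel" "integrable lborel p" "\<And>x. 0 \<le> p x"
    "q \<in> borel_measurable borel" "integrable lborel q" "\<And>x. 0 \<le> q x"
    "\<And>x. g x = p x - q x"
    using g(1,2) unfolding p_def q_def by simp_all
  have "density lborel (\<lambda>x. ennreal (p x)) = density lborel (\<lambda>x. ennreal (q x))"
  proof (rule measure_eqI_Ioc)
    fix a b :: real
    note eD = emeasure_density_lborel[OF pq(2,3), of "{a<..b}"] emeasure_density_lborel[OF pq(5,6), of "{a<..b}"]
    show "emeasure (density lborel (\<lambda>x. ennreal (p x))) {a<..b} \<noteq> \<infinity>" using eD(1) by simp
    assume ab: "a \<le> b"
    have "(LINT t|lborel. p t * indicator {a<..b} t) - (LINT t|lborel. q t * indicator {a<..b} t)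
        = (LINT t|lborel. p t * indicator {a<..b} t - q t * indicator {a<..b} t)"
      by (intro Bochner_Integration.integral_diff[symmetric] integrable_real_mult_indicator pq) auto
    also have "\<dots> = (LINT t|lborel. g t * indicator {a<..b} t)"
      by (simp add: pq(7) left_diff_distrib)
    also have "\<dots> = (LINT t|leb L. r t * indicator {a<..b} t)"
      by (rule g4[symmetric]) simp
    also have "\<dots> = 0" using prim_diff[OF r ab] z by simp
    finally show "emeasure (density lborel (\<lambda>x. ennreal (p x))) {a<..b} = emeasure (density lborel (\<lambda>x. ennreal (q x))) {a<..b}"
      using eD by simp
  qed simp_all
  then have "AE x in lborel. ennreal (p x) = ennreal (q x)"
    using pq by (subst (asm) sigma_finite_measure.density_unique_iff[OF sigma_finite_lborel]) auto
  then have "AE x in lborel. g x = 0" using pq by (auto elim!: eventually_mono)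
  then have "AE x in lebesgue. g x = 0" by (rule AE_completion)
  then have "AE x in leb L. g x = 0"
    by (subst AE_restrict_space_iff) (auto elim: eventually_mono)
  with g(3) show ?thesis by eventually_elim simp
qed

lemma L2_measurable: "u \<in> L2 L \<Longrightarrow> u \<in> borel_measurable (leb L)"
  by (simp add: L2_def)

lemma integrable_const_Om [simp]: "integrable (leb L) (\<lambda>x. c :: real)"
  using finite_measure.integrable_const[OF finite_measure_Om] .

lemma L2_integrable:
  assumes "u \<in> L2 L"
  shows "integrable (leb L) u"
proof (rule Bochner_Integration.integrable_bound)
  show "integrable (leb L) (\<lambda>x. 1 + (u x)\<^sup>2)"
    using assms by (intro Bochner_Integration.integrable_add integrable_const_Om) (simp add: L2_def)
  have "norm (u x) \<le> norm (1 + (u x)\<^sup>2)" for x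
    using sum_squares_bound[of "\<bar>u x\<bar>" 1] by (simp add: power2_eq_square)
  then show "AE x in leb L. norm (u x) \<le> norm (1 + (u x)\<^sup>2)" by simp
qed (rule L2_measurable[OF assms])

lemma L2_mult_integrable:
  assumes "u \<in> L2 L" "v \<in> L2 L"
  shows "integrable (leb L) (\<lambda>x. u x * v x)"
proof (rule Bochner_Integration.integrable_bound)
  show "integrable (leb L) (\<lambda>x. (u x)\<^sup>2 + (v x)\<^sup>2)"
    using assms by (intro Bochner_Integration.integrable_add) (simp_all add: L2_def)
  have "norm (u x * v x) \<le> norm ((u x)\<^sup>2 + (v x)\<^sup>2)" for x
  proof -
    have "2 * (\<bar>u x\<bar> * \<bar>v x\<bar>) \<le> (u x)\<^sup>2 + (v x)\<^sup>2"
      using sum_squares_bound[of "\<bar>u x\<bar>" "\<bar>v x\<bar>"] by (simp add: mult.assoc)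
    moreover have "0 \<le> \<bar>u x\<bar> * \<bar>v x\<bar>" by simp
    ultimately have "\<bar>u x\<bar> * \<bar>v x\<bar> \<le> (u x)\<^sup>2 + (v x)\<^sup>2" by linarith
    then show ?thesis by (simp add: abs_mult)
  qed
  then show "AE x in leb L. norm (u x * v x) \<le> norm ((u x)\<^sup>2 + (v x)\<^sup>2)" by simp
qed (intro borel_measurable_times L2_measurable assms)

lemma L2_dominated:
  assumes "v \<in> L2 L" "u \<in> borel_measurable (leb L)"
    "AE x in leb L. \<bar>u x\<bar> \<le> \<bar>v x\<bar>"
  shows "u \<in> L2 L"
proof -
  have "integrable (leb L) (\<lambda>x. (u x)\<^sup>2)"
  proof (rule Bochner_Integration.integrable_bound)
    show "integrable (leb L) (\<lambda>x. (v x)\<^sup>2)" using assms(1) by (simp add: L2_def)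
    show "(\<lambda>x. (u x)\<^sup>2) \<in> borel_measurable (leb L)"
      by (intro borel_measurable_power assms(2))
    show "AE x in leb L. norm ((u x)\<^sup>2) \<le> norm ((v x)\<^sup>2)"
      using assms(3) by eventually_elim (simp add: abs_le_square_iff)
  qed
  then show ?thesis using assms(2) by (simp add: L2_def)
qed

lemma L2_add:
  assumes "u \<in> L2 L" "v \<in> L2 L"
  shows "(\<lambda>x. u x + v x) \<in> L2 L"
proof -
  have "integrable (leb L) (\<lambda>x. (u x)\<^sup>2 + 2 * (u x * v x) + (v x)\<^sup>2)"
    using assms L2_mult_integrable[OF assms]
    by (intro Bochner_Integration.integrable_add Bochner_Integration.integrable_mult_right)
       (simp_all add: L2_def)
  moreover have "(\<lambda>x. u x + v x) \<in> borel_measurable (leb L)"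
    by (intro borel_measurable_add L2_measurable assms)
  ultimately show ?thesis by (simp add: L2_def power2_sum algebra_simps)
qed

lemma L2_cmult:
  assumes "u \<in> L2 L"
  shows "(\<lambda>x. c * u x) \<in> L2 L"
  using assms by (auto simp: L2_def power_mult_distrib intro: borel_measurable_times)

lemma L2_diff:
  assumes "u \<in> L2 L" "v \<in> L2 L"
  shows "(\<lambda>x. u x - v x) \<in> L2 L"
  using L2_add[OF assms(1) L2_cmult[OF assms(2), of "-1"]] by simp

lemma L2_const: "(\<lambda>x. c) \<in> L2 L"
  by (simp add: L2_def)

lemma L2_abs: "u \<in> L2 L \<Longrightarrow> (\<lambda>x. \<bar>u x\<bar>) \<in> L2 L"
  by (auto simp: L2_def intro: borel_measurable_abs)

lemma prim_bounded: "\<bar>prim L r x\<bar> \<le> (LINT y|leb L. \<bar>r y\<bar>)" if "integrable (leb L) r"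
proof -
  have "\<bar>prim L r x\<bar> \<le> (LINT y|leb L. \<bar>r y * indicator {..x} y\<bar>)"
    unfolding prim_def by (rule integral_abs_bound)
  also have "\<dots> \<le> (LINT y|leb L. \<bar>r y\<bar>)"
    using that by (intro integral_mono integrable_abs integrable_mult_ind) (auto simp: indicator_def)
  finally show ?thesis .
qed

lemma prim_measurable:
  assumes "integrable (leb L) r"
  shows "prim L r \<in> borel_measurable (leb L)"
  by (intro borel_measurable_Om borel_measurable_continuous_onI prim_continuous assms)

lemma L2_bounded:
  assumes "u \<in> borel_measurable (leb L)" "AE x in leb L. \<bar>u x\<bar> \<le> C"
  shows "u \<in> L2 L"
  using assms by (intro L2_dominated[OF L2_const[of C]]) (auto elim: eventually_mono)

lemma L2_prim:
  assumes "integrable (leb L) r"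
  shows "(\<lambda>x. c + prim L r x) \<in> L2 L"
proof (rule L2_add[OF L2_const L2_bounded[OF prim_measurable[OF assms]]])
  show "AE x in leb L. \<bar>prim L r x\<bar> \<le> (LINT y|leb L. \<bar>r y\<bar>)"
    using prim_bounded[OF assms] by simp
qed

lemma integrable_imp_loc:
  fixes u :: "real \<Rightarrow> real"
  assumes "integrable (leb L) u"
  shows "\<forall>S. compact S \<and> S \<subseteq> Om L \<longrightarrow> u absolutely_integrable_on S"
proof (intro allI impI)
  fix S :: "real set" assume S: "compact S \<and> S \<subseteq> Om L"
  have "set_integrable lebesgue (Om L) u"
    using assms unfolding set_integrable_def by (subst (asm) integrable_restrict_space) auto
  then show "u absolutely_integrable_on S"
    by (rule set_integrable_subset) (use S in \<open>auto intro: lmeasurable_compact fmeasurableD\<close>)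
qed

lemma loc_integrable:
  fixes v :: "real \<Rightarrow> real"
  assumes "\<forall>S. compact S \<and> S \<subseteq> Om L \<longrightarrow> v absolutely_integrable_on S" "-L < s" "t < L"
  shows "integrable (leb L) (\<lambda>x. v x * indicator {s..t} x)"
proof -
  have sub: "{s..t} \<subseteq> Om L" using assms by auto
  then have "set_integrable lebesgue {s..t} v" using assms(1) by blast
  then have "integrable lebesgue (\<lambda>x. indicator {s..t} x *\<^sub>R v x)" by (simp add: set_integrable_def)
  moreover have "(\<lambda>x. indicator (Om L) x *\<^sub>R (v x * indicator {s..t} x)) = (\<lambda>x. indicator {s..t} x *\<^sub>R v x)"
  proof
    fix x
    show "indicator (Om L) x *\<^sub>R (v x * indicator {s..t} x) = indicator {s..t} x *\<^sub>R v x"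
      using sub by (cases "x \<in> {s..t}") auto
  qed
  ultimately show ?thesis by (subst integrable_restrict_space) simp_all
qed

lemma loc_measurable:
  fixes v :: "real \<Rightarrow> real"
  assumes "\<forall>S. compact S \<and> S \<subseteq> Om L \<longrightarrow> v absolutely_integrable_on S"
  shows "v \<in> borel_measurable (leb L)"
proof (rule borel_measurable_LIMSEQ_real)
  let ?S = "\<lambda>n. {- L + inverse (real (Suc n)) .. L - inverse (real (Suc n))}"
  show "(\<lambda>x. v x * indicator (?S n) x) \<in> borel_measurable (leb L)" for n
    by (intro borel_measurable_integrable loc_integrable assms) simp_all
  fix x assume "x \<in> space (leb L)"
  then have x: "0 < x + L" "0 < L - x" by auto
  have "\<forall>\<^sub>F n in sequentially. inverse (real (Suc n)) < x + L"
    "\<forall>\<^sub>F n in sequentially. inverse (real (Suc n)) < L - x"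
    using order_tendstoD(2)[OF LIMSEQ_inverse_real_of_nat x(1)]
      order_tendstoD(2)[OF LIMSEQ_inverse_real_of_nat x(2)] by blast+
  then have "\<forall>\<^sub>F n in sequentially. v x * indicator (?S n) x = v x"
    by eventually_elim (simp add: indicator_def)
  then show "(\<lambda>n. v x * indicator (?S n) x) \<longlonglongrightarrow> v x" by (rule tendsto_eventually)
qed

lemma integrable_mult_bump:
  fixes v :: "real \<Rightarrow> real"
  assumes v: "\<forall>S. compact S \<and> S \<subseteq> Om L \<longrightarrow> v absolutely_integrable_on S" and st: "-L < s" "t < L"
  shows "integrable (leb L) (\<lambda>x. v x * bump n s t x)"
proof (rule Bochner_Integration.integrable_bound[OF loc_integrable[OF v st]])
  have "continuous_on UNIV (bump n s t)"
    using smooth_Ck[OF smooth_bump, of 0] by (simp add: Ck_def)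
  then show "(\<lambda>x. v x * bump n s t x) \<in> borel_measurable (leb L)"
    by (intro borel_measurable_times loc_measurable[OF v] borel_measurable_Om borel_measurable_continuous_onI)
  have "norm (v x * bump n s t x) \<le> norm (v x * indicator {s..t} x)" for x
    using bump_range[of n s t x] bump_outside[of x s t n]
    by (cases "x \<in> {s..t}") (auto simp: abs_mult intro: mult_left_le)
  then show "AE x in leb L. norm (v x * bump n s t x) \<le> norm (v x * indicator {s..t} x)" by simp
qed

text \<open>
  Testing with bumps that converge to the indicator function of an interval makes the integral over every interval
  vanish.
\<close>

lemma fundamental_lemma:
  fixes v :: "real \<Rightarrow> real"
  assumes v: "\<forall>S. compact S \<and> S \<subseteq> Om L \<longrightarrow> v absolutely_integrable_on S"
    and z: "\<And>n s t. -L < s \<Longrightarrow> s < t \<Longrightarrow> t < L \<Longrightarrow> (LINT x|leb L. v x * bump n s t x) = 0"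
  shows "AE x in leb L. v x = 0"
proof -
  let ?M = "leb L"
  have int0: "(LINT x|?M. v x * indicator {s<..<t} x) = 0" if st: "-L < s" "s < t" "t < L" for s t
  proof -
    have "(\<lambda>n. LINT x|?M. v x * bump n s t x) \<longlonglongrightarrow> (LINT x|?M. v x * indicator {s<..<t} x)"
    proof (rule integral_dominated_convergence)
      show "integrable ?M (\<lambda>x. \<bar>v x * indicator {s..t} x\<bar>)"
        by (intro integrable_abs loc_integrable v st)
      show "(\<lambda>x. v x * bump n s t x) \<in> borel_measurable ?M" for n
        by (intro borel_measurable_integrable integrable_mult_bump v st)
      show "(\<lambda>x. v x * indicator {s<..<t} x) \<in> borel_measurable ?M"
        by (intro borel_measurable_times loc_measurable[OF v] borel_measurable_Om borel_measurable_indicator) simp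
      show "AE x in ?M. (\<lambda>n. v x * bump n s t x) \<longlonglongrightarrow> v x * indicator {s<..<t} x"
        by (intro AE_I2 tendsto_mult_left bump_tendsto)
      have "norm (v x * bump n s t x) \<le> \<bar>v x * indicator {s..t} x\<bar>" for x n
        using bump_range[of n s t x] bump_outside[of x s t n]
        by (cases "x \<in> {s..t}") (auto simp: abs_mult intro: mult_left_le)
      then show "AE x in ?M. norm (v x * bump n s t x) \<le> \<bar>v x * indicator {s..t} x\<bar>" for n by simp
    qed
    then show ?thesis using z[OF st] by (simp add: LIMSEQ_const_iff)
  qed
  define T where "T n = L - inverse (real (Suc n))" for n
  have TL: "T n < L" for n by (simp add: T_def)
  have "AE x in ?M. v x * indicator {- T n..T n} x = 0" for n
  proof (rule AE_zero_if_prim_zero)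
    show i: "integrable ?M (\<lambda>x. v x * indicator {- T n..T n} x)"
      by (rule loc_integrable[OF v]) (use TL in auto)
    fix x
    have "prim L (\<lambda>x. v x * indicator {- T n..T n} x) x = (LINT y|?M. v y * indicator {- T n<..<min x (T n)} y)"
      unfolding prim_def
    proof (rule integral_cong_AE)
      show "(\<lambda>y. v y * indicator {- T n..T n} y * indicator {..x} y) \<in> borel_measurable ?M"
        by (intro borel_measurable_times loc_measurable[OF v] borel_measurable_Om borel_measurable_indicator) auto
      show "(\<lambda>y. v y * indicator {- T n<..<min x (T n)} y) \<in> borel_measurable ?M"
        by (intro borel_measurable_times loc_measurable[OF v] borel_measurable_Om borel_measurable_indicator) auto
      show "AE y in ?M. v y * indicator {- T n..T n} y * indicator {..x} y = v y * indicator {- T n<..<min x (T n)} y"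
        using AE_Om_neq[of "- T n"] AE_Om_neq[of "T n"] AE_Om_neq[of x]
        by eventually_elim (auto simp: indicator_def)
    qed
    also have "\<dots> = 0"
    proof (cases "- T n < min x (T n)")
      case True
      then show ?thesis using TL[of n] by (intro int0) auto
    next
      case False
      then have e: "{- T n<..<min x (T n)} = {}" by (intro greaterThanLessThan_empty leI)
      show ?thesis unfolding e by simp
    qed
    finally show "prim L (\<lambda>x. v x * indicator {- T n..T n} x) x = 0" .
  qed
  then have "AE x in ?M. \<forall>n. v x * indicator {- T n..T n} x = 0" unfolding AE_all_countable by blast
  with AE_space show ?thesis
  proof eventually_elim
    case (elim x)
    then have x: "0 < L - \<bar>x\<bar>" by auto
    from order_tendstoD(2)[OF LIMSEQ_inverse_real_of_nat x]
    obtain n where "inverse (real (Suc n)) < L - \<bar>x\<bar>" by (auto simp: eventually_sequentially)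
    then have "x \<in> {- T n..T n}" by (auto simp: T_def)
    with elim(2) show ?case by (metis indicator_simps(1) mult.right_neutral)
  qed
qed

lemma FTC_prim:
  assumes F: "\<And>x. (F has_real_derivative h x) (at x)" and h: "continuous_on UNIV h" and x: "-L < x" "x \<le> L"
  shows "prim L h x = F x - F (-L)"
proof -
  have hc: "isCont h y" for y using h by (simp add: continuous_on_eq_continuous_at)
  have hb: "h \<in> borel_measurable borel" using h by (rule borel_measurable_continuous_onI)
  have "prim L h x = (LINT y|lebesgue. indicator (Om L) y *\<^sub>R (h y * indicator {..x} y))"
    unfolding prim_def by (rule integral_restrict_space) simp
  also have "\<dots> = (LINT y|lborel. indicator (Om L) y *\<^sub>R (h y * indicator {..x} y))"
    by (rule integral_completion) (use hb in auto)
  also have "\<dots> = (LINT y|lborel. h y * indicator {-L..x} y)"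
  proof (rule integral_cong_AE)
    show "AE y in lborel. indicator (Om L) y *\<^sub>R (h y * indicator {..x} y) = h y * indicator {-L..x} y"
      using AE_lborel_singleton[of "-L"] AE_lborel_singleton[of "L"]
      by eventually_elim (use x in \<open>auto simp: indicator_def\<close>)
  qed (use hb in auto)
  also have "\<dots> = F x - F (-L)"
    by (rule integral_FTC_Icc_real) (use x F hc in auto)
  finally show ?thesis .
qed

lemma integrable_continuous_Om:
  assumes "continuous_on UNIV h"
  shows "integrable (leb L) (h :: real \<Rightarrow> real)"
proof -
  have "bounded (h ` {-L..L})"
    by (intro compact_imp_bounded compact_continuous_image continuous_on_subset[OF assms]) auto
  then obtain C where "\<And>x. x \<in> {-L..L} \<Longrightarrow> norm (h x) \<le> C" by (metis bounded_iff imageI)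
  then show ?thesis
    by (intro finite_measure.integrable_const_bound[OF finite_measure_Om, of _ C] AE_I2
        borel_measurable_Om borel_measurable_continuous_onI assms) auto
qed

lemma integrable_mult_continuous:
  fixes r h :: "real \<Rightarrow> real"
  assumes "integrable (leb L) r" "continuous_on UNIV h"
  shows "integrable (leb L) (\<lambda>x. r x * h x)"
proof -
  have "bounded (h ` {-L..L})"
    by (intro compact_imp_bounded compact_continuous_image continuous_on_subset[OF assms(2)]) auto
  then obtain C where C: "\<And>x. x \<in> {-L..L} \<Longrightarrow> norm (h x) \<le> C" by (metis bounded_iff imageI)
  show ?thesis
  proof (rule Bochner_Integration.integrable_bound)
    show "integrable (leb L) (\<lambda>x. C * r x)" using assms(1) by simp
    show "(\<lambda>x. r x * h x) \<in> borel_measurable (leb L)"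
      using assms by (intro borel_measurable_times borel_measurable_integrable borel_measurable_Om borel_measurable_continuous_onI)
    have "norm (r x * h x) \<le> norm (C * r x)" if "x \<in> Om L" for x
    proof -
      have "\<bar>h x\<bar> \<le> \<bar>C\<bar>" using C[of x] that by auto
      then show ?thesis using mult_left_mono[of "\<bar>h x\<bar>" "\<bar>C\<bar>" "\<bar>r x\<bar>"] by (simp add: abs_mult mult.commute)
    qed
    then show "AE x in leb L. norm (r x * h x) \<le> norm (C * r x)" by (intro AE_I2) simp
  qed
qed

lemma test_function_props:
  assumes "\<phi> \<in> test_functions L" "0 < L"
  shows "\<And>x. (\<phi> has_real_derivative deriv \<phi> x) (at x)" "continuous_on UNIV (deriv \<phi>)"
    "\<And>x. x \<in> Om L \<Longrightarrow> prim L (deriv \<phi>) x = \<phi> x" "(LINT x|leb L. deriv \<phi> x) = 0"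
proof -
  have C: "Ck 1 \<phi>" using assms by (simp add: test_functions_def)
  then have "\<phi> field_differentiable at x" for x unfolding Ck_def by (metis funpow_0 zero_less_one)
  then show D: "(\<phi> has_real_derivative deriv \<phi> x) (at x)" for x
    using field_differentiable_derivI by blast
  show c: "continuous_on UNIV (deriv \<phi>)" using C by (simp add: Ck_def)
  have "closure {x. \<phi> x \<noteq> 0} \<subseteq> Om L" using assms(1) by (simp add: test_functions_def)
  then have "{x. \<phi> x \<noteq> 0} \<subseteq> Om L" by (rule order_trans[OF closure_subset])
  then have z: "\<phi> (-L) = 0" "\<phi> L = 0" by auto
  show "prim L (deriv \<phi>) x = \<phi> x" if "x \<in> Om L" for x
  proof -
    have "prim L (deriv \<phi>) x = \<phi> x - \<phi> (-L)" by (rule FTC_prim[OF D c]) (use that in auto)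
    then show ?thesis by (simp only: z)
  qed
  have "prim L (deriv \<phi>) L = \<phi> L - \<phi> (-L)"
    by (rule FTC_prim[OF D c]) (use assms(2) in auto)
  then show "(LINT x|leb L. deriv \<phi> x) = 0" using z prim_right[of L L "deriv \<phi>"] by simp
qed

text \<open>
  Fix one bump \<open>g\<close> with integral \<open>m \<noteq> 0\<close>. For any other bump \<open>b\<close> the combination \<open>m b - (\<integral> b) g\<close> has
  integral zero, so its primitive is a test function. Hence \<open>\<integral> d b\<close> is a constant multiple of
  \<open>\<integral> b\<close>, and the fundamental lemma applies to \<open>d - c\<close>.
\<close>

lemma du_Bois_Reymond:
  assumes L: "0 < L" and d: "integrable (leb L) d"
    and z: "\<And>\<phi>. \<phi> \<in> test_functions L \<Longrightarrow> (LINT x|leb L. d x * deriv \<phi> x) = 0"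
  shows "\<exists>c. AE x in leb L. d x = c"
proof -
  let ?M = "leb L"
  have bc: "continuous_on UNIV (bump n s t)" for n s t
    using smooth_Ck[OF smooth_bump, of 0] by (simp add: Ck_def)
  define g where "g = bump 0 (-(L/2)) (L/2)"
  define m where "m = (LINT x|?M. g x)"
  have gc: "continuous_on UNIV g" unfolding g_def by (rule bc)
  have gi: "integrable ?M g" by (rule integrable_continuous_Om[OF gc])
  have "m \<noteq> 0"
  proof
    assume "m = 0"
    then have "AE x in ?M. g x = 0"
      using gi unfolding m_def
      by (subst (asm) integral_nonneg_eq_0_iff_AE) (auto simp: g_def bump_range)
    then have "AE x in lebesgue. x \<in> Om L \<longrightarrow> g x = 0" by (subst (asm) AE_restrict_space_iff) auto
    then have "AE x in lebesgue. x \<notin> {-(L/2)<..<L/2}"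
    proof eventually_elim
      case (elim x)
      then show ?case using bump_pos[of x "-(L/2)" "L/2" 0] L by (auto simp: g_def)
    qed
    then have "{-(L/2)<..<L/2} \<in> null_sets lebesgue" by (subst AE_iff_null_sets) auto
    then have "emeasure lebesgue {-(L/2)<..<L/2} = 0" by auto
    then show False using L by (simp add: emeasure_lborel_Ioo)
  qed
  define c where "c = (LINT x|?M. d x * g x) / m"
  have loc: "\<forall>S. compact S \<and> S \<subseteq> Om L \<longrightarrow> (\<lambda>x. d x - c) absolutely_integrable_on S"
    by (rule integrable_imp_loc) (use d in simp)
  have "AE x in ?M. d x - c = 0"
  proof (rule fundamental_lemma[OF loc])
    fix n s t assume st: "-L < s" "s < t" "t < (L::real)"
    define b where "b = bump n s t"
    have bi: "integrable ?M b" and dbi: "integrable ?M (\<lambda>x. d x * b x)" and dgi: "integrable ?M (\<lambda>x. d x * g x)"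
      unfolding b_def by (intro integrable_continuous_Om integrable_mult_continuous bc d gc)+
    define mb where "mb = (LINT x|?M. b x)"
    define h where "h x = m * b x + (- mb) * g x" for x
    have hs: "smooth h" unfolding h_def b_def g_def by (intro smooth.intros smooth_bump)
    have hc: "continuous_on UNIV h" using smooth_Ck[OF hs, of 0] by (simp add: Ck_def)
    obtain F where F: "\<And>x. (F has_real_derivative h x) (at x)"
      using einterval_antiderivative[of "-\<infinity>" "\<infinity>" h] hc
      by (auto simp: continuous_on_eq_continuous_at has_real_derivative_iff_has_vector_derivative)
    define s' t' where "s' = min s (-(L/2))" and "t' = max t (L/2)"
    have st': "-L < s'" "s' < t'" "t' < L" using st L by (auto simp: s'_def t'_def)
    have h0: "h x = 0" if "x \<notin> {s'<..<t'}" for x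
    proof -
      have "x \<notin> {s<..<t}" "x \<notin> {-(L/2)<..<L/2}" using that by (auto simp: s'_def t'_def)
      from bump_outside[OF this(1)] bump_outside[OF this(2)] show ?thesis
        by (simp add: h_def b_def g_def)
    qed
    have FTC: "F y - F x = (LINT w|lborel. h w * indicator {x..y} w)" if "x \<le> y" for x y
      by (rule integral_FTC_Icc_real[symmetric]) (use that F hc in \<open>auto simp: continuous_on_eq_continuous_at\<close>)
    have left: "F x = F s'" if "x \<le> s'" for x
    proof -
      have "(LINT w|lborel. h w * indicator {x..s'} w) = 0"
        by (intro integral_eq_zero_AE AE_I2) (auto simp: indicator_def h0)
      then show ?thesis using FTC[OF that] by simp
    qed
    have right: "F x = F t'" if "t' \<le> x" for x
    proof -
      have "(LINT w|lborel. h w * indicator {t'..x} w) = 0"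
        by (intro integral_eq_zero_AE AE_I2) (auto simp: indicator_def h0)
      then show ?thesis using FTC[OF that] by simp
    qed
    have "(LINT x|?M. h x) = m * mb + (- mb) * m"
      unfolding h_def mb_def m_def using bi gi by simp
    then have "prim L h L = 0" using prim_right[of L L h] by simp
    moreover have "prim L h L = F L - F (-L)" using L by (intro FTC_prim F hc) auto
    ultimately have ends: "F t' = F s'" using left[of "-L"] right[of L] st' by simp
    define \<phi> where "\<phi> x = F x - F s'" for x
    have D\<phi>: "(\<phi> has_real_derivative h x) (at x)" for x
      unfolding \<phi>_def using F by (auto intro!: derivative_eq_intros)
    have "s' \<le> x \<and> x \<le> t'" if "\<phi> x \<noteq> 0" for x
      using that left[of x] right[of x] ends unfolding \<phi>_def by linarith
    then have "{x. \<phi> x \<noteq> 0} \<subseteq> {s'..t'}" by auto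
    then have "closure {x. \<phi> x \<noteq> 0} \<subseteq> {s'..t'}" by (rule closure_minimal) simp
    moreover have "{s'..t'} \<subseteq> Om L" using st' by auto
    moreover have "Ck k \<phi>" for k by (rule Ck_antideriv[OF smooth_Ck[OF hs] D\<phi>])
    ultimately have "\<phi> \<in> test_functions L" unfolding test_functions_def by blast
    from z[OF this] have "(LINT x|?M. d x * deriv \<phi> x) = 0" .
    moreover have "deriv \<phi> = h" using D\<phi> by (intro ext DERIV_imp_deriv)
    ultimately have "(LINT x|?M. d x * h x) = 0" by simp
    moreover have "(LINT x|?M. d x * h x) = m * (LINT x|?M. d x * b x) - mb * (LINT x|?M. d x * g x)"
    proof -
      have "(LINT x|?M. d x * h x) = (LINT x|?M. m * (d x * b x) - mb * (d x * g x))"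
        by (intro Bochner_Integration.integral_cong refl) (simp add: h_def algebra_simps)
      also have "\<dots> = m * (LINT x|?M. d x * b x) - mb * (LINT x|?M. d x * g x)"
        using dbi dgi by (subst Bochner_Integration.integral_diff) auto
      finally show ?thesis .
    qed
    ultimately have eq: "(LINT x|?M. d x * b x) = c * mb"
      using \<open>m \<noteq> 0\<close> by (simp add: c_def field_simps)
    have "(LINT x|?M. (d x - c) * bump n s t x) = (LINT x|?M. d x * b x - c * b x)"
      by (simp add: b_def left_diff_distrib)
    also have "\<dots> = 0"
      using dbi bi eq by (subst Bochner_Integration.integral_diff) (auto simp: mb_def)
    finally show "(LINT x|?M. (d x - c) * bump n s t x) = 0" .
  qed
  then show ?thesis by (auto intro!: exI[of _ c])
qed

lemma has_weak_deriv_prim: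
  assumes L: "0 < L" and v: "integrable (leb L) v"
    and u: "u \<in> borel_measurable (leb L)"
    and uv: "AE x in leb L. u x = c + prim L v x"
  shows "has_weak_deriv L u v"
proof -
  let ?M = "leb L"
  have pi: "integrable ?M (\<lambda>x. c + prim L v x)"
    by (intro integrable_continuous_Om continuous_intros prim_continuous v)
  have ui: "integrable ?M u" by (rule integrable_cong_AE_imp[OF pi u]) (use uv in \<open>auto elim: eventually_mono\<close>)
  have "(LINT x|?M. u x * deriv \<phi> x) = - (LINT x|?M. v x * \<phi> x)" if t: "\<phi> \<in> test_functions L" for \<phi>
  proof -
    note p = test_function_props[OF t L]
    have d\<phi>: "integrable ?M (deriv \<phi>)" by (rule integrable_continuous_Om[OF p(2)])
    have "(LINT x|?M. u x * deriv \<phi> x) = (LINT x|?M. c * deriv \<phi> x + prim L v x * deriv \<phi> x)"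
    proof (rule integral_cong_AE)
      show "(\<lambda>x. u x * deriv \<phi> x) \<in> borel_measurable ?M"
        by (intro borel_measurable_times u borel_measurable_integrable d\<phi>)
      show "(\<lambda>x. c * deriv \<phi> x + prim L v x * deriv \<phi> x) \<in> borel_measurable ?M"
        by (intro borel_measurable_times borel_measurable_add borel_measurable_const prim_measurable v borel_measurable_integrable d\<phi>)
      show "AE x in ?M. u x * deriv \<phi> x = c * deriv \<phi> x + prim L v x * deriv \<phi> x"
        using uv by eventually_elim (simp add: distrib_right)
    qed
    also have "\<dots> = c * (LINT x|?M. deriv \<phi> x) + (LINT x|?M. prim L v x * deriv \<phi> x)"
      using d\<phi> by (subst Bochner_Integration.integral_add)
        (auto intro!: integrable_continuous_Om continuous_intros prim_continuous v p(2))
    also have "\<dots> = (LINT x|?M. prim L v x * deriv \<phi> x)" using p(4) by simp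
    also have "\<dots> = - (LINT x|?M. v x * prim L (deriv \<phi>) x)"
      using prim_integration_by_parts[OF v d\<phi>] p(4) by simp
    also have "(LINT x|?M. v x * prim L (deriv \<phi>) x) = (LINT x|?M. v x * \<phi> x)"
      by (intro Bochner_Integration.integral_cong refl) (simp add: p(3))
    finally show ?thesis .
  qed
  then show ?thesis unfolding has_weak_deriv_def
    using integrable_imp_loc[OF ui] integrable_imp_loc[OF v] by blast
qed

lemma has_weak_deriv_unique:
  assumes "has_weak_deriv L u v" "has_weak_deriv L u w"
  shows "AE x in leb L. v x = w x"
proof -
  have v: "\<forall>S. compact S \<and> S \<subseteq> Om L \<longrightarrow> v absolutely_integrable_on S"
    and w: "\<forall>S. compact S \<and> S \<subseteq> Om L \<longrightarrow> w absolutely_integrable_on S"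
    using assms[unfolded has_weak_deriv_def, THEN conjunct1] by simp_all
  have "AE x in leb L. v x - w x = 0"
  proof (rule fundamental_lemma)
    show "\<forall>S. compact S \<and> S \<subseteq> Om L \<longrightarrow> (\<lambda>x. v x - w x) absolutely_integrable_on S"
    proof (intro allI impI)
      fix S assume "compact S \<and> S \<subseteq> Om L"
      then show "(\<lambda>x. v x - w x) absolutely_integrable_on S"
        using v w by (intro set_integral_diff(1)) blast+
    qed
    fix n s t assume st: "-L < s" "s < t" "t < (L::real)"
    have "(LINT x|leb L. v x * bump n s t x) = (LINT x|leb L. w x * bump n s t x)"
    proof -
      note b = bump_test[OF st(1,3), of n]
      have "(LINT x|leb L. u x * deriv (bump n s t) x) = - (LINT x|leb L. v x * bump n s t x)"
        "(LINT x|leb L. u x * deriv (bump n s t) x) = - (LINT x|leb L. w x * bump n s t x)"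
        using assms[unfolded has_weak_deriv_def, THEN conjunct2, THEN bspec, OF b] by simp_all
      then show ?thesis by linarith
    qed
    then show "(LINT x|leb L. (v x - w x) * bump n s t x) = 0"
      unfolding left_diff_distrib
      by (subst Bochner_Integration.integral_diff) (auto intro!: integrable_mult_bump v w st)
  qed
  then show ?thesis by simp
qed

lemma weak_deriv_AE:
  assumes "has_weak_deriv L u v"
  shows "has_weak_deriv L u (weak_deriv L u)" "AE x in leb L. weak_deriv L u x = v x"
    "weak_deriv L u \<in> borel_measurable (leb L)"
proof -
  show h: "has_weak_deriv L u (weak_deriv L u)" unfolding weak_deriv_def by (rule someI[where P="has_weak_deriv L u", OF assms])
  show "AE x in leb L. weak_deriv L u x = v x" by (rule has_weak_deriv_unique[OF h assms])
  show "weak_deriv L u \<in> borel_measurable (leb L)"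
    using h by (intro loc_measurable) (simp add: has_weak_deriv_def)
qed

lemma has_weak_deriv_imp_prim:
  assumes L: "0 < L" and u: "integrable (leb L) u" and v: "integrable (leb L) v"
    and uv: "has_weak_deriv L u v"
  shows "\<exists>c. AE x in leb L. u x = c + prim L v x"
proof -
  let ?M = "leb L"
  have p: "has_weak_deriv L (prim L v) v"
    by (rule has_weak_deriv_prim[OF L v prim_measurable[OF v], of 0]) simp
  have pi: "integrable ?M (prim L v)" by (intro integrable_continuous_Om prim_continuous v)
  have "\<exists>c. AE x in ?M. u x - prim L v x = c"
  proof (rule du_Bois_Reymond[OF L])
    show "integrable ?M (\<lambda>x. u x - prim L v x)" using u pi by simp
    fix \<phi> assume t: "\<phi> \<in> test_functions L"
    have "(LINT x|?M. u x * deriv \<phi> x) = (LINT x|?M. prim L v x * deriv \<phi> x)"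
      using uv p t unfolding has_weak_deriv_def by simp
    then show "(LINT x|?M. (u x - prim L v x) * deriv \<phi> x) = 0"
      unfolding left_diff_distrib
      by (subst Bochner_Integration.integral_diff)
         (auto intro!: integrable_mult_continuous u pi test_function_props[OF t L])
  qed
  then obtain c where "AE x in ?M. u x - prim L v x = c" ..
  then have "AE x in ?M. u x = c + prim L v x" by eventually_elim simp
  then show ?thesis ..
qed

lemma H1_iff_prim:
  assumes L: "0 < L"
  shows "u \<in> H1 L \<longleftrightarrow> u \<in> L2 L \<and> (\<exists>v\<in>L2 L. \<exists>c. AE x in leb L. u x = c + prim L v x)"
proof
  assume "u \<in> H1 L"
  then obtain v where uv: "u \<in> L2 L" "v \<in> L2 L" "has_weak_deriv L u v" unfolding H1_def by blast
  from has_weak_deriv_imp_prim[OF L L2_integrable[OF uv(1)] L2_integrable[OF uv(2)] uv(3)] uv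
  show "u \<in> L2 L \<and> (\<exists>v\<in>L2 L. \<exists>c. AE x in leb L. u x = c + prim L v x)" by auto
next
  assume "u \<in> L2 L \<and> (\<exists>v\<in>L2 L. \<exists>c. AE x in leb L. u x = c + prim L v x)"
  then obtain v c where uv: "u \<in> L2 L" "v \<in> L2 L" "AE x in leb L. u x = c + prim L v x" by auto
  from has_weak_deriv_prim[OF L L2_integrable[OF uv(2)] L2_measurable[OF uv(1)] uv(3)] uv(1,2)
  show "u \<in> H1 L" unfolding H1_def by auto
qed

lemma H1_obtain:
  assumes L: "0 < L" and u: "u \<in> H1 L"
  obtains v c where "v \<in> L2 L" "has_weak_deriv L u v" "AE x in leb L. u x = c + prim L v x"
    "AE x in leb L. weak_deriv L u x = v x" "weak_deriv L u \<in> borel_measurable (leb L)"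
proof -
  obtain v where v: "u \<in> L2 L" "v \<in> L2 L" "has_weak_deriv L u v" using u unfolding H1_def by blast
  obtain c where c: "AE x in leb L. u x = c + prim L v x"
    using has_weak_deriv_imp_prim[OF L L2_integrable[OF v(1)] L2_integrable[OF v(2)] v(3)] by auto
  show ?thesis by (rule that[OF v(2,3) c weak_deriv_AE(2,3)[OF v(3)]])
qed

lemma cont_rep_eq:
  assumes L: "0 < L" and g: "continuous_on {-L..L} g" "AE x in leb L. g x = u x" and x: "x \<in> {-L..L}"
  shows "cont_rep L u x = g x"
proof -
  let ?h = "cont_rep L u"
  have "continuous_on {-L..L} ?h \<and> (AE x in leb L. ?h x = u x)"
    unfolding cont_rep_def by (rule someI[of _ g]) (use g in simp)
  then have h: "continuous_on {-L..L} ?h" "AE x in leb L. ?h x = u x" by auto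
  have "AE x in leb L. ?h x = g x" using h(2) g(2) by eventually_elim simp
  then have ae: "AE x in lebesgue. x \<in> Om L \<longrightarrow> ?h x = g x"
    by (subst (asm) AE_restrict_space_iff) auto
  have eq: "?h y = g y" if y: "y \<in> Om L" for y
  proof (rule ccontr)
    assume ne: "?h y \<noteq> g y"
    have op: "open (Om L \<inter> (\<lambda>x. ?h x - g x) -` (- {0}))"
      by (intro continuous_open_preimage continuous_on_diff continuous_on_subset[OF h(1)]
          continuous_on_subset[OF g(1)]) auto
    have n: "Om L \<inter> (\<lambda>x. ?h x - g x) -` (- {0}) \<in> null_sets lebesgue"
    proof (subst AE_iff_null_sets)
      show "Om L \<inter> (\<lambda>x. ?h x - g x) -` (- {0}) \<in> sets lebesgue"
        using op by (simp add: borel_open)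
      show "AE x in lebesgue. x \<notin> Om L \<inter> (\<lambda>x. ?h x - g x) -` (- {0})"
        using ae by eventually_elim auto
    qed
    have "y \<in> Om L \<inter> (\<lambda>x. ?h x - g x) -` (- {0})" using y ne by auto
    with op obtain e where e: "0 < e" "ball y e \<subseteq> Om L \<inter> (\<lambda>x. ?h x - g x) -` (- {0})"
      unfolding open_contains_ball by blast
    have "ball y e \<in> null_sets lebesgue" by (rule null_sets_subset[OF n _ e(2)]) simp
    then have "emeasure lebesgue {y - e<..<y + e} = 0" unfolding ball_eq_greaterThanLessThan by auto
    then show False using e(1) by (simp add: emeasure_lborel_Ioo)
  qed
  have cl: "closure (Om L) = {-L..L}" using L by simp
  have "(\<lambda>x. ?h x - g x) x = 0"
  proof (rule continuous_constant_on_closure[of "Om L" "\<lambda>x. ?h x - g x"])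
    show "continuous_on (closure (Om L)) (\<lambda>x. ?h x - g x)"
      unfolding cl by (intro continuous_on_diff h(1) g(1))
    show "?h y - g y = 0" if "y \<in> Om L" for y using eq[OF that] by simp
    show "x \<in> closure (Om L)" unfolding cl by (rule x)
  qed
  then show ?thesis by simp
qed

section \<open>Existence of a multiplier\<close>

text \<open>
  A substitute for Lebesgue points. The points at which some sublevel set with rational level is
  null in some rational neighbourhood, although the point belongs to it, form a countable union of
  null sets.
\<close>

lemma essentially_lower_points:
  fixes g :: "real \<Rightarrow> real"
  assumes g: "g \<in> borel_measurable lebesgue"
  obtains S where "- S \<in> null_sets lebesgue"
    "\<And>s \<beta> e. s \<in> S \<Longrightarrow> g s < \<beta> \<Longrightarrow> 0 < e \<Longrightarrow> {x. \<bar>x - s\<bar> < e \<and> g x < \<beta>} \<notin> null_sets lebesgue"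
proof -
  define A where "A = (\<lambda>(p, r, \<beta>). {x. p < x \<and> x < r \<and> g x < \<beta>})"
  define I where "I = {i \<in> \<rat> \<times> \<rat> \<times> \<rat>. A i \<in> null_sets lebesgue}"
  have meas: "{x. p < x \<and> x < r \<and> g x < \<beta>} \<in> sets lebesgue" for p r \<beta>
  proof -
    have "{x. g x < \<beta>} \<in> sets lebesgue"
      using borel_measurable_less[OF g borel_measurable_const[of \<beta>]] by simp
    then have "{p<..<r} \<inter> {x. g x < \<beta>} \<in> sets lebesgue" by (intro sets.Int) simp_all
    moreover have "{p<..<r} \<inter> {x. g x < \<beta>} = {x. p < x \<and> x < r \<and> g x < \<beta>}" by auto
    ultimately show ?thesis by (simp only:)
  qed
  have cQ: "countable (\<rat> \<times> \<rat> \<times> \<rat> :: (real \<times> real \<times> real) set)"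
    by (simp add: countable_rat)
  have "I \<subseteq> \<rat> \<times> \<rat> \<times> \<rat>" unfolding I_def by (rule Collect_restrict)
  then have "countable I" by (rule countable_subset[OF _ cQ])
  then have null: "(\<Union>i\<in>I. A i) \<in> null_sets lebesgue"
    by (rule null_sets_UN') (auto simp: I_def)
  show ?thesis
  proof (rule that[of "- (\<Union>i\<in>I. A i)"])
    show "- (- (\<Union>i\<in>I. A i)) \<in> null_sets lebesgue" using null by simp
    fix s \<beta> e :: real assume s: "s \<in> - (\<Union>i\<in>I. A i)" and \<beta>: "g s < \<beta>" and e: "0 < e"
    obtain \<beta>' where \<beta>': "\<beta>' \<in> \<rat>" "g s < \<beta>'" "\<beta>' < \<beta>" using Rats_dense_in_real[OF \<beta>] by blast
    obtain p where p: "p \<in> \<rat>" "s - e < p" "p < s" using Rats_dense_in_real[of "s - e" s] e by auto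
    obtain r where r: "r \<in> \<rat>" "s < r" "r < s + e" using Rats_dense_in_real[of s "s + e"] e by auto
    have sA: "s \<in> A (p, r, \<beta>')" using p r \<beta>' by (simp add: A_def)
    have nA: "A (p, r, \<beta>') \<notin> null_sets lebesgue"
    proof
      assume "A (p, r, \<beta>') \<in> null_sets lebesgue"
      then have "(p, r, \<beta>') \<in> I" using p r \<beta>' by (simp add: I_def)
      then show False using s sA by blast
    qed
    show "{x. \<bar>x - s\<bar> < e \<and> g x < \<beta>} \<notin> null_sets lebesgue"
    proof
      assume n: "{x. \<bar>x - s\<bar> < e \<and> g x < \<beta>} \<in> null_sets lebesgue"
      have "A (p, r, \<beta>') \<subseteq> {x. \<bar>x - s\<bar> < e \<and> g x < \<beta>}"
        using p r \<beta>' by (auto simp: A_def)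
      then have "A (p, r, \<beta>') \<in> null_sets lebesgue"
        by (rule null_sets_subset[OF n, rotated]) (simp add: A_def meas)
      with nA show False by simp
    qed
  qed
qed

lemma prim_indicator:
  assumes E: "E \<in> lmeasurable" and x: "-L \<le> x" "x < L"
  shows "prim L (indicator E) x = measure lebesgue (E \<inter> {..x}) - measure lebesgue (E \<inter> {..-L})"
proof -
  have Ex: "E \<inter> S \<in> lmeasurable" if "S \<in> sets borel" for S
    by (rule fmeasurable_Int_fmeasurable[OF E]) (use that in auto)
  have "prim L (indicator E) x = (LINT y|lebesgue. indicator (Om L) y *\<^sub>R (indicator E y * indicator {..x} y))"
    unfolding prim_def by (rule integral_restrict_space) simp
  also have "\<dots> = (LINT y|lebesgue. indicator (E \<inter> {-L<..x}) y)"
    using x by (intro Bochner_Integration.integral_cong refl) (auto simp: indicator_def)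
  also have "\<dots> = measure lebesgue (E \<inter> {-L<..x})" by simp
  also have "E \<inter> {-L<..x} = (E \<inter> {..x}) - (E \<inter> {..-L})" by auto
  also have "measure lebesgue \<dots> = measure lebesgue (E \<inter> {..x}) - measure lebesgue (E \<inter> {..-L})"
  proof (rule measure_Diff)
    show "emeasure lebesgue (E \<inter> {..x}) \<noteq> \<infinity>"
      using fmeasurableD2[OF Ex[of "{..x}"]] by (simp add: infinity_ennreal_def)
  qed (use x Ex[of "{..x}"] Ex[of "{..-L}"] in \<open>auto dest: fmeasurableD\<close>)
  finally show ?thesis .
qed

text \<open>
  The primitive of the normalised indicator function of \<open>E\<close>. It approximates a jump from \<open>0\<close> to \<open>1\<close> at \<open>s\<close> when \<open>E\<close>
  shrinks to \<open>s\<close>.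
\<close>

definition step_fn :: "real set \<Rightarrow> real \<Rightarrow> real" where
  "step_fn E x = measure lebesgue (E \<inter> {..x}) / measure lebesgue E"

lemma step_fn_range:
  assumes "E \<in> lmeasurable"
  shows "0 \<le> step_fn E x" "step_fn E x \<le> 1"
proof -
  have "measure lebesgue (E \<inter> {..x}) \<le> measure lebesgue E"
    using assms by (intro measure_mono_fmeasurable) (auto dest: fmeasurableD)
  then show "0 \<le> step_fn E x" "step_fn E x \<le> 1"
    by (auto simp: step_fn_def divide_le_eq_1 zero_less_measure_iff)
qed

lemma step_fn_limit:
  assumes E: "\<And>n. E n \<in> lmeasurable" "\<And>n. measure lebesgue (E n) > 0"
    and sub: "\<And>n. E n \<subseteq> {x. \<bar>x - s\<bar> < inverse (real (Suc n))}" and x: "x \<noteq> s"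
  shows "\<forall>\<^sub>F n in sequentially. step_fn (E n) x = (if s < x then 1 else 0)"
proof -
  have "0 < \<bar>x - s\<bar>" using x by simp
  from order_tendstoD(2)[OF LIMSEQ_inverse_real_of_nat this] show ?thesis
  proof eventually_elim
    case (elim n)
    show ?case
    proof (cases "s < x")
      case True
      then have "E n \<inter> {..x} = E n" using sub[of n] elim by force
      then show ?thesis using True E(2)[of n] by (simp add: step_fn_def)
    next
      case False
      then have "E n \<inter> {..x} = {}" using sub[of n] elim by force
      then show ?thesis using False by (simp add: step_fn_def)
    qed
  qed
qed

text \<open>
  The hypothesis \<open>dir\<close> says that the support function of the set of pairs \<open>(\<sigma>, \<eta>)\<close> with
  \<open>a \<le> \<sigma> \<le> b\<close>, \<open>l \<le> \<eta> \<le> u\<close> is non-negative on all pairs \<open>(\<phi>', \<phi>)\<close>; in general the existence of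
  a pair with \<open>\<sigma>' = \<eta>\<close> would then come from a Hahn--Banach argument. On an interval it suffices to test with
  \<open>\<phi>\<close> close to plus or minus the indicator function of an interval with end points \<open>s\<close>, \<open>t\<close>: here \<open>\<phi>'\<close> is concentrated on sets near
  \<open>s\<close> where \<open>b\<close> is almost as small as \<open>b(s)\<close> and near \<open>t\<close> where \<open>a\<close> is almost as large as \<open>a(t)\<close>.
\<close>

lemma multiplier_exists:
  fixes a b l u :: "real \<Rightarrow> real"
  assumes L: "0 < L"
    and a: "integrable (leb L) a" and b: "integrable (leb L) b"
    and l: "integrable (leb L) l" and u: "integrable (leb L) u"
    and ab: "\<And>x. a x \<le> b x" and lu: "\<And>x. l x \<le> u x"
    and dir: "\<And>q c. q \<in> borel_measurable (leb L) \<Longrightarrow> (\<exists>C. \<forall>x. \<bar>q x\<bar> \<le> C) \<Longrightarrow>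
      0 \<le> (LINT x|leb L. max (q x * a x) (q x * b x)) +
          (LINT x|leb L. max ((c + prim L q x) * l x) ((c + prim L q x) * u x))"
  obtains \<eta> where "integrable (leb L) \<eta>" "prim L \<eta> L = 0"
    "\<And>x. x \<in> Om L \<Longrightarrow> l x \<le> \<eta> x \<and> \<eta> x \<le> u x"
    "AE x in leb L. a x \<le> prim L \<eta> x \<and> prim L \<eta> x \<le> b x"
proof -
  let ?M = "leb L"
  \<comment> \<open>Points outside \<open>\<Omega>\<close> are admitted as \<open>s\<close> and \<open>t\<close>; they carry the boundary condition \<open>\<sigma>(\<plusminus>L) = 0\<close>.\<close>
  define a' where "a' x = (if x \<in> Om L then a x else 0)" for x
  define b' where "b' x = (if x \<in> Om L then b x else 0)" for x
  have ab': "a' x \<le> b' x" for x using ab by (simp add: a'_def b'_def)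
  have am: "a' \<in> borel_measurable lebesgue" and bm: "b' \<in> borel_measurable lebesgue"
    using borel_measurable_integrable[OF a] borel_measurable_integrable[OF b]
    unfolding a'_def b'_def by (auto intro!: borel_measurable_if_I simp del: greaterThanLessThan_iff)
  obtain Sb where Sb: "- Sb \<in> null_sets lebesgue"
    "\<And>s \<beta> e. s \<in> Sb \<Longrightarrow> b' s < \<beta> \<Longrightarrow> 0 < e \<Longrightarrow> {x. \<bar>x - s\<bar> < e \<and> b' x < \<beta>} \<notin> null_sets lebesgue"
    using essentially_lower_points[OF bm] by blast
  have am': "(\<lambda>x. - a' x) \<in> borel_measurable lebesgue" using am by (rule borel_measurable_uminus)
  obtain Sa where Sa: "- Sa \<in> null_sets lebesgue"
    "\<And>s \<beta> e. s \<in> Sa \<Longrightarrow> - a' s < \<beta> \<Longrightarrow> 0 < e \<Longrightarrow> {x. \<bar>x - s\<bar> < e \<and> - a' x < \<beta>} \<notin> null_sets lebesgue"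
    using essentially_lower_points[OF am'] by blast
  define S where "S = Sa \<inter> Sb"
  have Snull: "- S \<in> null_sets lebesgue"
    using null_sets.Un[OF Sa(1) Sb(1)] by (simp add: S_def Un_commute)
  have nbhd: "{x. \<bar>x - s\<bar> < e} \<in> lmeasurable" for s e :: real
  proof -
    have "{x. \<bar>x - s\<bar> < e} = ball s e" by (auto simp: dist_real_def)
    then show ?thesis by simp
  qed
  have key: "\<alpha> - \<beta> \<le> max (prim L u t - prim L u s) (prim L l t - prim L l s)"
    if s: "s \<in> S" and t: "t \<in> S" and st: "s \<noteq> t" and \<beta>: "b' s < \<beta>" and \<alpha>: "\<alpha> < a' t" for s t \<alpha> \<beta>
  proof -
    define e where "e n = inverse (real (Suc n))" for n
    have e: "0 < e n" for n by (simp add: e_def)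
    define E where "E n = {x. \<bar>x - s\<bar> < e n \<and> b' x < \<beta>}" for n
    define F where "F n = {x. \<bar>x - t\<bar> < e n \<and> - a' x < - \<alpha>}" for n
    have EF: "E n \<in> lmeasurable" "F n \<in> lmeasurable" for n
    proof -
      have "{x. b' x < \<beta>} \<in> sets lebesgue" "{x. - a' x < - \<alpha>} \<in> sets lebesgue"
        using borel_measurable_less[OF bm borel_measurable_const[of \<beta>]]
          borel_measurable_less[OF am' borel_measurable_const[of "- \<alpha>"]] by simp_all
      then have "{x. \<bar>x - s\<bar> < e n} \<inter> {x. b' x < \<beta>} \<in> lmeasurable"
        "{x. \<bar>x - t\<bar> < e n} \<inter> {x. - a' x < - \<alpha>} \<in> lmeasurable"
        using nbhd by (intro fmeasurable_Int_fmeasurable; simp)+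
      then show "E n \<in> lmeasurable" "F n \<in> lmeasurable"
        by (simp_all add: E_def F_def Collect_conj_eq)
    qed
    have null0: "A \<in> null_sets lebesgue" if "A \<in> lmeasurable" "measure lebesgue A = 0" for A :: "real set"
      using that emeasure_eq_measure2[OF that(1)] by (intro null_setsI) (auto dest: fmeasurableD)
    have pos: "0 < measure lebesgue (E n)" "0 < measure lebesgue (F n)" for n
    proof -
      have "E n \<notin> null_sets lebesgue" "F n \<notin> null_sets lebesgue"
        unfolding E_def F_def using Sb(2)[of s \<beta> "e n"] Sa(2)[of t "- \<alpha>" "e n"] s t \<beta> \<alpha> e[of n]
        by (simp_all add: S_def)
      then show "0 < measure lebesgue (E n)" "0 < measure lebesgue (F n)"
        using EF[of n] measure_nonneg[of lebesgue "E n"] measure_nonneg[of lebesgue "F n"]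
          null0[of "E n"] null0[of "F n"] by (simp_all add: less_le) metis+
    qed
    define q where "q n x = indicator (E n) x / measure lebesgue (E n) - indicator (F n) x / measure lebesgue (F n)" for n x
    define \<phi> where "\<phi> n x = step_fn (E n) x - step_fn (F n) x" for n x
    have indM: "indicator A \<in> borel_measurable ?M" if "A \<in> lmeasurable" for A
      using that by (intro measurable_restrict_space1 borel_measurable_indicator) (auto dest: fmeasurableD)
    have iindM: "integrable ?M (indicator A :: real \<Rightarrow> real)" if "A \<in> lmeasurable" for A
      by (rule finite_measure.integrable_const_bound[OF finite_measure_Om, of _ 1])
        (use indM[OF that] in \<open>auto simp: indicator_def\<close>)
    have qm: "q n \<in> borel_measurable ?M" for n
      unfolding q_def by (intro borel_measurable_diff borel_measurable_divide borel_measurable_const indM EF)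
    have qb: "\<exists>C. \<forall>x. \<bar>q n x\<bar> \<le> C" for n
    proof (intro exI allI)
      fix x
      have "\<bar>q n x\<bar> \<le> \<bar>indicator (E n) x / measure lebesgue (E n)\<bar> + \<bar>indicator (F n) x / measure lebesgue (F n)\<bar>"
        unfolding q_def by (rule abs_triangle_ineq4)
      also have "\<dots> \<le> 1 / measure lebesgue (E n) + 1 / measure lebesgue (F n)"
        by (intro add_mono) (use pos[of n] in \<open>auto simp: indicator_def\<close>)
      finally show "\<bar>q n x\<bar> \<le> 1 / measure lebesgue (E n) + 1 / measure lebesgue (F n)" .
    qed
    \<comment> \<open>The mass of \<open>q n\<close> to the left of \<open>\<Omega>\<close> enters as the constant of integration.\<close>
    define c where "c n = \<phi> n (-L)" for n
    have primq: "c n + prim L (q n) x = \<phi> n x" if x: "x \<in> Om L" for n x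
    proof -
      have q_eq: "q n = (\<lambda>x. (1 / measure lebesgue (E n)) * indicator (E n) x
          + (- 1 / measure lebesgue (F n)) * indicator (F n) x)"
        by (auto simp: q_def)
      have "prim L (q n) x = (1 / measure lebesgue (E n)) * prim L (indicator (E n)) x
          + (- 1 / measure lebesgue (F n)) * prim L (indicator (F n)) x"
        unfolding q_eq prim_cmult[symmetric] by (intro prim_add integrable_mult_right iindM EF)
      also have "\<dots> = \<phi> n x - \<phi> n (-L)"
        using x EF[of n] by (simp add: prim_indicator \<phi>_def step_fn_def diff_divide_distrib)
      finally show ?thesis by (simp add: c_def)
    qed
    have disj: "\<forall>\<^sub>F n in sequentially. E n \<inter> F n = {}"
    proof -
      have "0 < \<bar>s - t\<bar> / 2" using st by simp
      from order_tendstoD(2)[OF LIMSEQ_inverse_real_of_nat this] show ?thesis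
      proof eventually_elim
        case (elim n)
        show ?case
        proof (rule ccontr)
          assume "E n \<inter> F n \<noteq> {}"
          then obtain x where "\<bar>x - s\<bar> < e n" "\<bar>x - t\<bar> < e n" by (auto simp: E_def F_def)
          moreover have "\<bar>s - t\<bar> \<le> \<bar>x - s\<bar> + \<bar>x - t\<bar>" by arith
          ultimately show False using elim by (simp add: e_def)
        qed
      qed
    qed
    have first: "\<forall>\<^sub>F n in sequentially. (LINT x|?M. max (q n x * a x) (q n x * b x)) \<le> \<beta> - \<alpha>"
      using disj
    proof eventually_elim
      case (elim n)
      let ?mE = "measure lebesgue (E n)" and ?mF = "measure lebesgue (F n)"
      define r where "r x = (\<beta> / ?mE) * indicator (E n) x - (\<alpha> / ?mF) * indicator (F n) x" for x
      have ind: "integrable lebesgue (indicator (E n) :: real \<Rightarrow> real)" "integrable lebesgue (indicator (F n) :: real \<Rightarrow> real)"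
        by (intro integrable_real_indicator; use EF[of n] in \<open>simp add: fmeasurable_def del: emeasure_completion\<close>)+
      have ir: "integrable lebesgue r" unfolding r_def using ind by auto
      have "(LINT x|lebesgue. r x) = (\<beta> / ?mE) * ?mE - (\<alpha> / ?mF) * ?mF"
        unfolding r_def using ind by simp
      also have "\<dots> = \<beta> - \<alpha>" using pos[of n] by simp
      finally have r1: "(LINT x|lebesgue. r x) = \<beta> - \<alpha>" .
      have qa: "integrable ?M (\<lambda>x. q n x * h x)" if h: "integrable ?M h" for h
      proof -
        obtain C where C: "\<And>x. \<bar>q n x\<bar> \<le> C" using qb by blast
        show ?thesis
        proof (rule Bochner_Integration.integrable_bound)
          show "integrable ?M (\<lambda>x. C * h x)" using h by simp
          show "(\<lambda>x. q n x * h x) \<in> borel_measurable ?M"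
            by (intro borel_measurable_times qm borel_measurable_integrable h)
          have "\<bar>q n x\<bar> * \<bar>h x\<bar> \<le> \<bar>C\<bar> * \<bar>h x\<bar>" for x
            by (intro mult_right_mono) (use C[of x] in auto)
          then show "AE x in ?M. norm (q n x * h x) \<le> norm (C * h x)" by (simp add: abs_mult)
        qed
      qed
      have im: "integrable ?M (\<lambda>x. max (q n x * a x) (q n x * b x))"
        by (intro integrable_max qa a b)
      then have im': "integrable lebesgue (\<lambda>x. indicator (Om L) x *\<^sub>R max (q n x * a x) (q n x * b x))"
        by (subst (asm) integrable_restrict_space) auto
      have "(LINT x|?M. max (q n x * a x) (q n x * b x))
          = (LINT x|lebesgue. indicator (Om L) x *\<^sub>R max (q n x * a x) (q n x * b x))"
        by (rule integral_restrict_space) simp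
      also have "\<dots> \<le> (LINT x|lebesgue. r x)"
      proof (rule integral_mono[OF im' ir])
        fix x
        have eq: "indicator (Om L) x *\<^sub>R max (q n x * a x) (q n x * b x) = max (q n x * a' x) (q n x * b' x)"
          by (simp add: a'_def b'_def)
        consider "x \<in> E n" "x \<notin> F n" | "x \<in> F n" "x \<notin> E n" | "x \<notin> E n" "x \<notin> F n" using elim by blast
        then show "indicator (Om L) x *\<^sub>R max (q n x * a x) (q n x * b x) \<le> r x"
          unfolding eq
        proof cases
          case 1
          then have "b' x \<le> \<beta>" "a' x \<le> \<beta>" using ab'[of x] by (auto simp: E_def)
          then show "max (q n x * a' x) (q n x * b' x) \<le> r x"
            using 1 pos(1)[of n] by (simp add: q_def r_def divide_right_mono)
        next
          case 2
          then have "\<alpha> \<le> a' x" "\<alpha> \<le> b' x" using ab'[of x] by (auto simp: F_def)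
          then show "max (q n x * a' x) (q n x * b' x) \<le> r x"
            using 2 pos(2)[of n] by (simp add: q_def r_def divide_right_mono)
        next
          case 3
          then show "max (q n x * a' x) (q n x * b' x) \<le> r x" by (simp add: q_def r_def)
        qed
      qed
      finally show ?case using r1 by simp
    qed
    \<comment> \<open>The limit of \<open>\<phi> n\<close>: the indicator function of \<open>(s, t)\<close> if \<open>s < t\<close>, and minus that of \<open>(t, s)\<close> otherwise.\<close>
    define \<psi> where "\<psi> x = (if s < x then 1 else 0) - (if t < x then 1 else (0::real))" for x
    have lim: "(\<lambda>n. LINT x|?M. max ((c n + prim L (q n) x) * l x) ((c n + prim L (q n) x) * u x))
        \<longlonglongrightarrow> (LINT x|?M. max (\<psi> x * l x) (\<psi> x * u x))"
    proof (rule integral_dominated_convergence)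
      have lM: "l \<in> borel_measurable ?M" and uM: "u \<in> borel_measurable ?M" using l u by auto
      have qi: "integrable ?M (q n)" for n
        unfolding q_def by (intro Bochner_Integration.integrable_diff integrable_divide iindM EF)
      show "(\<lambda>x. max ((c n + prim L (q n) x) * l x) ((c n + prim L (q n) x) * u x)) \<in> borel_measurable ?M" for n
        by (intro borel_measurable_max borel_measurable_times borel_measurable_add borel_measurable_const
            prim_measurable qi lM uM)
      have \<psi>M: "\<psi> \<in> borel_measurable ?M" unfolding \<psi>_def
        by (rule borel_measurable_Om) measurable
      show "(\<lambda>x. max (\<psi> x * l x) (\<psi> x * u x)) \<in> borel_measurable ?M"
        by (intro borel_measurable_max borel_measurable_times \<psi>M lM uM)
      show "integrable ?M (\<lambda>x. \<bar>l x\<bar> + \<bar>u x\<bar>)" using l u by auto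
      show "AE x in ?M. (\<lambda>n. max ((c n + prim L (q n) x) * l x) ((c n + prim L (q n) x) * u x))
          \<longlonglongrightarrow> max (\<psi> x * l x) (\<psi> x * u x)"
        using AE_Om_neq[of s] AE_Om_neq[of t] AE_space
      proof eventually_elim
        case (elim x)
        have x: "x \<in> Om L" using elim by simp
        have "\<forall>\<^sub>F n in sequentially. step_fn (E n) x = (if s < x then 1 else 0)"
          by (rule step_fn_limit) (use EF pos elim in \<open>auto simp: E_def e_def\<close>)
        moreover have "\<forall>\<^sub>F n in sequentially. step_fn (F n) x = (if t < x then 1 else 0)"
          by (rule step_fn_limit) (use EF pos elim in \<open>auto simp: F_def e_def\<close>)
        ultimately have "\<forall>\<^sub>F n in sequentially. c n + prim L (q n) x = \<psi> x"
          by eventually_elim (simp only: primq[OF x] \<phi>_def \<psi>_def)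
        then have "\<forall>\<^sub>F n in sequentially. max ((c n + prim L (q n) x) * l x) ((c n + prim L (q n) x) * u x)
            = max (\<psi> x * l x) (\<psi> x * u x)"
          by eventually_elim simp
        then show ?case by (rule tendsto_eventually)
      qed
      show "AE x in ?M. norm (max ((c n + prim L (q n) x) * l x) ((c n + prim L (q n) x) * u x)) \<le> \<bar>l x\<bar> + \<bar>u x\<bar>" for n
        using AE_space
      proof eventually_elim
        case (elim x)
        then have x: "x \<in> Om L" by simp
        have "\<bar>\<phi> n x\<bar> \<le> 1"
          using step_fn_range[OF EF(1)[of n], of x] step_fn_range[OF EF(2)[of n], of x] by (simp add: \<phi>_def)
        then have "\<bar>\<phi> n x * l x\<bar> \<le> \<bar>l x\<bar>" "\<bar>\<phi> n x * u x\<bar> \<le> \<bar>u x\<bar>"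
          by (auto simp: abs_mult intro: mult_left_le_one_le)
        then show ?case unfolding primq[OF x] real_norm_def by linarith
      qed
    qed
    have "\<forall>\<^sub>F n in sequentially. \<alpha> - \<beta> \<le> (LINT x|?M. max ((c n + prim L (q n) x) * l x) ((c n + prim L (q n) x) * u x))"
      using first
    proof eventually_elim
      case (elim n)
      then show ?case using dir[OF qm qb, of n "c n"] by linarith
    qed
    then have "\<alpha> - \<beta> \<le> (LINT x|?M. max (\<psi> x * l x) (\<psi> x * u x))"
      by (intro tendsto_lowerbound[OF lim]) simp_all
    also have "\<dots> \<le> max (prim L u t - prim L u s) (prim L l t - prim L l s)"
    proof (cases "s < t")
      case True
      have "(LINT x|?M. max (\<psi> x * l x) (\<psi> x * u x)) = (LINT x|?M. u x * indicator {s<..t} x)"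
        using True lu by (intro Bochner_Integration.integral_cong refl) (auto simp: \<psi>_def indicator_def)
      then show ?thesis using prim_diff[OF u, of s t] True by simp
    next
      case False
      have "(LINT x|?M. max (\<psi> x * l x) (\<psi> x * u x)) = (LINT x|?M. - (l x * indicator {t<..s} x))"
        using False lu by (intro Bochner_Integration.integral_cong refl) (auto simp: \<psi>_def indicator_def)
      then show ?thesis using prim_diff[OF l, of t s] False by simp
    qed
    finally show ?thesis .
  qed
  have key': "a' t \<le> b' s + max (prim L u t - prim L u s) (prim L l t - prim L l s)"
    if s: "s \<in> S" and t: "t \<in> S" for s t
  proof (cases "s = t")
    case True
    then show ?thesis using ab'[of t] by simp
  next
    case False
    let ?d = "max (prim L u t - prim L u s) (prim L l t - prim L l s)"
    show ?thesis
    proof (rule field_le_epsilon)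
      fix e :: real assume "0 < e"
      then have "(a' t - e / 2) - (b' s + e / 2) \<le> ?d" by (intro key[OF s t False]) auto
      then show "a' t \<le> b' s + ?d + e" by (simp add: field_simps)
    qed
  qed
  have inS: "\<exists>x\<in>S. p < x \<and> x < r" if "p < (r::real)" for p r
  proof (rule ccontr)
    assume "\<not> ?thesis"
    then have "{p<..<r} \<subseteq> - S" by auto
    then have "{p<..<r} \<in> null_sets lebesgue" by (rule null_sets_subset[OF Snull, rotated]) simp
    then have "emeasure lebesgue {p<..<r} = 0" by auto
    then show False using that by (simp add: emeasure_lborel_Ioo)
  qed
  have Sne: "S \<noteq> {}" using inS[of 0 1] by auto
  obtain \<sigma> \<eta> where \<sigma>: "integrable ?M \<eta>"
    "\<And>x. x \<in> Om L \<Longrightarrow> l x \<le> \<eta> x \<and> \<eta> x \<le> u x"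
    "\<And>x y. \<sigma> y - \<sigma> x = prim L \<eta> y - prim L \<eta> x"
    "\<And>t. t \<in> S \<Longrightarrow> a' t \<le> \<sigma> t \<and> \<sigma> t \<le> b' t"
    by (rule prim_interpolation[where a=a' and b=b', OF l u lu Sne key'], assumption, assumption, rule that)
  obtain y where y: "y \<in> S" "y < -L" using inS[of "-L-1" "-L"] by auto
  have "\<sigma> y = 0" using \<sigma>(4)[OF y(1)] y(2) by (auto simp: a'_def b'_def)
  then have \<sigma>p: "\<sigma> x = prim L \<eta> x" for x using \<sigma>(3)[of x y] prim_left[of y L \<eta>] y(2) by simp
  obtain w where w: "w \<in> S" "L < w" using inS[of L "L+1"] by auto
  have "\<sigma> w = 0" using \<sigma>(4)[OF w(1)] w(2) by (auto simp: a'_def b'_def)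
  then have "prim L \<eta> L = 0" using \<sigma>p[of w] prim_right[of L w \<eta>] prim_right[of L L \<eta>] w(2) by simp
  moreover have "AE x in ?M. a x \<le> prim L \<eta> x \<and> prim L \<eta> x \<le> b x"
  proof (subst AE_restrict_space_iff)
    have "AE x in lebesgue. x \<in> S" using AE_not_in[OF Snull] by simp
    then show "AE x in lebesgue. x \<in> Om L \<longrightarrow> a x \<le> prim L \<eta> x \<and> prim L \<eta> x \<le> b x"
    proof eventually_elim
      case (elim x)
      then show ?case using \<sigma>(4)[of x] \<sigma>p[of x] by (auto simp: a'_def b'_def)
    qed
  qed simp
  ultimately show ?thesis using \<sigma>(2) by (intro that[OF \<sigma>(1)])
qed

section \<open>The integrand and the potential\<close>

text \<open>
  What the argument uses of \<open>f\<^sup>\<epsilon>\<close>, uniformly in \<open>\<epsilon> \<in> [0, 1]\<close>: \<open>[fl p, fr p]\<close> is the subdifferential at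
  \<open>p\<close>, so the directional derivative of \<open>g\<close> at \<open>p\<close> in the direction \<open>q\<close> is the larger one of
  \<open>q * fl p\<close> and \<open>q * fr p\<close>, for either sign of \<open>q\<close>.
\<close>

locale integrand =
  fixes g fl fr :: "real \<Rightarrow> real" and C :: real
  assumes C_nonneg: "0 \<le> C"
    and g_0: "g 0 = 0"
    and g_nonneg: "0 \<le> g p"
    and g_mono: "min 0 r \<le> p \<Longrightarrow> p \<le> max 0 r \<Longrightarrow> g p \<le> g r"
    and g_cont: "continuous_on UNIV g"
    and g_lip: "\<bar>g q - g p\<bar> \<le> C * (1 + \<bar>p\<bar> + \<bar>q\<bar>) * \<bar>q - p\<bar>"
    and fl_borel: "fl \<in> borel_measurable borel" and fr_borel: "fr \<in> borel_measurable borel"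
    and fl_le_fr: "fl p \<le> fr p"
    and f_bound: "\<bar>fl p\<bar> \<le> C * (1 + \<bar>p\<bar>)" "\<bar>fr p\<bar> \<le> C * (1 + \<bar>p\<bar>)"
    and subgradient: "fl p \<le> w \<Longrightarrow> w \<le> fr p \<Longrightarrow> g p + w * (q - p) \<le> g q"
    and directional: "(\<lambda>n. (g (p + q * inverse (real (Suc n))) - g p) * real (Suc n)) \<longlonglongrightarrow> max (q * fl p) (q * fr p)"

lemma integrand_smooth:
  assumes Ck: "Ck 2 F" and cvx: "convex_on UNIV F" and F0: "F 0 = 0" and pos: "\<And>r. 0 \<le> F r"
    and C: "0 < C" "\<And>r. \<bar>deriv F r\<bar> \<le> C * (1 + \<bar>r\<bar>)"
  shows "integrand F (deriv F) (deriv F) C"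
proof
  have "F field_differentiable at x" "deriv F field_differentiable at x" for x
    using Ck unfolding Ck_def by (auto dest: spec[of _ 0] spec[of _ 1])
  then have D: "(F has_real_derivative deriv F x) (at x)" and cd: "isCont (deriv F) x" for x
    using field_differentiable_derivI field_differentiable_imp_continuous_at by blast+
  show "0 \<le> C" "F 0 = 0" "\<And>p. 0 \<le> F p" using C F0 pos by auto
  show "continuous_on UNIV F"
    by (intro continuous_at_imp_continuous_on ballI DERIV_isCont[OF D])
  have "continuous_on UNIV (deriv F)" using cd by (intro continuous_at_imp_continuous_on ballI)
  then show "deriv F \<in> borel_measurable borel" by (rule borel_measurable_continuous_onI)
  show "F p \<le> F r" if "min 0 r \<le> p" "p \<le> max 0 r" for p r
  proof (cases "r = 0")
    case True
    then show ?thesis using that by simp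
  next
    case False
    define t where "t = p / r"
    have t: "0 \<le> t" "t \<le> 1" using that False
      by (auto simp: t_def zero_le_divide_iff divide_le_eq_1 min_def max_def split: if_splits)
    have p: "p = (1 - t) *\<^sub>R 0 + t *\<^sub>R r" using False by (simp add: t_def)
    have "F p \<le> (1 - t) * F 0 + t * F r"
      unfolding p by (rule convex_onD[OF cvx]) (use t in auto)
    also have "\<dots> \<le> F r" using F0 pos[of r] t by (simp add: mult_left_le_one_le)
    finally show ?thesis .
  qed
  have lip: "\<bar>F q - F p\<bar> \<le> C * (1 + \<bar>p\<bar> + \<bar>q\<bar>) * \<bar>q - p\<bar>" if pq: "p < q" for p q
  proof -
    obtain z where z: "p < z" "z < q" "F q - F p = (q - p) * deriv F z"
      using MVT2[OF pq D] by blast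
    have "C * (1 + \<bar>z\<bar>) \<le> C * (1 + \<bar>p\<bar> + \<bar>q\<bar>)" using z C by (intro mult_left_mono) auto
    then have "\<bar>deriv F z\<bar> \<le> C * (1 + \<bar>p\<bar> + \<bar>q\<bar>)" using C(2)[of z] by linarith
    then have "\<bar>deriv F z\<bar> * \<bar>q - p\<bar> \<le> C * (1 + \<bar>p\<bar> + \<bar>q\<bar>) * \<bar>q - p\<bar>" by (rule mult_right_mono) simp
    then show ?thesis unfolding z(3) abs_mult by (simp only: mult.commute)
  qed
  show "\<bar>F q - F p\<bar> \<le> C * (1 + \<bar>p\<bar> + \<bar>q\<bar>) * \<bar>q - p\<bar>" for p q
  proof (cases p q rule: linorder_cases)
    case less
    then show ?thesis by (rule lip)
  next
    case greater
    from lip[OF this] show ?thesis by (simp only: abs_minus_commute add.commute add.left_commute add.assoc)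
  qed simp
  show "deriv F p \<le> deriv F p" "\<bar>deriv F p\<bar> \<le> C * (1 + \<bar>p\<bar>)" for p
    using C by auto
  show "F p + w * (q - p) \<le> F q" if "deriv F p \<le> w" "w \<le> deriv F p" for p w q
  proof -
    have "F q - F p \<ge> deriv F p * (q - p)"
      by (rule convex_on_imp_above_tangent[OF cvx]) (use D in auto)
    then show ?thesis using that by auto
  qed
  show "(\<lambda>n. (F (p + q * inverse (real (Suc n))) - F p) * real (Suc n)) \<longlonglongrightarrow> max (q * deriv F p) (q * deriv F p)" for p q
  proof -
    have "((\<lambda>h. F (p + q * h)) has_real_derivative deriv F (p + q * 0) * q) (at 0)"
      by (rule DERIV_chain2[OF D]) (auto intro!: derivative_eq_intros)
    then have "((\<lambda>h. (F (p + q * h) - F p) / h) \<longlongrightarrow> deriv F p * q) (at 0)"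
      by (simp add: DERIV_def)
    moreover have "filterlim (\<lambda>n. inverse (real (Suc n))) (at 0) sequentially"
      by (simp add: filterlim_at LIMSEQ_inverse_real_of_nat del: of_nat_Suc)
    ultimately have "(\<lambda>n. (F (p + q * inverse (real (Suc n))) - F p) / inverse (real (Suc n))) \<longlonglongrightarrow> deriv F p * q"
      by (rule filterlim_compose)
    then show ?thesis by (simp add: divide_inverse mult.commute del: of_nat_Suc)
  qed
qed

lemma integrand_abs:
  "integrand abs (\<lambda>p. if 0 < p then 1 else -1) (\<lambda>p. if p < 0 then -1 else 1) 1"
proof
  show "\<bar>p\<bar> \<le> \<bar>r\<bar>" if "min 0 r \<le> p" "p \<le> max 0 r" for p r :: real using that by auto
  show "continuous_on UNIV (abs :: real \<Rightarrow> real)" by (intro continuous_intros)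
  show "\<bar>\<bar>q\<bar> - \<bar>p\<bar>\<bar> \<le> 1 * (1 + \<bar>p\<bar> + \<bar>q\<bar>) * \<bar>q - p\<bar>" for p q :: real
  proof -
    have "1 * \<bar>q - p\<bar> \<le> (1 + \<bar>p\<bar> + \<bar>q\<bar>) * \<bar>q - p\<bar>" by (rule mult_right_mono) auto
    then show ?thesis using abs_triangle_ineq3[of q p] by simp
  qed
  show "(\<lambda>p::real. if 0 < p then 1 else - 1 :: real) \<in> borel_measurable borel" by measurable
  show "(\<lambda>p::real. if p < 0 then - 1 else 1 :: real) \<in> borel_measurable borel" by measurable
  show "\<bar>p\<bar> + w * (q - p) \<le> \<bar>q\<bar>"
    if w: "(if 0 < p then 1 else - 1) \<le> w" "w \<le> (if p < 0 then - 1 else 1)" for p w q :: real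
  proof -
    have "\<bar>w\<bar> \<le> 1" "w * p = \<bar>p\<bar>" using w by (auto split: if_splits)
    moreover have "w * q \<le> \<bar>w\<bar> * \<bar>q\<bar>" by (metis abs_ge_self abs_mult)
    moreover have "\<bar>w\<bar> * \<bar>q\<bar> \<le> \<bar>q\<bar>" using calculation(1) by (simp add: mult_left_le_one_le)
    ultimately show ?thesis by (simp add: right_diff_distrib)
  qed
  show "(\<lambda>n. (\<bar>p + q * inverse (real (Suc n))\<bar> - \<bar>p\<bar>) * real (Suc n))
      \<longlonglongrightarrow> max (q * (if 0 < p then 1 else - 1)) (q * (if p < 0 then - 1 else 1))" for p q :: real
  proof -
    have t0: "(\<lambda>n. p + q * inverse (real (Suc n))) \<longlonglongrightarrow> p"
      using tendsto_add[OF tendsto_const tendsto_mult[OF tendsto_const LIMSEQ_inverse_real_of_nat], of p q] by simp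
    have "\<forall>\<^sub>F n in sequentially. (\<bar>p + q * inverse (real (Suc n))\<bar> - \<bar>p\<bar>) * real (Suc n)
        = max (q * (if 0 < p then 1 else - 1)) (q * (if p < 0 then - 1 else 1))"
    proof (cases p "0::real" rule: linorder_cases)
      case less
      from order_tendstoD(2)[OF t0 less] show ?thesis
        by eventually_elim (use less in \<open>simp add: algebra_simps del: of_nat_Suc\<close>)
    next
      case equal
      have "(\<bar>q * inverse (real (Suc n))\<bar> - 0) * real (Suc n) = \<bar>q\<bar>" for n
        by (simp add: abs_mult mult.assoc del: of_nat_Suc)
      then show ?thesis using equal by (simp add: max_def abs_if del: of_nat_Suc)
    next
      case greater
      from order_tendstoD(1)[OF t0 greater] show ?thesis
        by eventually_elim (use greater in \<open>simp add: algebra_simps del: of_nat_Suc\<close>)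
    qed
    then show ?thesis by (rule tendsto_eventually)
  qed
qed auto

lemma f_family_integrand:
  assumes f: "f_family f" and e: "\<epsilon> \<in> {0..1}"
  obtains fl fr C where "integrand (f \<epsilon>) fl fr C"
proof (cases "\<epsilon> = 0")
  case True
  have "f 0 = abs" using f by (auto simp: f_family_def)
  then show ?thesis using that integrand_abs True by simp
next
  case False
  with e have e': "\<epsilon> \<in> {0<..1}" by auto
  obtain C0 where "C0 > 0" "\<And>r. \<bar>deriv (f \<epsilon>) r\<bar> \<le> C0 * (1 + \<bar>r\<bar>)"
    using f e' unfolding f_family_def by blast
  moreover have "Ck 2 (f \<epsilon>)" "convex_on UNIV (f \<epsilon>)" "f \<epsilon> 0 = 0" "\<And>r. 0 \<le> f \<epsilon> r"
    using f e' unfolding f_family_def by blast+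
  ultimately show ?thesis using that integrand_smooth by blast
qed

text \<open>
  The two estimates of the linearisation error compare \<open>\<kappa> y - \<kappa> x = \<kappa>'(w) (y - x)\<close>, for some \<open>w\<close> between \<open>x\<close> and \<open>y\<close>, with
  \<open>\<kappa>'(x) (y - x)\<close>, using that \<open>\<kappa>'\<close> is increasing and Lipschitz continuous with \<open>\<kappa>'(0) = 0\<close>.
\<close>

lemma potential_props:
  assumes Ck: "Ck 2 \<kappa>" "Ck 1 (deriv \<kappa>)" and z: "\<And>y. y \<in> {-1..1} \<Longrightarrow> \<kappa> y = 0"
    and C: "0 < C" "\<And>y. 0 \<le> deriv (deriv \<kappa>) y \<and> deriv (deriv \<kappa>) y \<le> C"
  shows "continuous_on UNIV \<kappa>" "continuous_on UNIV (deriv \<kappa>)"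
    "\<And>x y. \<kappa> x + deriv \<kappa> x * (y - x) \<le> \<kappa> y"
    "\<And>x y. \<kappa> y - \<kappa> x - deriv \<kappa> x * (y - x) \<le> C * (y - x)\<^sup>2"
    "\<And>y. \<bar>deriv \<kappa> y\<bar> \<le> C * \<bar>y\<bar>"
proof -
  have "\<kappa> field_differentiable at x" "deriv \<kappa> field_differentiable at x" for x
    using Ck unfolding Ck_def by (auto dest: spec[of _ 0])
  then have D: "(\<kappa> has_real_derivative deriv \<kappa> x) (at x)"
    and D2: "(deriv \<kappa> has_real_derivative deriv (deriv \<kappa>) x) (at x)" for x
    using field_differentiable_derivI by blast+
  show "continuous_on UNIV \<kappa>" "continuous_on UNIV (deriv \<kappa>)"
    by (intro continuous_at_imp_continuous_on ballI DERIV_isCont[OF D] DERIV_isCont[OF D2])+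
  have K0: "deriv \<kappa> 0 = 0"
  proof (rule DERIV_unique[OF D])
    have "\<forall>\<^sub>F y in nhds 0. 0 = \<kappa> y"
      using eventually_nhds_in_open[of "{-1<..<1}" "0::real"] by (auto elim!: eventually_mono simp: z)
    moreover have "((\<lambda>y::real. 0::real) has_real_derivative 0) (at 0)" by simp
    ultimately show "(\<kappa> has_real_derivative 0) (at 0)"
      by (subst DERIV_cong_ev[OF refl _ refl, symmetric])
  qed
  have Kinc: "0 \<le> deriv \<kappa> y - deriv \<kappa> x \<and> deriv \<kappa> y - deriv \<kappa> x \<le> C * (y - x)" if "x \<le> y" for x y
  proof (cases "x = y")
    case False
    with that have "x < y" by simp
    then obtain w where "deriv \<kappa> y - deriv \<kappa> x = (y - x) * deriv (deriv \<kappa>) w"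
      using MVT2[OF _ D2] by blast
    moreover have "deriv (deriv \<kappa>) w * (y - x) \<le> C * (y - x)"
      by (rule mult_right_mono) (use C(2)[of w] that in auto)
    ultimately show ?thesis using C(2)[of w] that by (simp add: mult.commute)
  qed simp
  have both: "0 \<le> \<kappa> y - \<kappa> x - deriv \<kappa> x * (y - x) \<and> \<kappa> y - \<kappa> x - deriv \<kappa> x * (y - x) \<le> C * (y - x)\<^sup>2" for x y
  proof (cases x y rule: linorder_cases)
    case less
    then obtain w where w: "x < w" "w < y" "\<kappa> y - \<kappa> x = (y - x) * deriv \<kappa> w"
      using MVT2[OF less D] by blast
    have eq: "\<kappa> y - \<kappa> x - deriv \<kappa> x * (y - x) = (deriv \<kappa> w - deriv \<kappa> x) * (y - x)"
      unfolding w(3) by (simp add: algebra_simps)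
    have "deriv \<kappa> w - deriv \<kappa> x \<le> C * (w - x)" "0 \<le> deriv \<kappa> w - deriv \<kappa> x" using Kinc[of x w] w by auto
    moreover have "C * (w - x) \<le> C * (y - x)" using w C by (intro mult_left_mono) auto
    ultimately have "(deriv \<kappa> w - deriv \<kappa> x) * (y - x) \<le> (C * (y - x)) * (y - x)" "0 \<le> (deriv \<kappa> w - deriv \<kappa> x) * (y - x)"
      using less by (intro mult_right_mono mult_nonneg_nonneg; simp)+
    then show ?thesis unfolding eq by (simp add: power2_eq_square mult.assoc)
  next
    case greater
    then obtain w where w: "y < w" "w < x" "\<kappa> x - \<kappa> y = (x - y) * deriv \<kappa> w"
      using MVT2[OF greater D] by blast
    have eq: "\<kappa> y - \<kappa> x - deriv \<kappa> x * (y - x) = (deriv \<kappa> x - deriv \<kappa> w) * (x - y)"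
      using w(3) by (simp add: algebra_simps)
    have "deriv \<kappa> x - deriv \<kappa> w \<le> C * (x - w)" "0 \<le> deriv \<kappa> x - deriv \<kappa> w" using Kinc[of w x] w by auto
    moreover have "C * (x - w) \<le> C * (x - y)" using w C by (intro mult_left_mono) auto
    ultimately have "(deriv \<kappa> x - deriv \<kappa> w) * (x - y) \<le> (C * (x - y)) * (x - y)" "0 \<le> (deriv \<kappa> x - deriv \<kappa> w) * (x - y)"
      using greater by (intro mult_right_mono mult_nonneg_nonneg; simp)+
    then show ?thesis unfolding eq by (simp add: power2_eq_square mult.assoc algebra_simps)
  qed simp
  then show "\<kappa> x + deriv \<kappa> x * (y - x) \<le> \<kappa> y" "\<kappa> y - \<kappa> x - deriv \<kappa> x * (y - x) \<le> C * (y - x)\<^sup>2" for x y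
    by (auto simp: algebra_simps)
  show "\<bar>deriv \<kappa> y\<bar> \<le> C * \<bar>y\<bar>" for y
    using Kinc[of 0 y] Kinc[of y 0] K0 by (cases "0 \<le> y") auto
qed

context integrand
begin

lemma g_borel: "g \<in> borel_measurable borel"
  using g_cont by (rule borel_measurable_continuous_onI)

lemma g_integrable:
  assumes v: "v \<in> L2 L"
  shows "integrable (leb L) (\<lambda>x. g (v x))"
proof (rule Bochner_Integration.integrable_bound)
  show "integrable (leb L) (\<lambda>x. C * (\<bar>v x\<bar> + (v x)\<^sup>2))"
    using v L2_integrable[OF v] by (intro integrable_mult_right Bochner_Integration.integrable_add integrable_abs) (auto simp: L2_def)
  show "(\<lambda>x. g (v x)) \<in> borel_measurable (leb L)"
    by (rule measurable_compose[OF L2_measurable[OF v] g_borel])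
  have "norm (g (v x)) \<le> norm (C * (\<bar>v x\<bar> + (v x)\<^sup>2))" for x
    using g_lip[of "v x" 0] g_0 C_nonneg by (simp add: abs_mult distrib_right power2_eq_square mult.assoc)
  then show "AE x in leb L. norm (g (v x)) \<le> norm (C * (\<bar>v x\<bar> + (v x)\<^sup>2))" by simp
qed

lemma energy_integrable:
  assumes v: "v \<in> L2 L"
  shows "integrable (leb L) (\<lambda>x. g (v x) + \<nu>\<^sup>2 / 2 * (v x)\<^sup>2)"
  using v by (intro Bochner_Integration.integrable_add g_integrable integrable_mult_right) (auto simp: L2_def)

lemma slope_L2:
  assumes v: "v \<in> L2 L" and h: "h \<in> borel_measurable borel" "\<And>p. \<bar>h p\<bar> \<le> C * (1 + \<bar>p\<bar>)"
  shows "(\<lambda>x. h (v x) + \<nu>\<^sup>2 * v x) \<in> L2 L"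
proof (rule L2_add[OF _ L2_cmult[OF v]])
  show "(\<lambda>x. h (v x)) \<in> L2 L"
  proof (rule L2_dominated[OF L2_cmult[OF L2_add[OF L2_const[of 1] L2_abs[OF v]], of C]])
    show "(\<lambda>x. h (v x)) \<in> borel_measurable (leb L)"
      by (rule measurable_compose[OF L2_measurable[OF v] h(1)])
    have "\<bar>h (v x)\<bar> \<le> \<bar>C * (1 + \<bar>v x\<bar>)\<bar>" for x using h(2)[of "v x"] by linarith
    then show "AE x in leb L. \<bar>h (v x)\<bar> \<le> \<bar>C * (1 + \<bar>v x\<bar>)\<bar>" by simp
  qed
qed

text \<open>
  The part of the first variation that concerns the energy, for perturbations \<open>v + q / (n + 1)\<close> of the derivative.
  The sequence \<open>B\<close> stands for the difference quotients of the remaining terms, whose limit \<open>D\<close> may be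
  replaced by an upper bound \<open>E\<close>.
\<close>

lemma first_variation:
  fixes B :: "nat \<Rightarrow> real \<Rightarrow> real" and v q :: "real \<Rightarrow> real" and \<nu> :: real
  defines "G \<equiv> \<lambda>p. g p + \<nu>\<^sup>2 / 2 * p\<^sup>2"
  assumes v: "v \<in> L2 L" and qm: "q \<in> borel_measurable (leb L)" and qb: "\<And>x. \<bar>q x\<bar> \<le> Q"
    and Bm: "\<And>n. B n \<in> borel_measurable (leb L)" and W: "integrable (leb L) W"
    and BW: "\<And>n. AE x in leb L. \<bar>B n x\<bar> \<le> W x"
    and Dm: "D \<in> borel_measurable (leb L)"
    and BD: "AE x in leb L. (\<lambda>n. B n x) \<longlonglongrightarrow> D x"
    and DE: "AE x in leb L. D x \<le> E x" and E: "integrable (leb L) E"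
    and nonneg: "\<And>n. 0 \<le> (LINT x|leb L. (G (v x + q x * inverse (real (Suc n))) - G (v x)) * real (Suc n))
        + (LINT x|leb L. B n x)"
  shows "0 \<le> (LINT x|leb L. max (q x * (fl (v x) + \<nu>\<^sup>2 * v x)) (q x * (fr (v x) + \<nu>\<^sup>2 * v x)))
      + (LINT x|leb L. E x)"
proof -
  let ?M = "leb L"
  let ?A = "\<lambda>n x. (G (v x + q x * inverse (real (Suc n))) - G (v x)) * real (Suc n)"
  let ?A' = "\<lambda>x. max (q x * (fl (v x) + \<nu>\<^sup>2 * v x)) (q x * (fr (v x) + \<nu>\<^sup>2 * v x))"
  have vm: "v \<in> borel_measurable ?M" using L2_measurable[OF v] .
  have Q: "0 \<le> Q" using qb[of 0] by linarith
  have Gb: "G \<in> borel_measurable borel" unfolding G_def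
    by (intro borel_measurable_add g_borel borel_measurable_times borel_measurable_power) auto
  have limA: "(\<lambda>n. LINT x|?M. ?A n x) \<longlonglongrightarrow> (LINT x|?M. ?A' x)"
  proof (rule integral_dominated_convergence)
    show "?A' \<in> borel_measurable ?M"
      by (intro borel_measurable_max borel_measurable_times borel_measurable_add qm vm borel_measurable_const
          measurable_compose[OF vm fl_borel] measurable_compose[OF vm fr_borel])
    show "?A n \<in> borel_measurable ?M" for n
    proof -
      have "(\<lambda>x. v x + q x * inverse (real (Suc n))) \<in> borel_measurable ?M"
        by (intro borel_measurable_add borel_measurable_times vm qm borel_measurable_const)
      then show ?thesis
        by (intro borel_measurable_times borel_measurable_diff borel_measurable_const
            measurable_compose[OF _ Gb] vm)
    qed
    let ?w = "\<lambda>x. (C * (1 + Q) * Q + \<nu>\<^sup>2 / 2 * Q * Q) + (2 * C * Q + \<nu>\<^sup>2 * Q) * \<bar>v x\<bar>"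
    show "integrable ?M ?w"
      by (intro Bochner_Integration.integrable_add integrable_const_Om integrable_mult_right integrable_abs L2_integrable v)
    have split: "?A n x = (g (v x + q x * inverse (real (Suc n))) - g (v x)) * real (Suc n)
        + (\<nu>\<^sup>2 * (v x * q x) + \<nu>\<^sup>2 / 2 * (q x)\<^sup>2 * inverse (real (Suc n)))" for n x
    proof -
      define t where "t = inverse (real (Suc n))"
      have t: "t * real (Suc n) = 1" by (simp_all add: t_def del: of_nat_Suc)
      have "((v x + q x * t)\<^sup>2 - (v x)\<^sup>2) * real (Suc n) = (2 * (v x * q x) + (q x)\<^sup>2 * t) * (t * real (Suc n))"
        by (simp add: power2_eq_square algebra_simps)
      then have "((v x + q x * t)\<^sup>2 - (v x)\<^sup>2) * real (Suc n) = 2 * (v x * q x) + (q x)\<^sup>2 * t" using t by simp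
      then have "\<nu>\<^sup>2 / 2 * (((v x + q x * t)\<^sup>2 - (v x)\<^sup>2) * real (Suc n)) = \<nu>\<^sup>2 * (v x * q x) + \<nu>\<^sup>2 / 2 * (q x)\<^sup>2 * t"
        by (simp add: algebra_simps)
      then show ?thesis unfolding G_def t_def[symmetric] by (simp add: algebra_simps del: of_nat_Suc)
    qed
    show "AE x in ?M. (\<lambda>n. ?A n x) \<longlonglongrightarrow> ?A' x"
    proof (intro AE_I2)
      fix x
      have "(\<lambda>n. ?A n x) \<longlonglongrightarrow> max (q x * fl (v x)) (q x * fr (v x)) + (\<nu>\<^sup>2 * (v x * q x) + \<nu>\<^sup>2 / 2 * (q x)\<^sup>2 * 0)"
        unfolding split by (intro tendsto_intros directional LIMSEQ_inverse_real_of_nat)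
      also have "max (q x * fl (v x)) (q x * fr (v x)) + (\<nu>\<^sup>2 * (v x * q x) + \<nu>\<^sup>2 / 2 * (q x)\<^sup>2 * 0) = ?A' x"
        by (simp add: max_def algebra_simps)
      finally show "(\<lambda>n. ?A n x) \<longlonglongrightarrow> ?A' x" .
    qed
    fix n
    show "AE x in ?M. norm (?A n x) \<le> ?w x"
    proof (intro AE_I2)
      fix x
      define t where "t = inverse (real (Suc n))"
      have t: "0 < t" "t \<le> 1" "t * real (Suc n) = 1" by (simp_all add: t_def inverse_le_1_iff del: of_nat_Suc)
      have qt: "\<bar>q x * t\<bar> \<le> Q"
        using mult_mono[of "\<bar>q x\<bar>" Q t 1] qb[of x] t Q by (simp add: abs_mult)
      have "\<bar>g (v x + q x * t) - g (v x)\<bar> \<le> C * (1 + \<bar>v x\<bar> + \<bar>v x + q x * t\<bar>) * \<bar>q x * t\<bar>"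
        using g_lip[of "v x + q x * t" "v x"] by simp
      also have "\<dots> \<le> C * (1 + 2 * \<bar>v x\<bar> + Q) * (Q * t)"
      proof (rule mult_mono)
        have "\<bar>v x + q x * t\<bar> \<le> \<bar>v x\<bar> + Q" using qt by linarith
        then show "C * (1 + \<bar>v x\<bar> + \<bar>v x + q x * t\<bar>) \<le> C * (1 + 2 * \<bar>v x\<bar> + Q)"
          by (intro mult_left_mono C_nonneg) simp
        show "\<bar>q x * t\<bar> \<le> Q * t" using qb[of x] t by (simp add: abs_mult mult_right_mono del: of_nat_Suc)
      qed (use Q C_nonneg in auto)
      finally have "\<bar>g (v x + q x * t) - g (v x)\<bar> * real (Suc n) \<le> C * (1 + 2 * \<bar>v x\<bar> + Q) * (Q * t) * real (Suc n)"
        by (rule mult_right_mono) simp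
      also have "\<dots> = C * (1 + 2 * \<bar>v x\<bar> + Q) * Q" using t(3) by (simp add: mult.assoc del: of_nat_Suc)
      finally have 1: "\<bar>(g (v x + q x * t) - g (v x)) * real (Suc n)\<bar> \<le> C * (1 + 2 * \<bar>v x\<bar> + Q) * Q"
        by (simp add: abs_mult del: of_nat_Suc)
      have "\<bar>v x * q x\<bar> \<le> \<bar>v x\<bar> * Q" using qb[of x] by (simp add: abs_mult mult_left_mono)
      then have 2: "\<bar>\<nu>\<^sup>2 * (v x * q x)\<bar> \<le> \<nu>\<^sup>2 * (\<bar>v x\<bar> * Q)"
        unfolding abs_mult[of "\<nu>\<^sup>2"] by (intro mult_mono) auto
      have "(q x)\<^sup>2 \<le> Q * Q" using qb[of x] Q by (metis abs_ge_zero mult_mono power2_abs power2_eq_square)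
      then have "(q x)\<^sup>2 * t \<le> Q * Q * 1" using t Q by (intro mult_mono) auto
      then have "\<nu>\<^sup>2 / 2 * ((q x)\<^sup>2 * t) \<le> \<nu>\<^sup>2 / 2 * (Q * Q)" by (intro mult_left_mono) auto
      moreover have "0 \<le> \<nu>\<^sup>2 / 2 * ((q x)\<^sup>2 * t)" using t by simp
      ultimately have 3: "\<bar>\<nu>\<^sup>2 / 2 * (q x)\<^sup>2 * t\<bar> \<le> \<nu>\<^sup>2 / 2 * Q * Q" by (simp add: mult.assoc)
      have "norm (?A n x) \<le> C * (1 + 2 * \<bar>v x\<bar> + Q) * Q + \<nu>\<^sup>2 * (\<bar>v x\<bar> * Q) + \<nu>\<^sup>2 / 2 * Q * Q"
        using 1 2 3 split[of x n, folded t_def] unfolding real_norm_def t_def[symmetric] by linarith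
      also have "\<dots> = ?w x" by (simp add: algebra_simps)
      finally show "norm (?A n x) \<le> ?w x" .
    qed
  qed
  have limB: "(\<lambda>n. LINT x|?M. B n x) \<longlonglongrightarrow> (LINT x|?M. D x)"
    by (rule integral_dominated_convergence[OF Dm Bm W BD]) (use BW in simp)
  have Di: "integrable ?M D"
    by (rule integrable_dominated_convergence[OF Dm Bm W BD]) (use BW in simp)
  have "0 \<le> (LINT x|?M. ?A' x) + (LINT x|?M. D x)"
    by (rule tendsto_lowerbound[OF tendsto_add[OF limA limB]]) (use nonneg in auto)
  also have "\<dots> \<le> (LINT x|?M. ?A' x) + (LINT x|?M. E x)"
    using integral_mono_AE[OF Di E DE] by simp
  finally show ?thesis .
qed

end

section \<open>The functional and the sufficiency of the conditions\<close>

locale problem =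
  fixes L \<nu> \<epsilon> \<delta> :: real and f Khat K :: "real \<Rightarrow> real \<Rightarrow> real"
  assumes L: "0 < L" and \<nu>: "0 < \<nu>" and f: "f_family f" and K: "K_family Khat K"
    and \<epsilon>: "\<epsilon> \<in> {0..1}" and \<delta>: "\<delta> \<in> {0..1}"
begin

abbreviation "M \<equiv> leb L"

abbreviation "\<Psi> \<equiv> Psi L \<nu> f Khat \<epsilon> \<delta>"

text \<open>
  For \<open>\<delta> = 0\<close> the indicator function of \<open>[-1, 1]\<close> is split into the finite potential \<open>0\<close> and the
  constraint \<open>admissible\<close>, so that all functionals below are real-valued.
\<close>

definition pot :: "real \<Rightarrow> real" where
  "pot y = (if \<delta> = 0 then 0 else Khat \<delta> y)"

definition admissible :: "(real \<Rightarrow> real) \<Rightarrow> bool" where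
  "admissible w \<longleftrightarrow> (\<delta> = 0 \<longrightarrow> (AE x in M. w x \<in> {-1..1}))"

definition energy :: "(real \<Rightarrow> real) \<Rightarrow> real" where
  "energy r = (LINT x|M. f \<epsilon> (r x) + \<nu>\<^sup>2 / 2 * (r x)\<^sup>2)"

definition potential :: "(real \<Rightarrow> real) \<Rightarrow> real" where
  "potential w = (LINT x|M. pot (w x))"

lemma pot_smooth:
  assumes "\<delta> \<noteq> 0"
  obtains C where "0 < C" "continuous_on UNIV pot" "continuous_on UNIV (K \<delta>)"
    "\<And>x y. pot x + K \<delta> x * (y - x) \<le> pot y"
    "\<And>x y. pot y - pot x - K \<delta> x * (y - x) \<le> C * (y - x)\<^sup>2"
    "\<And>y. \<bar>K \<delta> y\<bar> \<le> C * \<bar>y\<bar>"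
proof -
  from assms \<delta> have d: "\<delta> \<in> {0<..1}" by auto
  have p: "pot = Khat \<delta>" using assms by (auto simp: pot_def)
  have k: "Ck 2 (Khat \<delta>)" "Ck 1 (K \<delta>)" "K \<delta> = deriv (Khat \<delta>)" "\<And>z. z \<in> {-1..1} \<Longrightarrow> Khat \<delta> z = 0"
    "\<exists>C>0. \<forall>z. 0 \<le> deriv (K \<delta>) z \<and> deriv (K \<delta>) z \<le> C"
    using K d unfolding K_family_def by blast+
  then obtain C where C: "0 < C" "\<And>z. 0 \<le> deriv (K \<delta>) z \<and> deriv (K \<delta>) z \<le> C" by blast
  note pp = potential_props[OF k(1) k(2)[unfolded k(3)] k(4) C(1) C(2)[unfolded k(3)]]
  show ?thesis
    by (rule that[OF C(1)]) (simp_all only: p k(3) pp)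
qed

lemma pot_obstacle: "\<delta> = 0 \<Longrightarrow> pot y = 0"
  unfolding pot_def by simp

lemma admissible_obstacle: "admissible w \<Longrightarrow> \<delta> = 0 \<Longrightarrow> AE x in M. w x \<in> {-1..1}"
  unfolding admissible_def by blast

lemma pot_0: "pot 0 = 0"
proof (cases "\<delta> = 0")
  case False
  with \<delta> have "\<delta> \<in> {0<..1}" by auto
  then have "\<forall>z\<in>{-1..1}. Khat \<delta> z = 0" using K unfolding K_family_def by blast
  then show ?thesis by (simp add: pot_def)
qed (rule pot_obstacle)

lemma pot_bounds:
  obtains C where "\<And>y. 0 \<le> pot y \<and> pot y \<le> C * y\<^sup>2" "continuous_on UNIV pot"
proof (cases "\<delta> = 0")
  case True
  then have "pot = (\<lambda>y. 0)" using pot_obstacle by blast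
  then show ?thesis by (intro that[of 0]) auto
next
  case False
  from pot_smooth[OF this] obtain C where C: "continuous_on UNIV pot"
    "\<And>x y. pot x + K \<delta> x * (y - x) \<le> pot y"
    "\<And>x y. pot y - pot x - K \<delta> x * (y - x) \<le> C * (y - x)\<^sup>2"
    "\<And>y. \<bar>K \<delta> y\<bar> \<le> C * \<bar>y\<bar>" by metis
  have K0: "K \<delta> 0 = 0" using C(4)[of 0] by simp
  show ?thesis
    by (rule that[of C]) (use C(1) C(2)[of 0] C(3)[of _ 0] K0 pot_0 in auto)
qed

lemma pot_nonneg: "0 \<le> pot y"
  using pot_bounds by metis

lemma pot_borel: "pot \<in> borel_measurable borel"
  using pot_bounds borel_measurable_continuous_onI by metis

lemma pot_integrable:
  assumes w: "w \<in> L2 L"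
  shows "integrable M (\<lambda>x. pot (w x))"
proof -
  obtain C where C: "\<And>y. 0 \<le> pot y \<and> pot y \<le> C * y\<^sup>2" using pot_bounds by metis
  show ?thesis
  proof (rule Bochner_Integration.integrable_bound)
    show "integrable M (\<lambda>x. C * (w x)\<^sup>2)" using w by (intro integrable_mult_right) (simp add: L2_def)
    show "(\<lambda>x. pot (w x)) \<in> borel_measurable M"
      by (rule measurable_compose[OF L2_measurable[OF w] pot_borel])
    have "norm (pot (w x)) \<le> norm (C * (w x)\<^sup>2)" for x using C[of "w x"] by auto
    then show "AE x in M. norm (pot (w x)) \<le> norm (C * (w x)\<^sup>2)" by simp
  qed
qed

lemma Psi_eq:
  assumes w: "w \<in> H1 L" and a: "admissible w" and r: "r \<in> L2 L" and wr: "has_weak_deriv L w r"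
  shows "\<Psi> w = ereal (energy r + potential w)"
proof -
  obtain fl fr C where I: "integrand (f \<epsilon>) fl fr C" using f_family_integrand[OF f \<epsilon>] .
  interpret integrand "f \<epsilon>" fl fr C by (rule I)
  have wL: "w \<in> L2 L" using w by (simp add: H1_def)
  note wd = weak_deriv_AE[OF wr]
  have i2: "integrable M (\<lambda>x. (r x)\<^sup>2)" using r by (simp add: L2_def)
  have 1: "(\<integral>\<^sup>+x. ennreal (f \<epsilon> (weak_deriv L w x)) \<partial>M) = ennreal (LINT x|M. f \<epsilon> (r x))"
  proof -
    have "(\<integral>\<^sup>+x. ennreal (f \<epsilon> (weak_deriv L w x)) \<partial>M) = (\<integral>\<^sup>+x. ennreal (f \<epsilon> (r x)) \<partial>M)"
      by (rule nn_integral_cong_AE) (use wd(2) in eventually_elim, simp)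
    then show ?thesis by (simp add: nn_integral_eq_integral g_integrable[OF r] g_nonneg)
  qed
  have 2: "(\<integral>\<^sup>+x. ennreal ((weak_deriv L w x)\<^sup>2) \<partial>M) = ennreal (LINT x|M. (r x)\<^sup>2)"
  proof -
    have "(\<integral>\<^sup>+x. ennreal ((weak_deriv L w x)\<^sup>2) \<partial>M) = (\<integral>\<^sup>+x. ennreal ((r x)\<^sup>2) \<partial>M)"
      by (rule nn_integral_cong_AE) (use wd(2) in eventually_elim, simp)
    then show ?thesis by (simp add: nn_integral_eq_integral i2)
  qed
  have 3: "(\<integral>\<^sup>+x. e2ennreal (Khat_ext Khat \<delta> (w x)) \<partial>M) = ennreal (potential w)"
  proof -
    have "AE x in M. e2ennreal (Khat_ext Khat \<delta> (w x)) = ennreal (pot (w x))"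
    proof (cases "\<delta> = 0")
      case True
      have e0: "e2ennreal 0 = 0" by (metis e2ennreal_ereal ennreal_0 zero_ereal_def)
      from admissible_obstacle[OF a True] show ?thesis
        by eventually_elim (simp only: pot_obstacle[OF True], simp add: Khat_ext_def True e0)
    next
      case False
      then show ?thesis by (simp add: Khat_ext_def pot_def)
    qed
    then have "(\<integral>\<^sup>+x. e2ennreal (Khat_ext Khat \<delta> (w x)) \<partial>M) = (\<integral>\<^sup>+x. ennreal (pot (w x)) \<partial>M)"
      by (rule nn_integral_cong_AE)
    then show ?thesis by (simp add: nn_integral_eq_integral pot_integrable[OF wL] pot_nonneg potential_def)
  qed
  have n1: "0 \<le> (LINT x|M. f \<epsilon> (r x))" by (simp add: g_nonneg)
  have n2: "0 \<le> (LINT x|M. (r x)\<^sup>2)" by simp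
  have n3: "0 \<le> potential w" by (simp add: potential_def pot_nonneg)
  have "\<Psi> w = enn2ereal (ennreal (LINT x|M. f \<epsilon> (r x)) + ennreal (\<nu>\<^sup>2 / 2) * ennreal (LINT x|M. (r x)\<^sup>2) + ennreal (potential w))"
    unfolding Psi_def 1 2 3 using w by simp
  also have "\<dots> = enn2ereal (ennreal ((LINT x|M. f \<epsilon> (r x)) + \<nu>\<^sup>2 / 2 * (LINT x|M. (r x)\<^sup>2) + potential w))"
  proof -
    have m: "ennreal (\<nu>\<^sup>2 / 2) * ennreal (LINT x|M. (r x)\<^sup>2) = ennreal (\<nu>\<^sup>2 / 2 * (LINT x|M. (r x)\<^sup>2))"
      by (rule ennreal_mult[symmetric]) (use n2 in auto)
    have "0 \<le> \<nu>\<^sup>2 / 2 * (LINT x|M. (r x)\<^sup>2)" using n2 by simp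
    then show ?thesis unfolding m using n1 n3 by (simp only: ennreal_plus add_nonneg_nonneg)
  qed
  also have "\<dots> = ereal ((LINT x|M. f \<epsilon> (r x)) + \<nu>\<^sup>2 / 2 * (LINT x|M. (r x)\<^sup>2) + potential w)"
    using n1 n2 n3 by (intro enn2ereal_ennreal add_nonneg_nonneg mult_nonneg_nonneg) auto
  also have "(LINT x|M. f \<epsilon> (r x)) + \<nu>\<^sup>2 / 2 * (LINT x|M. (r x)\<^sup>2) = energy r"
    unfolding energy_def using g_integrable[OF r] i2 by simp
  finally show ?thesis .
qed

lemma Psi_finite:
  assumes w: "w \<in> L2 L" and fin: "\<Psi> w < \<infinity>"
  shows "w \<in> H1 L" "admissible w"
proof -
  show H: "w \<in> H1 L" using fin by (auto simp: Psi_def split: if_splits)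
  show "admissible w" unfolding admissible_def
  proof
    assume d: "\<delta> = 0"
    have e0: "e2ennreal 0 = 0" by (metis e2ennreal_ereal ennreal_0 zero_ereal_def)
    have eq: "e2ennreal (Khat_ext Khat \<delta> (w x)) = (if w x \<in> {-1..1} then 0 else \<infinity>)" for x
      using e0 by (simp add: Khat_ext_def d)
    have "(\<integral>\<^sup>+x. e2ennreal (Khat_ext Khat \<delta> (w x)) \<partial>M) \<noteq> \<infinity>"
    proof
      assume inf: "(\<integral>\<^sup>+x. e2ennreal (Khat_ext Khat \<delta> (w x)) \<partial>M) = \<infinity>"
      have "\<Psi> w = enn2ereal \<infinity>" unfolding Psi_def inf using H by simp
      then show False using fin by simp
    qed
    then have fin': "(\<integral>\<^sup>+x. (if w x \<in> {-1..1} then 0 else \<infinity>) \<partial>M) \<noteq> \<infinity>" unfolding eq .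
    have m: "(\<lambda>x. if w x \<in> {-1..1} then 0 else \<infinity> :: ennreal) \<in> borel_measurable M"
    proof -
      have "(\<lambda>y::real. if y \<in> {-1..1} then 0 else \<infinity> :: ennreal) \<in> borel_measurable borel" by measurable
      from measurable_compose[OF L2_measurable[OF w] this] show ?thesis .
    qed
    from nn_integral_PInf_AE[OF m fin'] show "AE x in M. w x \<in> {-1..1}"
      by eventually_elim (simp split: if_splits)
  qed
qed

lemma AE_Om_ex:
  assumes "AE x in M. P x"
  shows "\<exists>x\<in>Om L. P x"
proof (rule ccontr)
  assume n: "\<not> ?thesis"
  have "AE x in lebesgue. x \<in> Om L \<longrightarrow> P x" using assms by (subst (asm) AE_restrict_space_iff) auto
  then have "AE x in lebesgue. x \<notin> Om L" by eventually_elim (use n in blast)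
  then have "Om L \<in> null_sets lebesgue" by (subst AE_iff_null_sets) auto
  then have "emeasure lebesgue (Om L) = 0" by blast
  then show False using L by (simp add: emeasure_lborel_Ioo)
qed

lemma K_set_ineq:
  assumes "\<xi> \<in> K_set Khat K \<delta> y" and "\<delta> = 0 \<longrightarrow> w \<in> {-1..1}"
  shows "pot y + \<xi> * (w - y) \<le> pot w"
proof (cases "\<delta> = 0")
  case True
  with assms have s: "(y, \<xi>) \<in> subdifferential_real (Khat_ext Khat 0)" and w: "w \<in> {-1..1}" by (auto simp: K_set_def)
  have "Khat_ext Khat 0 y + ereal (\<xi> * (w - y)) \<le> Khat_ext Khat 0 w"
    using s unfolding subdifferential_def by simp
  then have "\<xi> * (w - y) \<le> 0" using w by (simp add: Khat_ext_def split: if_splits)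
  then show ?thesis by (simp only: pot_obstacle[OF True])
next
  case False
  then have "\<xi> = K \<delta> y" using assms by (simp add: K_set_def)
  then show ?thesis using pot_smooth[OF False] by metis
qed

lemma K_set_range:
  assumes "\<xi> \<in> K_set Khat K \<delta> y" "\<delta> = 0"
  shows "y \<in> {-1..1}"
  using assms by (auto simp: K_set_def subdifferential_def Khat_ext_def split: if_splits)

text \<open>
  With \<open>\<sigma> = \<omega> + \<nu>\<^sup>2 z'\<close> and \<open>\<eta> = \<sigma>'\<close> the equation reads \<open>z\<^sup>* = \<xi> - \<eta>\<close>. The subgradient inequalities
  produce \<open>\<integral> \<sigma> (w - z)' + \<integral> \<xi> (w - z)\<close>, and integration by parts identifies this with
  \<open>\<integral> z\<^sup>* (w - z)\<close>, the boundary terms being zero because \<open>\<sigma>(\<plusminus>L) = 0\<close>.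
\<close>

lemma sufficiency:
  assumes z: "z \<in> L2 L" and zs: "zs \<in> L2 L"
    and \<omega>: "\<omega> \<in> H1 L \<inter> Linf L" and \<xi>: "\<xi> \<in> L2 L" and H2: "z \<in> H2 L"
    and bc: "cont_rep L (\<lambda>x. \<omega> x + \<nu>\<^sup>2 * weak_deriv L z x) L = 0"
      "cont_rep L (\<lambda>x. \<omega> x + \<nu>\<^sup>2 * weak_deriv L z x) (-L) = 0"
    and eq: "AE x in M. zs x = - weak_deriv L \<omega> x - \<nu>\<^sup>2 * weak_deriv L (weak_deriv L z) x + \<xi> x"
    and sub: "AE x in M. (weak_deriv L z x, \<omega> x) \<in> subdifferential_real (\<lambda>r. ereal (f \<epsilon> r))"
    and Ks: "AE x in M. \<xi> x \<in> K_set Khat K \<delta> (z x)"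
  shows "(z, zs) \<in> subdifferential (L2 L) (L2_inner L) \<Psi>"
proof -
  obtain fl fr C where I: "integrand (f \<epsilon>) fl fr C" using f_family_integrand[OF f \<epsilon>] .
  interpret integrand "f \<epsilon>" fl fr C by (rule I)
  obtain v where v: "v \<in> H1 L" "has_weak_deriv L z v" using H2 by (auto simp: H2_def)
  have vL: "v \<in> L2 L" using v(1) by (simp add: H1_def)
  have zH: "z \<in> H1 L" using z v(2) vL by (auto simp: H1_def)
  obtain c0 where c0: "AE x in M. z x = c0 + prim L v x"
    using has_weak_deriv_imp_prim[OF L L2_integrable[OF z] L2_integrable[OF vL] v(2)] by auto
  note wz = weak_deriv_AE[OF v(2)]
  obtain v' c1 where v': "v' \<in> L2 L" "AE x in M. v x = c1 + prim L v' x"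
    using H1_obtain[OF L v(1)] by metis
  have \<omega>H: "\<omega> \<in> H1 L" using \<omega> by simp
  obtain \<omega>' c2 where \<omega>': "\<omega>' \<in> L2 L" "AE x in M. \<omega> x = c2 + prim L \<omega>' x" "AE x in M. weak_deriv L \<omega> x = \<omega>' x"
    using H1_obtain[OF L \<omega>H] by metis
  have \<omega>L: "\<omega> \<in> L2 L" using \<omega>H by (simp add: H1_def)
  define \<eta> where "\<eta> x = \<omega>' x + \<nu>\<^sup>2 * v' x" for x
  have \<eta>L: "\<eta> \<in> L2 L" unfolding \<eta>_def by (intro L2_add L2_cmult \<omega>' v')
  note \<eta>i = L2_integrable[OF \<eta>L]
  define \<sigma> where "\<sigma> x = (c2 + \<nu>\<^sup>2 * c1) + prim L \<eta> x" for x
  have prim\<eta>: "prim L \<eta> x = prim L \<omega>' x + \<nu>\<^sup>2 * prim L v' x" for x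
    unfolding \<eta>_def
    by (subst prim_add) (auto intro!: integrable_mult_right L2_integrable \<omega>' v' simp: prim_cmult)
  have \<sigma>ae: "AE x in M. \<sigma> x = \<omega> x + \<nu>\<^sup>2 * weak_deriv L z x"
    using \<omega>'(2) v'(2) wz(2) by eventually_elim (simp add: \<sigma>_def prim\<eta> distrib_left)
  have \<sigma>c: "continuous_on {-L..L} \<sigma>"
    unfolding \<sigma>_def by (intro continuous_intros continuous_on_subset[OF prim_continuous[OF \<eta>i]]) auto
  have "\<sigma> L = 0" "\<sigma> (-L) = 0"
    using cont_rep_eq[OF L \<sigma>c \<sigma>ae, of L] cont_rep_eq[OF L \<sigma>c \<sigma>ae, of "-L"] bc L by auto
  then have c12: "c2 + \<nu>\<^sup>2 * c1 = 0" and \<eta>L0: "prim L \<eta> L = 0"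
    by (simp_all add: \<sigma>_def prim_left)
  have \<sigma>p: "\<sigma> x = prim L \<eta> x" for x by (simp add: \<sigma>_def c12)
  have wd2: "has_weak_deriv L (weak_deriv L z) v'"
  proof (rule has_weak_deriv_prim[OF L L2_integrable[OF v'(1)] wz(3)])
    show "AE x in M. weak_deriv L z x = c1 + prim L v' x"
      using wz(2) v'(2) by eventually_elim simp
  qed
  have zs\<xi>: "AE x in M. zs x = \<xi> x - \<eta> x"
    using eq \<omega>'(3) weak_deriv_AE(2)[OF wd2] by eventually_elim (simp add: \<eta>_def)
  have admz: "admissible z" unfolding admissible_def
  proof
    assume d: "\<delta> = 0"
    show "AE x in M. z x \<in> {-1..1}" using Ks by eventually_elim (rule K_set_range[OF _ d])
  qed
  note Pz = Psi_eq[OF zH admz vL v(2)]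
  have "\<Psi> z + ereal (L2_inner L zs (\<lambda>x. w x - z x)) \<le> \<Psi> w" if w: "w \<in> L2 L" for w
  proof (cases "\<Psi> w < \<infinity>")
    case False
    then show ?thesis by simp
  next
    case True
    note fin = Psi_finite[OF w True]
    obtain r cw where r: "r \<in> L2 L" "has_weak_deriv L w r" "AE x in M. w x = cw + prim L r x"
      using H1_obtain[OF L fin(1)] by metis
    note Pw = Psi_eq[OF fin(1,2) r(1,2)]
    define R where "R x = r x - v x" for x
    have RL: "R \<in> L2 L" unfolding R_def by (intro L2_diff r vL)
    have dL: "(\<lambda>x. w x - z x) \<in> L2 L" by (intro L2_diff w z)
    have primR: "prim L R x = prim L r x - prim L v x" for x
      using prim_add[OF L2_integrable[OF r(1)] L2_integrable[OF L2_cmult[OF vL, of "-1"]], of x]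
        prim_cmult[of L "-1" v x] by (simp add: R_def[abs_def])
    have wz': "AE x in M. w x - z x = (cw - c0) + prim L R x"
      using r(3) c0 by eventually_elim (simp add: primR)
    have \<sigma>M: "\<sigma> \<in> L2 L" unfolding \<sigma>_def by (rule L2_prim[OF \<eta>i])
    have i1: "integrable M (\<lambda>x. \<sigma> x * R x)" by (rule L2_mult_integrable[OF \<sigma>M RL])
    have i2: "integrable M (\<lambda>x. \<xi> x * (w x - z x))" by (rule L2_mult_integrable[OF \<xi> dL])
    have i3: "integrable M (\<lambda>x. \<eta> x * (w x - z x))" by (rule L2_mult_integrable[OF \<eta>L dL])
    have en: "energy v + (LINT x|M. \<sigma> x * R x) \<le> energy r"
    proof -
      have "energy v + (LINT x|M. \<sigma> x * R x) = (LINT x|M. (f \<epsilon> (v x) + \<nu>\<^sup>2 / 2 * (v x)\<^sup>2) + \<sigma> x * R x)"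
        unfolding energy_def by (rule Bochner_Integration.integral_add[symmetric, OF energy_integrable[OF vL] i1])
      also have "\<dots> \<le> energy r" unfolding energy_def
      proof (rule integral_mono_AE[OF Bochner_Integration.integrable_add[OF energy_integrable[OF vL] i1] energy_integrable[OF r(1)]])
        show "AE x in M. (f \<epsilon> (v x) + \<nu>\<^sup>2 / 2 * (v x)\<^sup>2) + \<sigma> x * R x \<le> f \<epsilon> (r x) + \<nu>\<^sup>2 / 2 * (r x)\<^sup>2"
          using sub wz(2) \<sigma>ae
        proof eventually_elim
          case (elim x)
          have 1: "f \<epsilon> (v x) + \<omega> x * (r x - v x) \<le> f \<epsilon> (r x)"
            using elim(1) unfolding subdifferential_def elim(2) by (simp add: inner_real_def)
          have "0 \<le> \<nu>\<^sup>2 / 2 * (r x - v x)\<^sup>2" by simp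
          then have 2: "\<nu>\<^sup>2 / 2 * (v x)\<^sup>2 + \<nu>\<^sup>2 * v x * (r x - v x) \<le> \<nu>\<^sup>2 / 2 * (r x)\<^sup>2"
            by (simp add: power2_eq_square algebra_simps)
          have "\<sigma> x * R x = \<omega> x * (r x - v x) + \<nu>\<^sup>2 * v x * (r x - v x)"
            using elim by (simp add: R_def distrib_right)
          then show ?case using 1 2 by linarith
        qed
      qed
      finally show ?thesis .
    qed
    have po: "potential z + (LINT x|M. \<xi> x * (w x - z x)) \<le> potential w"
    proof -
      have "potential z + (LINT x|M. \<xi> x * (w x - z x)) = (LINT x|M. pot (z x) + \<xi> x * (w x - z x))"
        unfolding potential_def by (rule Bochner_Integration.integral_add[symmetric, OF pot_integrable[OF z] i2])
      also have "\<dots> \<le> potential w" unfolding potential_def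
      proof (rule integral_mono_AE[OF Bochner_Integration.integrable_add[OF pot_integrable[OF z] i2] pot_integrable[OF w]])
        have "AE x in M. \<delta> = 0 \<longrightarrow> w x \<in> {-1..1}"
          using admissible_obstacle[OF fin(2)] by (cases "\<delta> = 0") auto
        with Ks show "AE x in M. pot (z x) + \<xi> x * (w x - z x) \<le> pot (w x)"
          by eventually_elim (rule K_set_ineq)
      qed
      finally show ?thesis .
    qed
    have "(LINT x|M. prim L \<eta> x * R x) + (LINT x|M. \<eta> x * prim L R x) = 0"
      using prim_integration_by_parts[OF \<eta>i L2_integrable[OF RL]] \<eta>L0 prim_right[of L L \<eta>] by simp
    moreover have "(LINT x|M. \<eta> x * (w x - z x)) = (LINT x|M. \<eta> x * prim L R x)"
    proof -
      have ip: "integrable M (\<lambda>x. \<eta> x * prim L R x)"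
        by (intro integrable_mult_continuous \<eta>i prim_continuous L2_integrable RL)
      have "(LINT x|M. \<eta> x * (w x - z x)) = (LINT x|M. (cw - c0) * \<eta> x + \<eta> x * prim L R x)"
      proof (rule integral_cong_AE)
        show "AE x in M. \<eta> x * (w x - z x) = (cw - c0) * \<eta> x + \<eta> x * prim L R x"
          using wz' by eventually_elim (simp add: distrib_left mult.commute)
      qed (use i3 ip \<eta>i in auto)
      also have "\<dots> = (cw - c0) * (LINT x|M. \<eta> x) + (LINT x|M. \<eta> x * prim L R x)"
        using \<eta>i ip by simp
      also have "(LINT x|M. \<eta> x) = 0" using \<eta>L0 prim_right[of L L \<eta>] by simp
      finally show ?thesis by simp
    qed
    moreover have "L2_inner L zs (\<lambda>x. w x - z x) = (LINT x|M. \<xi> x * (w x - z x)) - (LINT x|M. \<eta> x * (w x - z x))"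
    proof -
      have "L2_inner L zs (\<lambda>x. w x - z x) = (LINT x|M. \<xi> x * (w x - z x) - \<eta> x * (w x - z x))"
        unfolding L2_inner_def
      proof (rule integral_cong_AE)
        show "AE x in M. zs x * (w x - z x) = \<xi> x * (w x - z x) - \<eta> x * (w x - z x)"
          using zs\<xi> by eventually_elim (simp add: left_diff_distrib)
      qed (use i2 i3 L2_mult_integrable[OF zs dL] in auto)
      then show ?thesis using i2 i3 by simp
    qed
    ultimately have "energy v + potential z + L2_inner L zs (\<lambda>x. w x - z x) \<le> energy r + potential w"
      using en po by (simp add: \<sigma>p)
    then show ?thesis unfolding Pz Pw by simp
  qed
  then show ?thesis unfolding subdifferential_def
    using z zs Pz by (simp add: fun_diff_def)
qed

section \<open>First variation of a minimiser\<close>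

definition minimizer :: "(real \<Rightarrow> real) \<Rightarrow> real \<Rightarrow> (real \<Rightarrow> real) \<Rightarrow> bool" where
  "minimizer zs c0 v \<longleftrightarrow> admissible (\<lambda>x. c0 + prim L v x) \<and>
     (\<forall>c. \<forall>r\<in>L2 L. admissible (\<lambda>x. c + prim L r x) \<longrightarrow>
       energy v + potential (\<lambda>x. c0 + prim L v x)
         + (LINT x|M. zs x * ((c + prim L r x) - (c0 + prim L v x)))
       \<le> energy r + potential (\<lambda>x. c + prim L r x))"

lemma minimizerD:
  assumes "minimizer zs c0 v" "r \<in> L2 L" "admissible (\<lambda>x. c + prim L r x)"
  shows "energy v + potential (\<lambda>x. c0 + prim L v x)
      + (LINT x|M. zs x * ((c + prim L r x) - (c0 + prim L v x))) \<le> energy r + potential (\<lambda>x. c + prim L r x)"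
  using assms unfolding minimizer_def by blast

lemma subdifferential_minimum:
  assumes z: "z \<in> L2 L" and zs: "zs \<in> L2 L"
    and sub: "(z, zs) \<in> subdifferential (L2 L) (L2_inner L) \<Psi>"
  obtains v c0 where "v \<in> L2 L" "has_weak_deriv L z v" "AE x in M. z x = c0 + prim L v x"
    "minimizer zs c0 v"
proof -
  have fin: "\<Psi> z < \<infinity>"
    and min: "\<And>w. w \<in> L2 L \<Longrightarrow> \<Psi> z + ereal (L2_inner L zs (\<lambda>x. w x - z x)) \<le> \<Psi> w"
    using sub by (auto simp: subdifferential_def fun_diff_def)
  note zH = Psi_finite[OF z fin]
  obtain v c0 where v: "v \<in> L2 L" "has_weak_deriv L z v" "AE x in M. z x = c0 + prim L v x"
    using H1_obtain[OF L zH(1)] by metis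
  let ?Z = "\<lambda>x. c0 + prim L v x"
  have aZ: "admissible ?Z" unfolding admissible_def
  proof
    assume "\<delta> = 0"
    from v(3) admissible_obstacle[OF zH(2) this] show "AE x in M. c0 + prim L v x \<in> {-1..1}"
      by eventually_elim simp
  qed
  have ZL: "?Z \<in> L2 L" by (rule L2_prim[OF L2_integrable[OF v(1)]])
  have Zd: "has_weak_deriv L ?Z v"
    by (rule has_weak_deriv_prim[OF L L2_integrable[OF v(1)] L2_measurable[OF ZL], of c0]) simp
  have pz: "potential z = potential ?Z" unfolding potential_def
  proof (rule integral_cong_AE)
    show "AE x in M. pot (z x) = pot (c0 + prim L v x)" using v(3) by eventually_elim simp
  qed (use pot_integrable[OF z] pot_integrable[OF ZL] in auto)
  show ?thesis
  proof (rule that[OF v], unfold minimizer_def, intro conjI allI ballI impI)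
    show "admissible ?Z" by (rule aZ)
    fix c r assume r: "r \<in> L2 L" and a: "admissible (\<lambda>x. c + prim L r x)"
    let ?w = "\<lambda>x. c + prim L r x"
    have wL: "?w \<in> L2 L" by (rule L2_prim[OF L2_integrable[OF r]])
    have wd: "has_weak_deriv L ?w r"
      by (rule has_weak_deriv_prim[OF L L2_integrable[OF r] L2_measurable[OF wL], of c]) simp
    have wH: "?w \<in> H1 L" unfolding H1_def using wL wd r by auto
    have "L2_inner L zs (\<lambda>x. ?w x - z x) = (LINT x|M. zs x * (?w x - ?Z x))"
      unfolding L2_inner_def
    proof (rule integral_cong_AE)
      show "AE x in M. zs x * (?w x - z x) = zs x * (?w x - ?Z x)" using v(3) by eventually_elim simp
    qed (use L2_mult_integrable[OF zs L2_diff[OF wL z]] L2_mult_integrable[OF zs L2_diff[OF wL ZL]] in auto)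
    then show "energy v + potential ?Z + (LINT x|M. zs x * (?w x - ?Z x)) \<le> energy r + potential ?w"
      using min[OF wL] unfolding Psi_eq[OF zH v(1,2)] Psi_eq[OF wH a r wd] pz by simp
  qed
qed

lemma quotient_nonneg:
  fixes N t :: real
  assumes I: "integrand (f \<epsilon>) fl fr C"
    and zs: "zs \<in> L2 L" and v: "v \<in> L2 L" and Z: "Z \<in> L2 L" and w: "w \<in> L2 L"
    and p: "(\<lambda>x. v x + q x * t) \<in> L2 L"
    and min: "energy v + potential Z + (LINT x|M. zs x * (w x - Z x)) \<le> energy r + potential w"
    and le: "energy r \<le> energy (\<lambda>x. v x + q x * t)" and N: "0 \<le> N"
  shows "0 \<le> (LINT x|M. ((f \<epsilon> (v x + q x * t) + \<nu>\<^sup>2 / 2 * (v x + q x * t)\<^sup>2) - (f \<epsilon> (v x) + \<nu>\<^sup>2 / 2 * (v x)\<^sup>2)) * N)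
    + (LINT x|M. (pot (w x) - pot (Z x) - zs x * (w x - Z x)) * N)"
proof -
  interpret integrand "f \<epsilon>" fl fr C by (rule I)
  note i = energy_integrable[OF p, of \<nu>] energy_integrable[OF v, of \<nu>] pot_integrable[OF w] pot_integrable[OF Z]
    L2_mult_integrable[OF zs L2_diff[OF w Z]]
  have "0 \<le> ((energy (\<lambda>x. v x + q x * t) - energy v) + (potential w - potential Z - (LINT x|M. zs x * (w x - Z x)))) * N"
    using min le N by (intro mult_nonneg_nonneg) auto
  also have "\<dots> = (energy (\<lambda>x. v x + q x * t) - energy v) * N
      + (potential w - potential Z - (LINT x|M. zs x * (w x - Z x))) * N"
    by (rule distrib_right)
  also have "energy (\<lambda>x. v x + q x * t) - energy v =
      (LINT x|M. (f \<epsilon> (v x + q x * t) + \<nu>\<^sup>2 / 2 * (v x + q x * t)\<^sup>2) - (f \<epsilon> (v x) + \<nu>\<^sup>2 / 2 * (v x)\<^sup>2))"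
    unfolding energy_def by (rule Bochner_Integration.integral_diff[symmetric, OF i(1,2)])
  also have "potential w - potential Z - (LINT x|M. zs x * (w x - Z x)) =
      (LINT x|M. pot (w x) - pot (Z x) - zs x * (w x - Z x))"
    unfolding potential_def
    by (simp only: Bochner_Integration.integral_diff i Bochner_Integration.integrable_diff)
  finally show ?thesis by (simp only: integral_mult_left_zero)
qed

lemma bounded_integrable:
  assumes "q \<in> borel_measurable M" "\<And>x. \<bar>q x\<bar> \<le> (Q::real)"
  shows "q \<in> L2 L"
  using assms by (intro L2_bounded[of q L Q]) auto

text \<open>
  The competitors are \<open>Z + \<phi> / (n + 1)\<close>, where \<open>Z = c0 + \<integral> v\<close>. The potential differs from its linearisation at \<open>Z\<close>
  by a term of second order, which disappears in the limit.
\<close>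

lemma directional_smooth:
  assumes I: "integrand (f \<epsilon>) fl fr C" and \<delta>0: "\<delta> \<noteq> 0"
    and zs: "zs \<in> L2 L" and v: "v \<in> L2 L"
    and min: "minimizer zs c0 v"
    and qm: "q \<in> borel_measurable M" and qb: "\<And>x. \<bar>q x\<bar> \<le> Q"
    and l: "l = (\<lambda>x. K \<delta> (c0 + prim L v x) - zs x)"
  shows "l \<in> L2 L"
    and "0 \<le> (LINT x|M. max (q x * (fl (v x) + \<nu>\<^sup>2 * v x)) (q x * (fr (v x) + \<nu>\<^sup>2 * v x)))
      + (LINT x|M. max ((c + prim L q x) * l x) ((c + prim L q x) * l x))"
proof -
  interpret integrand "f \<epsilon>" fl fr C by (rule I)
  obtain CK where CK: "0 < CK" "continuous_on UNIV pot" "continuous_on UNIV (K \<delta>)"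
    "\<And>x y. pot x + K \<delta> x * (y - x) \<le> pot y"
    "\<And>x y. pot y - pot x - K \<delta> x * (y - x) \<le> CK * (y - x)\<^sup>2"
    "\<And>y. \<bar>K \<delta> y\<bar> \<le> CK * \<bar>y\<bar>"
    using pot_smooth[OF \<delta>0] by metis
  define Z where "Z x = c0 + prim L v x" for x
  have ZL: "Z \<in> L2 L" unfolding Z_def by (rule L2_prim[OF L2_integrable[OF v]])
  have KZ: "(\<lambda>x. K \<delta> (Z x)) \<in> L2 L"
  proof (rule L2_dominated[OF L2_cmult[OF ZL, of CK]])
    show "(\<lambda>x. K \<delta> (Z x)) \<in> borel_measurable M"
      by (rule measurable_compose[OF L2_measurable[OF ZL] borel_measurable_continuous_onI[OF CK(3)]])
    show "AE x in M. \<bar>K \<delta> (Z x)\<bar> \<le> \<bar>CK * Z x\<bar>" using CK(1) CK(6) by (simp add: abs_mult)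
  qed
  have lZ: "l x = K \<delta> (Z x) - zs x" for x by (simp add: l Z_def)
  show lL: "l \<in> L2 L" unfolding l Z_def[symmetric] by (rule L2_diff[OF KZ zs])
  have qL: "q \<in> L2 L" by (rule bounded_integrable[OF qm qb])
  note qi = L2_integrable[OF qL]
  define \<phi> where "\<phi> x = c + prim L q x" for x
  have \<phi>c: "continuous_on UNIV \<phi>" unfolding \<phi>_def by (intro continuous_intros prim_continuous qi)
  have \<phi>L: "\<phi> \<in> L2 L" unfolding \<phi>_def by (rule L2_prim[OF qi])
  define t where "t n = inverse (real (Suc n))" for n
  have t: "0 < t n" "t n \<le> 1" "t n * real (Suc n) = 1" for n
    by (simp_all add: t_def inverse_le_1_iff del: of_nat_Suc)
  have t0: "t \<longlonglongrightarrow> 0" unfolding t_def by (rule LIMSEQ_inverse_real_of_nat)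
  define w where "w n x = Z x + t n * \<phi> x" for n x
  have wL: "w n \<in> L2 L" for n unfolding w_def by (intro L2_add ZL L2_cmult \<phi>L)
  have pL: "(\<lambda>x. v x + q x * t n) \<in> L2 L" for n
    using L2_add[OF v L2_cmult[OF qL, of "t n"]] by (simp add: mult.commute)
  have w_eq: "w n x = (c0 + t n * c) + prim L (\<lambda>x. v x + q x * t n) x" for n x
  proof -
    have "prim L (\<lambda>x. v x + t n * q x) x = prim L v x + t n * prim L q x"
      using prim_add[OF L2_integrable[OF v] L2_integrable[OF L2_cmult[OF qL, of "t n"]], of x]
        prim_cmult[of L "t n" q x] by simp
    then show ?thesis by (simp add: w_def Z_def \<phi>_def algebra_simps)
  qed
  define B where "B n x = (pot (w n x) - pot (Z x) - zs x * (w n x - Z x)) * real (Suc n)" for n x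
  have Bd: "\<bar>B n x - \<phi> x * l x\<bar> \<le> CK * (\<phi> x)\<^sup>2 * t n" for n x
  proof -
    define e where "e = pot (w n x) - pot (Z x) - K \<delta> (Z x) * (w n x - Z x)"
    have e: "0 \<le> e" "e \<le> CK * (t n * \<phi> x)\<^sup>2"
      using CK(4)[of "Z x" "w n x"] CK(5)[of "w n x" "Z x"] by (simp_all add: e_def w_def)
    have "pot (w n x) - pot (Z x) - zs x * (w n x - Z x) = e + l x * (t n * \<phi> x)"
      by (simp add: e_def lZ w_def algebra_simps)
    then have "B n x = e * real (Suc n) + l x * \<phi> x * (t n * real (Suc n))"
      by (simp add: B_def distrib_right mult.assoc mult.left_commute del: of_nat_Suc)
    then have "B n x - \<phi> x * l x = e * real (Suc n)" using t(3) by (simp del: of_nat_Suc)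
    moreover have "e * real (Suc n) \<le> CK * (t n * \<phi> x)\<^sup>2 * real (Suc n)"
      by (rule mult_right_mono[OF e(2)]) simp
    moreover have "CK * (t n * \<phi> x)\<^sup>2 * real (Suc n) = CK * (\<phi> x)\<^sup>2 * t n * (t n * real (Suc n))"
      by (simp add: power2_eq_square algebra_simps del: of_nat_Suc)
    moreover have "0 \<le> e * real (Suc n)" using e(1) by simp
    ultimately show ?thesis using t(3) by (simp del: of_nat_Suc)
  qed
  have lim: "(\<lambda>n. B n x) \<longlonglongrightarrow> \<phi> x * l x" for x
  proof -
    have "(\<lambda>n. CK * (\<phi> x)\<^sup>2 * t n) \<longlonglongrightarrow> CK * (\<phi> x)\<^sup>2 * 0" by (intro tendsto_intros t0)
    then have "(\<lambda>n. CK * (\<phi> x)\<^sup>2 * t n) \<longlonglongrightarrow> 0" by simp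
    then have "(\<lambda>n. B n x - \<phi> x * l x) \<longlonglongrightarrow> 0"
      by (rule Lim_null_comparison[rotated]) (use Bd in simp)
    then show ?thesis by (simp add: LIM_zero_iff)
  qed
  have \<phi>l: "integrable M (\<lambda>x. \<phi> x * l x)" by (rule L2_mult_integrable[OF \<phi>L lL])
  have "0 \<le> (LINT x|M. max (q x * (fl (v x) + \<nu>\<^sup>2 * v x)) (q x * (fr (v x) + \<nu>\<^sup>2 * v x)))
      + (LINT x|M. \<phi> x * l x)"
  proof (rule first_variation[OF v qm qb, where B=B and W="\<lambda>x. \<bar>\<phi> x * l x\<bar> + CK * (\<phi> x)\<^sup>2" and D="\<lambda>x. \<phi> x * l x"])
    show "B n \<in> borel_measurable M" for n
      unfolding B_def
      by (intro borel_measurable_times borel_measurable_diff borel_measurable_const L2_measurable zs ZL wL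
          borel_measurable_integrable[OF pot_integrable[OF wL]] borel_measurable_integrable[OF pot_integrable[OF ZL]])
    show "integrable M (\<lambda>x. \<bar>\<phi> x * l x\<bar> + CK * (\<phi> x)\<^sup>2)"
      using \<phi>l \<phi>L by (intro Bochner_Integration.integrable_add integrable_abs integrable_mult_right) (auto simp: L2_def)
    show "AE x in M. \<bar>B n x\<bar> \<le> \<bar>\<phi> x * l x\<bar> + CK * (\<phi> x)\<^sup>2" for n
    proof (intro AE_I2)
      fix x
      have "CK * (\<phi> x)\<^sup>2 * t n \<le> CK * (\<phi> x)\<^sup>2 * 1" using CK(1) t by (intro mult_left_mono) auto
      then show "\<bar>B n x\<bar> \<le> \<bar>\<phi> x * l x\<bar> + CK * (\<phi> x)\<^sup>2" using Bd[of n x] by linarith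
    qed
    show "(\<lambda>x. \<phi> x * l x) \<in> borel_measurable M" "integrable M (\<lambda>x. \<phi> x * l x)" using \<phi>l by auto
    show "AE x in M. (\<lambda>n. B n x) \<longlonglongrightarrow> \<phi> x * l x" using lim by simp
    show "AE x in M. \<phi> x * l x \<le> \<phi> x * l x" by simp
    show "0 \<le> (LINT x|M. ((f \<epsilon> (v x + q x * inverse (real (Suc n))) + \<nu>\<^sup>2 / 2 * (v x + q x * inverse (real (Suc n)))\<^sup>2)
        - (f \<epsilon> (v x) + \<nu>\<^sup>2 / 2 * (v x)\<^sup>2)) * real (Suc n)) + (LINT x|M. B n x)" for n
      unfolding B_def t_def[symmetric]
    proof (rule quotient_nonneg[OF I zs v ZL wL pL])
      show "energy v + potential Z + (LINT x|M. zs x * (w n x - Z x)) \<le> energy (\<lambda>x. v x + q x * t n) + potential (w n)"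
        using minimizerD[OF min pL, of "c0 + t n * c" n] \<delta>0 unfolding w_eq[abs_def] Z_def[abs_def] admissible_def by blast
    qed auto
  qed
  then show "0 \<le> (LINT x|M. max (q x * (fl (v x) + \<nu>\<^sup>2 * v x)) (q x * (fr (v x) + \<nu>\<^sup>2 * v x)))
      + (LINT x|M. max ((c + prim L q x) * l x) ((c + prim L q x) * l x))"
    by (simp add: \<phi>_def)
qed

end

definition clip :: "real \<Rightarrow> real" where
  "clip y = max (-1) (min 1 y)"

lemma clip_range: "clip y \<in> {-1..1}"
  by (simp add: clip_def)

lemma clip_id: "y \<in> {-1..1} \<Longrightarrow> clip y = y"
  by (simp add: clip_def)

lemma clip_lipschitz: "\<bar>clip x - clip y\<bar> \<le> \<bar>x - y\<bar>"
  unfolding clip_def by linarith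

lemma clip_continuous: "continuous_on UNIV clip"
  unfolding clip_def[abs_def] by (intro continuous_intros)

text \<open>
  The increment of a truncation lies between zero and the increment of the function, hence between
  the integrals of \<open>min 0 r\<close> and \<open>max 0 r\<close>. So \<open>prim_between_density\<close> gives the chain rule in the form
  needed: an integrand that is smallest at zero and convex does not increase.
\<close>

lemma clip_prim:
  assumes r: "integrable (leb L) r"
  obtains \<rho> where "\<rho> \<in> borel_measurable (leb L)" "integrable (leb L) \<rho>"
    "\<And>x. x \<in> Om L \<Longrightarrow> min 0 (r x) \<le> \<rho> x \<and> \<rho> x \<le> max 0 (r x)"
    "\<And>x. clip (c + prim L r x) = clip c + prim L \<rho> x"
proof -
  let ?M = "leb L"
  let ?l = "\<lambda>x. min 0 (r x)" and ?u = "\<lambda>x. max 0 (r x)"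
  have l: "integrable ?M ?l" and u: "integrable ?M ?u" using r by auto
  have z: "integrable ?M (\<lambda>x. 0 :: real)" by simp
  have z0: "prim L (\<lambda>x. 0) y = 0" for y by (simp add: prim_def)
  have le: "prim L ?l y - prim L ?l x \<le> prim L r y - prim L r x" "prim L ?l y - prim L ?l x \<le> 0"
    "prim L r y - prim L r x \<le> prim L ?u y - prim L ?u x" "0 \<le> prim L ?u y - prim L ?u x" if "x \<le> y" for x y
    using prim_mono_increments[OF l r _ that] prim_mono_increments[OF l z _ that]
      prim_mono_increments[OF r u _ that] prim_mono_increments[OF z u _ that] by (simp_all add: z0)
  have clip_inc: "min 0 (b - a) \<le> clip b - clip a" "clip b - clip a \<le> max 0 (b - a)" for a b
    unfolding clip_def by linarith+
  obtain \<rho> where \<rho>: "\<rho> \<in> borel_measurable ?M" "integrable ?M \<rho>"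
    "\<And>x. x \<in> Om L \<Longrightarrow> ?l x \<le> \<rho> x \<and> \<rho> x \<le> ?u x"
    "\<And>x y. clip (c + prim L r y) - clip (c + prim L r x) = prim L \<rho> y - prim L \<rho> x"
  proof (rule prim_between_density[OF l u, where \<sigma>="\<lambda>x. clip (c + prim L r x)"])
    show "?l x \<le> ?u x" for x by simp
    fix x y :: real assume xy: "x \<le> y"
    show "prim L ?l y - prim L ?l x \<le> clip (c + prim L r y) - clip (c + prim L r x)"
      using clip_inc(1)[of "c + prim L r y" "c + prim L r x"] le(1,2)[OF xy] by linarith
    show "clip (c + prim L r y) - clip (c + prim L r x) \<le> prim L ?u y - prim L ?u x"
      using clip_inc(2)[of "c + prim L r y" "c + prim L r x"] le(3,4)[OF xy] by linarith
  qed (rule that)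
  have "clip (c + prim L r x) = clip c + prim L \<rho> x" for x
    using \<rho>(4)[of x "-L"] by (simp add: prim_left)
  with \<rho> show ?thesis by (intro that[of \<rho>]) auto
qed

lemma clip_quotient:
  assumes Z: "Z \<in> {-1..1}"
  shows "(\<lambda>n. (clip (Z + inverse (real (Suc n)) * p) - Z) * real (Suc n)) \<longlonglongrightarrow>
    p - max 0 p * indicator {1..} Z + max 0 (- p) * indicator {..-1} Z"
    (is "_ \<longlonglongrightarrow> ?d")
proof (rule tendsto_eventually)
  have t0: "(\<lambda>n. Z + inverse (real (Suc n)) * p) \<longlonglongrightarrow> Z"
    using tendsto_add[OF tendsto_const tendsto_mult[OF LIMSEQ_inverse_real_of_nat tendsto_const], of Z p] by simp
  have tN: "inverse (real (Suc n)) * p * real (Suc n) = p" for n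
  proof -
    have "inverse (real (Suc n)) * real (Suc n) = 1" by (rule left_inverse) simp
    then show ?thesis by (metis mult.assoc mult.commute mult_1)
  qed
  have inside: "(clip (Z + inverse (real (Suc n)) * p) - Z) * real (Suc n) = p"
    if "Z + inverse (real (Suc n)) * p \<in> {-1..1}" for n
  proof -
    have "clip (Z + inverse (real (Suc n)) * p) - Z = inverse (real (Suc n)) * p"
      unfolding clip_id[OF that] by simp
    then show ?thesis using tN by simp
  qed
  have sgn: "0 \<le> p \<Longrightarrow> 0 \<le> inverse (real (Suc n)) * p" "p \<le> 0 \<Longrightarrow> inverse (real (Suc n)) * p \<le> 0" for n
    by (simp_all add: mult_nonneg_nonpos del: of_nat_Suc)
  consider "p = 0" | "p > 0" "Z < 1" | "p > 0" "Z = 1" | "p < 0" "-1 < Z" | "p < 0" "Z = -1"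
    using Z by fastforce
  then show "\<forall>\<^sub>F n in sequentially. (clip (Z + inverse (real (Suc n)) * p) - Z) * real (Suc n) = ?d"
  proof cases
    case 1
    then show ?thesis using Z by (simp add: clip_id)
  next
    case 2
    then have d: "?d = p" by (simp add: indicator_def)
    from order_tendstoD(2)[OF t0 2(2)] show ?thesis
    proof eventually_elim
      case (elim n)
      have "Z + inverse (real (Suc n)) * p \<in> {-1..1}"
        unfolding atLeastAtMost_iff
        using sgn(1)[OF less_imp_le[OF 2(1)], of n] elim Z[unfolded atLeastAtMost_iff] by linarith
      then show ?case unfolding d by (rule inside)
    qed
  next
    case 3
    have "clip (Z + inverse (real (Suc n)) * p) = 1" for n
      using sgn(1)[of n] 3 by (simp add: clip_def del: of_nat_Suc)
    then show ?thesis using 3 by (simp add: indicator_def)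
  next
    case 4
    then have d: "?d = p" by (simp add: indicator_def)
    from order_tendstoD(1)[OF t0 4(2)] show ?thesis
    proof eventually_elim
      case (elim n)
      have "Z + inverse (real (Suc n)) * p \<in> {-1..1}"
        unfolding atLeastAtMost_iff
        using sgn(2)[OF less_imp_le[OF 4(1)], of n] elim Z[unfolded atLeastAtMost_iff] by linarith
      then show ?case unfolding d by (rule inside)
    qed
  next
    case 5
    have "clip (Z + inverse (real (Suc n)) * p) = -1" for n
      using sgn(2)[of n] 5 by (simp add: clip_def del: of_nat_Suc)
    then show ?thesis using 5 by (simp add: indicator_def)
  qed
qed

context problem
begin

text \<open>
  The competitors are the truncations of \<open>Z + \<phi> / (n + 1)\<close>, where \<open>Z = c0 + \<integral> v\<close>. In the limit a variation that
  points out of \<open>[-1, 1]\<close> is suppressed on the contact set, and the term \<open>- z\<^sup>* \<phi>\<close> drops out there. The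
  bounds \<open>l\<close> and \<open>u\<close> are those of an exact penalisation: where \<open>Z = 1\<close> the reaction
  \<open>\<xi> = \<sigma>' + z\<^sup>*\<close> may take any value in \<open>[0, max 0 z\<^sup>*]\<close>. The positive part is what keeps \<open>l \<le> u\<close>
  where \<open>Z = 1\<close> and \<open>z\<^sup>* < 0\<close>.
\<close>

lemma directional_obstacle:
  assumes I: "integrand (f \<epsilon>) fl fr C" and \<delta>0: "\<delta> = 0"
    and zs: "zs \<in> L2 L" and v: "v \<in> L2 L"
    and min: "minimizer zs c0 v"
    and qm: "q \<in> borel_measurable M" and qb: "\<And>x. \<bar>q x\<bar> \<le> Q"
    and l: "l = (\<lambda>x. - zs x - max 0 (- zs x) * indicator {..-1} (c0 + prim L v x))"
    and u: "u = (\<lambda>x. - zs x + max 0 (zs x) * indicator {1..} (c0 + prim L v x))"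
  shows "l \<in> L2 L" "u \<in> L2 L"
    and "0 \<le> (LINT x|M. max (q x * (fl (v x) + \<nu>\<^sup>2 * v x)) (q x * (fr (v x) + \<nu>\<^sup>2 * v x)))
      + (LINT x|M. max ((c + prim L q x) * l x) ((c + prim L q x) * u x))"
proof -
  interpret integrand "f \<epsilon>" fl fr C by (rule I)
  define Z where "Z x = c0 + prim L v x" for x
  have ZL: "Z \<in> L2 L" unfolding Z_def by (rule L2_prim[OF L2_integrable[OF v]])
  have Zm: "Z \<in> borel_measurable M" by (rule L2_measurable[OF ZL])
  have zm: "zs \<in> borel_measurable M" by (rule L2_measurable[OF zs])
  have adm: "admissible (\<lambda>x. c0 + prim L v x)" using min by (simp add: minimizer_def)
  have Zadm: "AE x in M. Z x \<in> {-1..1}" using admissible_obstacle[OF adm \<delta>0] by (simp add: Z_def)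
  have indm: "(\<lambda>x. indicator S (Z x) :: real) \<in> borel_measurable M" if "S \<in> sets borel" for S
    by (rule measurable_compose[OF Zm borel_measurable_indicator[OF that]])
  show lL: "l \<in> L2 L"
  proof (rule L2_dominated[OF zs])
    show "l \<in> borel_measurable M" unfolding l Z_def[symmetric]
      by (intro borel_measurable_diff borel_measurable_times borel_measurable_max borel_measurable_const
          borel_measurable_uminus zm indm) simp
    show "AE x in M. \<bar>l x\<bar> \<le> \<bar>zs x\<bar>" by (intro AE_I2) (auto simp: l indicator_def max_def)
  qed
  show uL: "u \<in> L2 L"
  proof (rule L2_dominated[OF zs])
    show "u \<in> borel_measurable M" unfolding u Z_def[symmetric]
      by (intro borel_measurable_add borel_measurable_times borel_measurable_max borel_measurable_const
          borel_measurable_uminus zm indm) simp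
    show "AE x in M. \<bar>u x\<bar> \<le> \<bar>zs x\<bar>" by (intro AE_I2) (auto simp: u indicator_def max_def)
  qed
  have qL: "q \<in> L2 L" by (rule bounded_integrable[OF qm qb])
  note qi = L2_integrable[OF qL]
  define \<phi> where "\<phi> x = c + prim L q x" for x
  have \<phi>L: "\<phi> \<in> L2 L" unfolding \<phi>_def by (rule L2_prim[OF qi])
  have \<phi>m: "\<phi> \<in> borel_measurable M" by (rule L2_measurable[OF \<phi>L])
  define t where "t n = inverse (real (Suc n))" for n
  have t: "0 < t n" "t n * real (Suc n) = 1" for n
    by (simp_all add: t_def del: of_nat_Suc)
  have pL: "(\<lambda>x. v x + q x * t n) \<in> L2 L" for n
    using L2_add[OF v L2_cmult[OF qL, of "t n"]] by (simp add: mult.commute)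
  have y_eq: "(c0 + t n * c) + prim L (\<lambda>x. v x + q x * t n) x = Z x + t n * \<phi> x" for n x
  proof -
    have "prim L (\<lambda>x. v x + t n * q x) x = prim L v x + t n * prim L q x"
      using prim_add[OF L2_integrable[OF v] L2_integrable[OF L2_cmult[OF qL, of "t n"]], of x]
        prim_cmult[of L "t n" q x] by simp
    then show ?thesis by (simp add: Z_def \<phi>_def algebra_simps)
  qed
  define w where "w n x = clip (Z x + t n * \<phi> x)" for n x
  have wm: "w n \<in> borel_measurable M" for n unfolding w_def
    by (intro measurable_compose[OF _ borel_measurable_continuous_onI[OF clip_continuous]]
        borel_measurable_add borel_measurable_times borel_measurable_const Zm \<phi>m)
  have wL: "w n \<in> L2 L" for n
  proof (rule L2_bounded[OF wm])
    show "AE x in M. \<bar>w n x\<bar> \<le> 1" by (intro AE_I2) (use clip_range in \<open>auto simp: w_def abs_le_iff\<close>)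
  qed
  define B where "B n x = (pot (w n x) - pot (Z x) - zs x * (w n x - Z x)) * real (Suc n)" for n x
  have B_eq: "B n x = - zs x * ((w n x - Z x) * real (Suc n))" for n x
    unfolding B_def pot_obstacle[OF \<delta>0] by (simp del: of_nat_Suc)
  define D where "D x = - zs x * (\<phi> x - max 0 (\<phi> x) * indicator {1..} (Z x) + max 0 (- \<phi> x) * indicator {..-1} (Z x))" for x
  have E: "integrable M (\<lambda>x. max (\<phi> x * l x) (\<phi> x * u x))"
    by (intro integrable_max L2_mult_integrable \<phi>L lL uL)
  have "0 \<le> (LINT x|M. max (q x * (fl (v x) + \<nu>\<^sup>2 * v x)) (q x * (fr (v x) + \<nu>\<^sup>2 * v x)))
      + (LINT x|M. max (\<phi> x * l x) (\<phi> x * u x))"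
  proof (rule first_variation[OF v qm qb, where B=B and W="\<lambda>x. \<bar>zs x * \<phi> x\<bar>" and D=D])
    show "B n \<in> borel_measurable M" for n
      unfolding B_eq[abs_def]
      by (intro borel_measurable_times borel_measurable_diff borel_measurable_const borel_measurable_uminus zm wm Zm)
    show "integrable M (\<lambda>x. \<bar>zs x * \<phi> x\<bar>)" by (intro integrable_abs L2_mult_integrable zs \<phi>L)
    show "AE x in M. \<bar>B n x\<bar> \<le> \<bar>zs x * \<phi> x\<bar>" for n
      using Zadm
    proof eventually_elim
      case (elim x)
      have "\<bar>w n x - Z x\<bar> \<le> \<bar>t n * \<phi> x\<bar>"
        using clip_lipschitz[of "Z x + t n * \<phi> x" "Z x"] by (simp add: w_def clip_id[OF elim])
      then have "\<bar>w n x - Z x\<bar> * real (Suc n) \<le> \<bar>t n * \<phi> x\<bar> * real (Suc n)" by (rule mult_right_mono) simp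
      also have "\<dots> = \<bar>\<phi> x\<bar> * (t n * real (Suc n))"
        using t(1)[of n] by (simp add: abs_mult mult.assoc mult.left_commute del: of_nat_Suc)
      also have "\<dots> = \<bar>\<phi> x\<bar>" unfolding t(2) by simp
      finally have "\<bar>w n x - Z x\<bar> * real (Suc n) \<le> \<bar>\<phi> x\<bar>" .
      then have "\<bar>zs x\<bar> * (\<bar>w n x - Z x\<bar> * real (Suc n)) \<le> \<bar>zs x\<bar> * \<bar>\<phi> x\<bar>" by (rule mult_left_mono) simp
      then show ?case by (simp add: B_eq abs_mult del: of_nat_Suc)
    qed
    show "D \<in> borel_measurable M" unfolding D_def
      by (intro borel_measurable_add borel_measurable_diff borel_measurable_times borel_measurable_max borel_measurable_const
          borel_measurable_uminus zm \<phi>m indm) simp_all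
    show "AE x in M. (\<lambda>n. B n x) \<longlonglongrightarrow> D x"
      using Zadm
    proof eventually_elim
      case (elim x)
      show ?case unfolding B_eq D_def w_def t_def
        by (intro tendsto_mult[OF tendsto_const] clip_quotient elim)
    qed
    show "AE x in M. D x \<le> max (\<phi> x * l x) (\<phi> x * u x)"
    proof (intro AE_I2)
      fix x
      show "D x \<le> max (\<phi> x * l x) (\<phi> x * u x)"
      proof (cases "0 \<le> \<phi> x")
        case \<phi>: True
        have "D x \<le> \<phi> x * u x"
        proof (cases "1 \<le> Z x")
          case True
          then have "D x = 0" "u x = - zs x + max 0 (zs x)"
            using \<phi> by (simp_all add: D_def u Z_def indicator_def)
          then show ?thesis using mult_nonneg_nonneg[OF \<phi>, of "- zs x + max 0 (zs x)"] by simp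
        next
          case False
          then show ?thesis using \<phi> by (simp add: D_def u Z_def indicator_def)
        qed
        then show ?thesis by simp
      next
        case False
        then have \<phi>: "\<phi> x \<le> 0" by simp
        have "D x \<le> \<phi> x * l x"
        proof (cases "Z x \<le> -1")
          case True
          then have "D x = 0" "l x = - zs x - max 0 (- zs x)"
            using \<phi> by (simp_all add: D_def l Z_def indicator_def)
          then show ?thesis using mult_nonpos_nonpos[OF \<phi>, of "- zs x - max 0 (- zs x)"] by simp
        next
          case False
          then show ?thesis using \<phi> by (simp add: D_def l Z_def indicator_def)
        qed
        then show ?thesis by simp
      qed
    qed
    show "integrable M (\<lambda>x. max (\<phi> x * l x) (\<phi> x * u x))" by (rule E)
    fix n
    show "0 \<le> (LINT x|M. ((f \<epsilon> (v x + q x * inverse (real (Suc n))) + \<nu>\<^sup>2 / 2 * (v x + q x * inverse (real (Suc n)))\<^sup>2)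
        - (f \<epsilon> (v x) + \<nu>\<^sup>2 / 2 * (v x)\<^sup>2)) * real (Suc n)) + (LINT x|M. B n x)"
    proof -
      obtain \<rho> where \<rho>: "\<rho> \<in> borel_measurable M" and "integrable M \<rho>"
        and \<rho>2:
        "\<And>x. x \<in> Om L \<Longrightarrow> min 0 (v x + q x * t n) \<le> \<rho> x \<and> \<rho> x \<le> max 0 (v x + q x * t n)"
        and \<rho>3: "\<And>x. clip ((c0 + t n * c) + prim L (\<lambda>x. v x + q x * t n) x) = clip (c0 + t n * c) + prim L \<rho> x"
        by (rule clip_prim[where r="\<lambda>x. v x + q x * t n" and c="c0 + t n * c", OF L2_integrable[OF pL]], rule that)
      have w_eq: "w n x = clip (c0 + t n * c) + prim L \<rho> x" for x
        using \<rho>3[of x] unfolding y_eq w_def .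
      have \<rho>abs: "\<bar>\<rho> x\<bar> \<le> \<bar>v x + q x * t n\<bar>" if "x \<in> Om L" for x
        using \<rho>2[OF that] by (auto simp: min_def max_def split: if_splits)
      have \<rho>L: "\<rho> \<in> L2 L"
        by (rule L2_dominated[OF pL[of n] \<rho>]) (use \<rho>abs in \<open>auto intro!: AE_I2\<close>)
      have le: "energy \<rho> \<le> energy (\<lambda>x. v x + q x * t n)"
        unfolding energy_def
      proof (rule integral_mono[OF energy_integrable[OF \<rho>L] energy_integrable[OF pL]])
        fix x assume "x \<in> space M"
        then have x: "x \<in> Om L" by simp
        have "f \<epsilon> (\<rho> x) \<le> f \<epsilon> (v x + q x * t n)" using \<rho>2[OF x] by (intro g_mono) auto
        moreover have "(\<rho> x)\<^sup>2 \<le> (v x + q x * t n)\<^sup>2" using \<rho>abs[OF x] by (simp add: abs_le_square_iff)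
        then have "\<nu>\<^sup>2 / 2 * (\<rho> x)\<^sup>2 \<le> \<nu>\<^sup>2 / 2 * (v x + q x * t n)\<^sup>2" by (rule mult_left_mono) simp
        ultimately show "f \<epsilon> (\<rho> x) + \<nu>\<^sup>2 / 2 * (\<rho> x)\<^sup>2 \<le> f \<epsilon> (v x + q x * t n) + \<nu>\<^sup>2 / 2 * (v x + q x * t n)\<^sup>2"
          by linarith
      qed
      have wadm: "admissible (w n)" unfolding admissible_def w_def using clip_range by (auto intro!: AE_I2)
      have m: "energy v + potential Z + (LINT x|M. zs x * (w n x - Z x)) \<le> energy \<rho> + potential (w n)"
        using minimizerD[OF min \<rho>L, of "clip (c0 + t n * c)"] wadm unfolding w_eq[abs_def] Z_def[abs_def] by blast
      show ?thesis unfolding B_def t_def[symmetric]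
        by (rule quotient_nonneg[OF I zs v ZL wL pL m le]) simp
    qed
  qed
  then show "0 \<le> (LINT x|M. max (q x * (fl (v x) + \<nu>\<^sup>2 * v x)) (q x * (fr (v x) + \<nu>\<^sup>2 * v x)))
      + (LINT x|M. max ((c + prim L q x) * l x) ((c + prim L q x) * u x))"
    by (simp add: \<phi>_def)
qed

section \<open>Necessity of the conditions\<close>

lemma reaction_bounds:
  assumes I: "integrand (f \<epsilon>) fl fr C"
    and zs: "zs \<in> L2 L" and v: "v \<in> L2 L"
    and min: "minimizer zs c0 v"
  obtains l u where "\<And>x. l x \<le> u x" "l \<in> L2 L" "u \<in> L2 L"
    "\<forall>q c. q \<in> borel_measurable M \<longrightarrow> (\<exists>Q. \<forall>x. \<bar>q x\<bar> \<le> Q) \<longrightarrow>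
      0 \<le> (LINT x|M. max (q x * (fl (v x) + \<nu>\<^sup>2 * v x)) (q x * (fr (v x) + \<nu>\<^sup>2 * v x)))
        + (LINT x|M. max ((c + prim L q x) * l x) ((c + prim L q x) * u x))"
    "AE x in M. \<forall>y. l x \<le> y \<and> y \<le> u x \<longrightarrow> y + zs x \<in> K_set Khat K \<delta> (c0 + prim L v x)"
proof (cases "\<delta> = 0")
  case False
  note d = directional_smooth[OF I False zs v min _ _ refl]
  show ?thesis
  proof (rule that)
    show "(\<lambda>x. K \<delta> (c0 + prim L v x) - zs x) \<in> L2 L" "(\<lambda>x. K \<delta> (c0 + prim L v x) - zs x) \<in> L2 L"
      by (rule d(1)[of "\<lambda>x. 0" 0]; simp)+
    show "AE x in M. \<forall>y. K \<delta> (c0 + prim L v x) - zs x \<le> y \<and> y \<le> K \<delta> (c0 + prim L v x) - zs x \<longrightarrow>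
        y + zs x \<in> K_set Khat K \<delta> (c0 + prim L v x)"
      using False by (intro AE_I2) (auto simp: K_set_def)
  qed (use d(2) in auto)
next
  case True
  let ?Z = "\<lambda>x. c0 + prim L v x"
  let ?l = "\<lambda>x. - zs x - max 0 (- zs x) * indicator {..-1} (?Z x)"
  let ?u = "\<lambda>x. - zs x + max 0 (zs x) * indicator {1..} (?Z x)"
  note d = directional_obstacle[OF I True zs v min _ _ refl refl]
  show ?thesis
  proof (rule that[of ?l ?u])
    show "?l \<in> L2 L" "?u \<in> L2 L" by (rule d(1)[of "\<lambda>x. 0" 0] d(2)[of "\<lambda>x. 0" 0]; simp)+
    show "?l x \<le> ?u x" for x by (simp add: indicator_def)
    have adm: "admissible ?Z" using min by (simp add: minimizer_def)
    show "AE x in M. \<forall>y. ?l x \<le> y \<and> y \<le> ?u x \<longrightarrow> y + zs x \<in> K_set Khat K \<delta> (?Z x)"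
      using admissible_obstacle[OF adm True]
    proof eventually_elim
      case (elim x)
      show ?case
      proof (intro allI impI)
        fix y assume y: "?l x \<le> y \<and> y \<le> ?u x"
        have pos: "?Z x < 1 \<Longrightarrow> y + zs x \<le> 0" and neg: "-1 < ?Z x \<Longrightarrow> 0 \<le> y + zs x"
          using y by (auto simp: indicator_def)
        have "(y + zs x) * (w - ?Z x) \<le> 0" if w: "w \<in> {-1..1}" for w
        proof -
          consider "?Z x = 1" | "?Z x = -1" | "-1 < ?Z x" "?Z x < 1" using elim by fastforce
          then show ?thesis
          proof cases
            case 1
            then show ?thesis using neg w by (intro mult_nonneg_nonpos) auto
          next
            case 2
            then show ?thesis using pos w by (intro mult_nonpos_nonneg) auto
          next
            case 3
            then have "y + zs x = 0" using pos neg by simp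
            then show ?thesis by simp
          qed
        qed
        then show "y + zs x \<in> K_set Khat K \<delta> (?Z x)"
          using elim True unfolding K_set_def subdifferential_def Khat_ext_def by auto
      qed
    qed
  qed (use d(3) in auto)
qed

end

text \<open>
  The hypothesis \<open>mono\<close> is the monotonicity of \<open>\<partial>f\<close> for \<open>\<omega> = \<sigma> - \<nu>\<^sup>2 v\<close>, \<open>\<sigma> = \<integral> \<eta>\<close>. It yields
  \<open>\<nu>\<^sup>2 \<bar>v t - v s\<bar> \<le> \<bar>\<sigma> t - \<sigma> s\<bar>\<close>, so \<open>prim_interpolation\<close> with \<open>a = b = v\<close> and slopes bounded by
  \<open>\<bar>\<eta>\<bar> / \<nu>\<^sup>2\<close> represents \<open>v\<close> by a primitive.
\<close>

lemma derivative_regular: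
  assumes L: "0 < L" and \<nu>: "0 < \<nu>" and v: "v \<in> L2 L" and \<eta>: "\<eta> \<in> L2 L"
    and S: "AE x in leb L. x \<in> S" and Sne: "S \<noteq> {}"
    and mono: "\<And>s t. s \<in> S \<Longrightarrow> t \<in> S \<Longrightarrow>
      0 \<le> ((prim L \<eta> t - \<nu>\<^sup>2 * v t) - (prim L \<eta> s - \<nu>\<^sup>2 * v s)) * (v t - v s)"
  shows "v \<in> H1 L"
proof -
  let ?M = "leb L"
  define u where "u x = 1 / \<nu>\<^sup>2 * \<bar>\<eta> x\<bar>" for x
  define l where "l x = - 1 * u x" for x
  have uL: "u \<in> L2 L" unfolding u_def by (intro L2_cmult L2_abs \<eta>)
  have lL: "l \<in> L2 L" unfolding l_def by (intro L2_cmult uL)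
  have u0: "0 \<le> u x" for x by (simp add: u_def)
  have lu: "l x \<le> u x" for x using u0[of x] by (simp add: l_def)
  have inc: "\<bar>prim L \<eta> t - prim L \<eta> s\<bar> \<le> \<nu>\<^sup>2 * \<bar>prim L u t - prim L u s\<bar>" if "s \<le> t" for s t
  proof -
    note \<eta>i = L2_integrable[OF \<eta>] and ui = L2_integrable[OF uL]
    have "\<bar>prim L \<eta> t - prim L \<eta> s\<bar> \<le> (LINT x|?M. \<bar>\<eta> x * indicator {s<..t} x\<bar>)"
      unfolding prim_diff[OF \<eta>i that] by (rule integral_abs_bound)
    also have "\<dots> = (LINT x|?M. \<nu>\<^sup>2 * (u x * indicator {s<..t} x))"
      using \<nu> by (intro Bochner_Integration.integral_cong refl) (simp add: u_def abs_mult)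
    also have "\<dots> = \<nu>\<^sup>2 * (prim L u t - prim L u s)"
      unfolding prim_diff[OF ui that] by simp
    also have "\<dots> \<le> \<nu>\<^sup>2 * \<bar>prim L u t - prim L u s\<bar>" by (rule mult_left_mono) auto
    finally show ?thesis .
  qed
  have inc': "\<bar>prim L \<eta> t - prim L \<eta> s\<bar> \<le> \<nu>\<^sup>2 * \<bar>prim L u t - prim L u s\<bar>" for s t
    using inc[of s t] inc[of t s] by (cases "s \<le> t") (auto simp: abs_minus_commute)
  have lip: "\<nu>\<^sup>2 * \<bar>v t - v s\<bar> \<le> \<bar>prim L \<eta> t - prim L \<eta> s\<bar>" if "s \<in> S" "t \<in> S" for s t
  proof (cases "v t = v s")
    case False
    have "\<nu>\<^sup>2 * (v t - v s) * (v t - v s) \<le> (prim L \<eta> t - prim L \<eta> s) * (v t - v s)"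
      using mono[OF that] by (simp add: algebra_simps)
    also have "\<dots> \<le> \<bar>prim L \<eta> t - prim L \<eta> s\<bar> * \<bar>v t - v s\<bar>" by (metis abs_ge_self abs_mult)
    finally have "(\<nu>\<^sup>2 * \<bar>v t - v s\<bar>) * \<bar>v t - v s\<bar> \<le> \<bar>prim L \<eta> t - prim L \<eta> s\<bar> * \<bar>v t - v s\<bar>"
      by (simp add: mult.assoc)
    then show ?thesis by (rule mult_right_le_imp_le) (use False in simp)
  qed simp
  have ab: "v t \<le> v s + max (prim L u t - prim L u s) (prim L l t - prim L l s)" if "s \<in> S" "t \<in> S" for s t
  proof -
    have "\<nu>\<^sup>2 * \<bar>v t - v s\<bar> \<le> \<nu>\<^sup>2 * \<bar>prim L u t - prim L u s\<bar>" using lip[OF that] inc'[of t s] by linarith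
    then have "\<bar>v t - v s\<bar> \<le> \<bar>prim L u t - prim L u s\<bar>" by (rule mult_left_le_imp_le) (use \<nu> in simp)
    moreover have "prim L l x = - prim L u x" for x using prim_cmult[of L "-1" u x] by (simp add: l_def[abs_def])
    ultimately show ?thesis by simp
  qed
  obtain P \<theta> where P: "integrable ?M \<theta>" "\<And>x. x \<in> Om L \<Longrightarrow> l x \<le> \<theta> x \<and> \<theta> x \<le> u x"
    "\<And>x y. P y - P x = prim L \<theta> y - prim L \<theta> x" "\<And>t. t \<in> S \<Longrightarrow> v t \<le> P t \<and> P t \<le> v t"
    by (rule prim_interpolation[where a=v and b=v, OF L2_integrable[OF lL] L2_integrable[OF uL] lu Sne ab],
        assumption, assumption, rule that)
  have \<theta>L: "\<theta> \<in> L2 L"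
  proof (rule L2_dominated[OF uL])
    show "\<theta> \<in> borel_measurable ?M" using P(1) by auto
    show "AE x in ?M. \<bar>\<theta> x\<bar> \<le> \<bar>u x\<bar>"
    proof (intro AE_I2)
      fix x assume "x \<in> space ?M"
      then show "\<bar>\<theta> x\<bar> \<le> \<bar>u x\<bar>" using P(2)[of x] u0[of x] by (auto simp: l_def abs_le_iff)
    qed
  qed
  have "AE x in ?M. v x = P (-L) + prim L \<theta> x"
    using S
  proof eventually_elim
    case (elim x)
    then show ?case using P(4)[of x] P(3)[of x "-L"] by (simp add: prim_left)
  qed
  then show ?thesis unfolding H1_iff_prim[OF L] using v \<theta>L by auto
qed

context problem
begin

text \<open>
  The multiplier \<open>\<sigma> = \<integral> \<eta>\<close> gives \<open>\<omega> = \<sigma> - \<nu>\<^sup>2 v\<close> and \<open>\<xi> = \<eta> + z\<^sup>*\<close>.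
\<close>

lemma necessity:
  assumes z: "z \<in> L2 L" and zs: "zs \<in> L2 L"
    and sub: "(z, zs) \<in> subdifferential (L2 L) (L2_inner L) \<Psi>"
  shows "\<exists>\<omega>\<in>H1 L \<inter> Linf L. \<exists>\<xi>\<in>L2 L.
       z \<in> H2 L \<and>
       cont_rep L (\<lambda>x. \<omega> x + \<nu>\<^sup>2 * weak_deriv L z x) L = 0 \<and>
       cont_rep L (\<lambda>x. \<omega> x + \<nu>\<^sup>2 * weak_deriv L z x) (-L) = 0 \<and>
       (AE x in M. zs x = - weak_deriv L \<omega> x - \<nu>\<^sup>2 * weak_deriv L (weak_deriv L z) x + \<xi> x) \<and>
       (AE x in M. (weak_deriv L z x, \<omega> x) \<in> subdifferential_real (\<lambda>r. ereal (f \<epsilon> r))) \<and>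
       (AE x in M. \<xi> x \<in> K_set Khat K \<delta> (z x))"
proof -
  obtain fl fr C where I: "integrand (f \<epsilon>) fl fr C" using f_family_integrand[OF f \<epsilon>] .
  interpret integrand "f \<epsilon>" fl fr C by (rule I)
  obtain v c0 where v: "v \<in> L2 L" "has_weak_deriv L z v" "AE x in M. z x = c0 + prim L v x"
    and min: "minimizer zs c0 v"
    by (rule subdifferential_minimum[OF z zs sub])
  obtain l u where le: "\<And>x. l x \<le> u x" and lu: "l \<in> L2 L" "u \<in> L2 L"
    and dir: "\<forall>q c. q \<in> borel_measurable M \<longrightarrow> (\<exists>Q. \<forall>x. \<bar>q x\<bar> \<le> Q) \<longrightarrow>
      0 \<le> (LINT x|M. max (q x * (fl (v x) + \<nu>\<^sup>2 * v x)) (q x * (fr (v x) + \<nu>\<^sup>2 * v x)))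
        + (LINT x|M. max ((c + prim L q x) * l x) ((c + prim L q x) * u x))"
    and react: "AE x in M. \<forall>y. l x \<le> y \<and> y \<le> u x \<longrightarrow> y + zs x \<in> K_set Khat K \<delta> (c0 + prim L v x)"
    by (rule reaction_bounds[OF I zs v(1) min], rule that)
  have aL: "(\<lambda>x. fl (v x) + \<nu>\<^sup>2 * v x) \<in> L2 L" by (rule slope_L2[OF v(1) fl_borel f_bound(1)])
  have bL: "(\<lambda>x. fr (v x) + \<nu>\<^sup>2 * v x) \<in> L2 L" by (rule slope_L2[OF v(1) fr_borel f_bound(2)])
  obtain \<eta> where \<eta>: "integrable M \<eta>" "prim L \<eta> L = 0"
    "\<And>x. x \<in> Om L \<Longrightarrow> l x \<le> \<eta> x \<and> \<eta> x \<le> u x"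
    "AE x in M. fl (v x) + \<nu>\<^sup>2 * v x \<le> prim L \<eta> x \<and> prim L \<eta> x \<le> fr (v x) + \<nu>\<^sup>2 * v x"
  proof (rule multiplier_exists[OF L L2_integrable[OF aL] L2_integrable[OF bL] L2_integrable[OF lu(1)] L2_integrable[OF lu(2)]])
    show "fl (v x) + \<nu>\<^sup>2 * v x \<le> fr (v x) + \<nu>\<^sup>2 * v x" for x using fl_le_fr by simp
    show "l x \<le> u x" for x by (rule le)
    fix q :: "real \<Rightarrow> real" and c assume q: "q \<in> borel_measurable M" "\<exists>C. \<forall>x. \<bar>q x\<bar> \<le> C"
    from dir[rule_format, OF q] show "0 \<le> (LINT x|M. max (q x * (fl (v x) + \<nu>\<^sup>2 * v x)) (q x * (fr (v x) + \<nu>\<^sup>2 * v x)))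
        + (LINT x|M. max ((c + prim L q x) * l x) ((c + prim L q x) * u x))" .
  qed (rule that)
  have \<eta>L: "\<eta> \<in> L2 L"
  proof (rule L2_dominated[OF L2_add[OF L2_abs[OF lu(1)] L2_abs[OF lu(2)]]])
    show "\<eta> \<in> borel_measurable M" using \<eta>(1) by auto
    show "AE x in M. \<bar>\<eta> x\<bar> \<le> \<bar>\<bar>l x\<bar> + \<bar>u x\<bar>\<bar>"
    proof (intro AE_I2)
      fix x assume "x \<in> space M"
      then have "l x \<le> \<eta> x \<and> \<eta> x \<le> u x" by (intro \<eta>(3)) simp
      then show "\<bar>\<eta> x\<bar> \<le> \<bar>\<bar>l x\<bar> + \<bar>u x\<bar>\<bar>" by linarith
    qed
  qed
  define S where "S = {x. fl (v x) \<le> prim L \<eta> x - \<nu>\<^sup>2 * v x \<and> prim L \<eta> x - \<nu>\<^sup>2 * v x \<le> fr (v x)}"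
  have S: "AE x in M. x \<in> S" using \<eta>(4) by eventually_elim (simp add: S_def)
  have Sne: "S \<noteq> {}" using AE_Om_ex[OF S] by auto
  have vH: "v \<in> H1 L"
  proof (rule derivative_regular[OF L \<nu> v(1) \<eta>L S Sne])
    fix s t assume "s \<in> S" "t \<in> S"
    then have "f \<epsilon> (v s) + (prim L \<eta> s - \<nu>\<^sup>2 * v s) * (v t - v s) \<le> f \<epsilon> (v t)"
      "f \<epsilon> (v t) + (prim L \<eta> t - \<nu>\<^sup>2 * v t) * (v s - v t) \<le> f \<epsilon> (v s)"
      by (auto simp: S_def intro!: subgradient)
    then show "0 \<le> ((prim L \<eta> t - \<nu>\<^sup>2 * v t) - (prim L \<eta> s - \<nu>\<^sup>2 * v s)) * (v t - v s)"
      by (simp add: algebra_simps)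
  qed
  obtain v' c1 where v': "v' \<in> L2 L" "AE x in M. v x = c1 + prim L v' x"
    using vH unfolding H1_iff_prim[OF L] by auto
  define \<omega> where "\<omega> x = prim L \<eta> x - \<nu>\<^sup>2 * v x" for x
  define \<omega>' where "\<omega>' x = \<eta> x - \<nu>\<^sup>2 * v' x" for x
  have \<omega>'L: "\<omega>' \<in> L2 L" unfolding \<omega>'_def by (intro L2_diff L2_cmult \<eta>L v')
  have prim\<omega>': "prim L \<omega>' x = prim L \<eta> x - \<nu>\<^sup>2 * prim L v' x" for x
    using prim_add[OF \<eta>(1) L2_integrable[OF L2_cmult[OF v'(1), of "-(\<nu>\<^sup>2)"]], of x] prim_cmult[of L "-(\<nu>\<^sup>2)" v' x]
    by (simp add: \<omega>'_def[abs_def])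
  have \<omega>L: "\<omega> \<in> L2 L" unfolding \<omega>_def
    using L2_diff[OF L2_prim[OF \<eta>(1), of 0] L2_cmult[OF v(1), of "\<nu>\<^sup>2"]] by simp
  have \<omega>ae: "AE x in M. \<omega> x = - (\<nu>\<^sup>2 * c1) + prim L \<omega>' x"
    using v'(2) by eventually_elim (simp add: \<omega>_def prim\<omega>' distrib_left)
  have \<omega>H: "\<omega> \<in> H1 L"
    unfolding H1_iff_prim[OF L] by (intro conjI \<omega>L bexI[OF _ \<omega>'L] exI) (rule \<omega>ae)
  have \<omega>d: "has_weak_deriv L \<omega> \<omega>'"
    by (rule has_weak_deriv_prim[OF L L2_integrable[OF \<omega>'L] L2_measurable[OF \<omega>L] \<omega>ae])
  have \<omega>inf: "\<omega> \<in> Linf L"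
  proof -
    have "AE x in M. \<bar>\<omega> x\<bar> \<le> \<bar>\<nu>\<^sup>2 * c1\<bar> + (LINT y|M. \<bar>\<omega>' y\<bar>)"
      using \<omega>ae
    proof eventually_elim
      case (elim x)
      then show ?case using prim_bounded[OF L2_integrable[OF \<omega>'L], of x] by linarith
    qed
    then show ?thesis unfolding Linf_def using L2_measurable[OF \<omega>L] by auto
  qed
  define \<xi> where "\<xi> x = \<eta> x + zs x" for x
  have \<xi>L: "\<xi> \<in> L2 L" unfolding \<xi>_def by (rule L2_add[OF \<eta>L zs])
  note wz = weak_deriv_AE[OF v(2)]
  have wd2: "has_weak_deriv L (weak_deriv L z) v'"
  proof (rule has_weak_deriv_prim[OF L L2_integrable[OF v'(1)] wz(3)])
    show "AE x in M. weak_deriv L z x = c1 + prim L v' x"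
      using wz(2) v'(2) by eventually_elim simp
  qed
  have zH2: "z \<in> H2 L" unfolding H2_def using z vH v(2) by auto
  have pc: "continuous_on {-L..L} (prim L \<eta>)" by (rule continuous_on_subset[OF prim_continuous[OF \<eta>(1)]]) simp
  have pae: "AE x in M. prim L \<eta> x = \<omega> x + \<nu>\<^sup>2 * weak_deriv L z x"
    using wz(2) by eventually_elim (simp add: \<omega>_def)
  have bc: "cont_rep L (\<lambda>x. \<omega> x + \<nu>\<^sup>2 * weak_deriv L z x) L = 0"
    "cont_rep L (\<lambda>x. \<omega> x + \<nu>\<^sup>2 * weak_deriv L z x) (-L) = 0"
    using cont_rep_eq[OF L pc pae, of L] cont_rep_eq[OF L pc pae, of "-L"] L \<eta>(2) by (simp_all add: prim_left)
  have eq: "AE x in M. zs x = - weak_deriv L \<omega> x - \<nu>\<^sup>2 * weak_deriv L (weak_deriv L z) x + \<xi> x"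
    using weak_deriv_AE(2)[OF \<omega>d] weak_deriv_AE(2)[OF wd2]
    by eventually_elim (simp add: \<omega>'_def \<xi>_def)
  have sg: "AE x in M. (weak_deriv L z x, \<omega> x) \<in> subdifferential_real (\<lambda>r. ereal (f \<epsilon> r))"
    using S wz(2)
  proof eventually_elim
    case (elim x)
    then have "f \<epsilon> (v x) + \<omega> x * (q - v x) \<le> f \<epsilon> q" for q
      by (intro subgradient) (simp_all add: S_def \<omega>_def)
    then show ?case unfolding subdifferential_def using elim(2) by (simp add: inner_real_def)
  qed
  have Ks: "AE x in M. \<xi> x \<in> K_set Khat K \<delta> (z x)"
    using react v(3) AE_space
  proof eventually_elim
    case (elim x)
    then have "l x \<le> \<eta> x \<and> \<eta> x \<le> u x" by (intro \<eta>(3)) simp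
    then show ?case using elim(1,2) by (simp add: \<xi>_def)
  qed
  show ?thesis
  proof (intro bexI conjI)
    show "\<omega> \<in> H1 L \<inter> Linf L" using \<omega>H \<omega>inf by simp
    show "\<xi> \<in> L2 L" by (rule \<xi>L)
  qed (use zH2 bc eq sg Ks in auto)
qed

end

theorem mainTheorem1:
  fixes L \<nu> \<epsilon> \<delta> :: real
    and f Khat K :: "real \<Rightarrow> real \<Rightarrow> real"
    and z zs :: "real \<Rightarrow> real"
  assumes "0 < L" and "0 < \<nu>"
    and "f_family f" and "K_family Khat K"
    and "\<epsilon> \<in> {0..1}" and "\<delta> \<in> {0..1}"
    and "z \<in> L2 L" and "zs \<in> L2 L"
  shows "(z, zs) \<in> subdifferential (L2 L) (L2_inner L) (Psi L \<nu> f Khat \<epsilon> \<delta>) \<longleftrightarrow>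
    (\<exists>\<omega>\<in>H1 L \<inter> Linf L. \<exists>\<xi>\<in>L2 L.
       z \<in> H2 L \<and>
       cont_rep L (\<lambda>x. \<omega> x + \<nu>\<^sup>2 * weak_deriv L z x) L = 0 \<and>
       cont_rep L (\<lambda>x. \<omega> x + \<nu>\<^sup>2 * weak_deriv L z x) (-L) = 0 \<and>
       (AE x in lebesgue_on (Om L).
          zs x = - weak_deriv L \<omega> x - \<nu>\<^sup>2 * weak_deriv L (weak_deriv L z) x + \<xi> x) \<and>
       (AE x in lebesgue_on (Om L).
          (weak_deriv L z x, \<omega> x) \<in> subdifferential_real (\<lambda>r. ereal (f \<epsilon> r))) \<and>
       (AE x in lebesgue_on (Om L). \<xi> x \<in> K_set Khat K \<delta> (z x)))"
proof -
  interpret problem L \<nu> \<epsilon> \<delta> f Khat K using assms by unfold_locales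
  show ?thesis
    by (rule iffI, erule necessity[OF assms(7,8)], elim bexE conjE, rule sufficiency[OF assms(7,8)])
qed

end
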